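(* In the monoid of characters of $\mathbb{K}[\mathcal{NCP}]$ for $\star$, $\lambda=\mu_{\mathcal{NCP}}\star\lambda^s\star\gamma_{-1}$ and $\mu=\gamma_{-1}\star\mu^s\star\mu_{\mathcal{NCP}}$. Moreover, for any noncrossing partition $\pi$, $$\mu(\pi)=\sum_{\substack{\sim\in\mathcal{E}_c[\pi],\\ \pi/\sim\,=\,\mathrm{Base}(\pi/\sim)}}(-1)^{\mathrm{cl}(\sim)}\mu_{\mathcal{NCP}}(\pi\mid_\cdot\sim),$$ where $\mathrm{cl}(\sim)$ is the number of classes of $\sim$.
   Context: $\mathbb{K}$ is a field of characteristic zero. A noncrossing partition is a partition $\pi$ of a set $[n]=\{1,\ldots,n\}$, $n\ge1$, into nonempty blocks such that there are no distinct blocks $b\ne b'$ and $x,z\in b$, $y,t\in b'$ with $x<y<z<t$. $|\pi|$ is its number of blocks; $\mathcal{NCP}$ is the set of all noncrossing partitions. For a nonempty set $Y$ of blocks of $\pi$, $\pi_{\mid Y}$ is the noncrossing partition obtained by deleting the blocks not in $Y$ and renumbering the remaining elements increasingly; $\pi_{\mid\emptyset}=1$. The nesting order on blocks is $b\le_\pi b'\iff b'\subseteq[\min b,\max b]$; $\mathrm{Base}(\pi)$ is the set of blocks of $\pi$ minimal for $\le_\pi$. An ideal of $\pi$ is a set $J$ of blocks that is upward closed for $\le_\pi$; then the union of its blocks decomposes into maximal subsets of consecutive integers $I_1,\ldots,I_k$, each a union of blocks, and $\pi_{\mid_\cdot J}=\prod_i\pi_{\mid I_i}$ (restriction to the blocks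 contained in $I_i$; product $\cdot$ below). $\mathbb{K}[\mathcal{NCP}]$ is the free commutative algebra generated by $\mathcal{NCP}$, with product $\cdot$ and unit $1$. It carries two coproducts which are algebra morphisms, given on $\pi\in\mathcal{NCP}$ by $\Delta(\pi)=\sum_{J\text{ ideal of }\pi}\pi_{\mid\pi\setminus J}\otimes\pi_{\mid_\cdot J}$ and $\delta(\pi)=\sum_{\sim\in\mathcal{E}_c[\pi]}\pi/\!\sim\,\otimes\,\pi\mid_\cdot\sim$, where, for an equivalence $\sim$ on the set of blocks of $\pi$, $\pi/\!\sim$ is the partition whose blocks are the unions of the blocks in each class, $\mathcal{E}_c[\pi]$ is the set of $\sim$ for which $\pi/\!\sim$ is noncrossing, and $\pi\mid_\cdot\sim=\prod_{C\text{ class of }\sim}\pi_{\mid C}$. The counits are the algebra morphisms with $\varepsilon_\Delta(\pi)=0$, and $\epsilon_\delta(\pi)=1$ if $|\pi|=1$, $\epsilon_\delta(\pi)=0$ otherwise. $(\mathbb{K}[\mathcal{NCP}],\cdot,\Delta)$ is a Hopf algebra. $\mathbb{K}[X]$ has the multiplicative coproducts $\Delta(X)=X\otimes1+1\otimes X$, $\delta(X)=X\otimes X$ with counits $P\mapsto P(0)$, $P\mapsto P(1)$. $\phi_{\mathcal{NCP}}:\mathbb{K}[\mathcal{NCP}]\to\mathbb{K}[X]$ is the unique algebra morphism compatible with both coproducts $\Delta,\delta$ and both counits (it exists and is unique by known results). The character $\mu_{\mathcal{NCP}}$ is $\mu_{\mathcal{NCP}}(x)=\phi_{\mathcal{NCP}}(x)(-1)$;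 by known results it is the inverse of $\epsilon_\delta$ for the convolution $(\lambda\otimes\lambda')\circ\Delta$, and the antipode of $(\mathbb{K}[\mathcal{NCP}],\cdot,\Delta)$ is $S=(\mu_{\mathcal{NCP}}\otimes\mathrm{Id})\circ\delta$. Characters of $\mathbb{K}[\mathcal{NCP}]$ (algebra morphisms to $\mathbb{K}$) form a monoid under $\alpha\star\beta=(\alpha\otimes\beta)\circ\delta$, with unit $\epsilon_\delta$; a character is invertible for $\star$ if and only if it does not vanish on noncrossing partitions with one block. The characters $\lambda$, $\lambda^s$, $\gamma_{-1}$ are given on $\pi\in\mathcal{NCP}$ by: $\lambda(\pi)=1$; $\lambda^s(\pi)=1$ if $\pi=\mathrm{Base}(\pi)$ and $0$ otherwise; $\gamma_{-1}(\pi)=-1$ if $|\pi|=1$ and $0$ otherwise. $\mu$ and $\mu^s$ are the inverses for $\star$ of $\lambda$ and $\lambda^s$ respectively. *)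

theory Defs
  imports
    "HOL-Library.Multiset"
    "HOL-Library.Disjoint_Sets"
    "HOL-Library.Product_Plus"
    "HOL-Library.Poly_Mapping"
    "HOL-Computational_Algebra.Polynomial"
begin

section \<open>Noncrossing partitions\<close>

definition noncrossing :: "nat set set \<Rightarrow> bool" where
  "noncrossing P \<longleftrightarrow>
     \<not> (\<exists>b\<in>P. \<exists>b'\<in>P. b \<noteq> b' \<and>
          (\<exists>x\<in>b. \<exists>z\<in>b. \<exists>y\<in>b'. \<exists>t\<in>b'. x < y \<and> y < z \<and> z < t))"

typedef ncp = "{P :: nat set set. (\<exists>n\<ge>1. partition_on {1..n} P) \<and> noncrossing P}"
  morphisms blocks ncp_of
proof
  have "partition_on {1..1} {{1::nat}}"
    by (auto simp: partition_on_def)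
  then show "{{1::nat}} \<in> {P. (\<exists>n\<ge>1. partition_on {1..n} P) \<and> noncrossing P}"
    by (auto simp: noncrossing_def)
qed

text \<open>Increasing renumbering of the elements of a set of blocks.\<close>
definition renumber :: "nat set set \<Rightarrow> nat set set" where
  "renumber Y = (`) (\<lambda>x. card {y \<in> \<Union>Y. y \<le> x}) ` Y"

text \<open>
  The restriction to a nonempty set of blocks \<open>Y\<close> of a noncrossing partition; the value at
  \<open>Y = {}\<close> is meaningless and never used.
\<close>
definition restrict_ncp :: "nat set set \<Rightarrow> ncp" where
  "restrict_ncp Y = ncp_of (renumber Y)"

definition nest_le :: "nat set \<Rightarrow> nat set \<Rightarrow> bool" where
  "nest_le b b' \<longleftrightarrow> b' \<subseteq> {Min b..Max b}"

definition Base :: "ncp \<Rightarrow> nat set set" where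
  "Base p = {b \<in> blocks p. \<forall>b' \<in> blocks p. nest_le b' b \<longrightarrow> b' = b}"

definition ideals :: "ncp \<Rightarrow> nat set set set" where
  "ideals p = {J. J \<subseteq> blocks p \<and> (\<forall>b\<in>J. \<forall>b'\<in>blocks p. nest_le b b' \<longrightarrow> b' \<in> J)}"

definition components :: "nat set \<Rightarrow> nat set set" where
  "components S = {I. I \<noteq> {} \<and> I \<subseteq> S \<and> (\<exists>a b. I = {a..b}) \<and>
     (\<forall>a b. I \<subseteq> {a..b} \<and> {a..b} \<subseteq> S \<longrightarrow> {a..b} = I)}"

definition merge :: "ncp \<Rightarrow> (nat set \<times> nat set) set \<Rightarrow> nat set set" where
  "merge p r = Union ` (blocks p // r)"

definition nc_equivs :: "ncp \<Rightarrow> (nat set \<times> nat set) set set" where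
  "nc_equivs p = {r. equiv (blocks p) r \<and> noncrossing (merge p r)}"

definition quot_ncp :: "ncp \<Rightarrow> (nat set \<times> nat set) set \<Rightarrow> ncp" where
  "quot_ncp p r = ncp_of (merge p r)"

section \<open>The free commutative algebra and its tensor square\<close>

text \<open>
  The free commutative algebra on \<^typ>\<open>ncp\<close> is the monoid algebra of the free commutative monoid
  of multisets. Its tensor square is free on pairs of monomials, hence is the monoid algebra of
  the product monoid, with the tensor of two monomials as basis element.
\<close>
type_synonym 'k alg = "ncp multiset \<Rightarrow>\<^sub>0 'k"
type_synonym 'k alg2 = "ncp multiset \<times> ncp multiset \<Rightarrow>\<^sub>0 'k"

definition mon :: "'m \<Rightarrow> ('m \<Rightarrow>\<^sub>0 'k::comm_ring_1)" where
  "mon m = Poly_Mapping.single m 1"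

definition scalar :: "'k \<Rightarrow> ('m::comm_monoid_add \<Rightarrow>\<^sub>0 'k::comm_ring_1)" where
  "scalar c = Poly_Mapping.single 0 c"

abbreviation gen :: "ncp \<Rightarrow> 'k::comm_ring_1 alg" where
  "gen p \<equiv> mon {#p#}"

text \<open>The restriction to a possibly empty set of blocks, as a monomial.\<close>
definition restr_mon :: "nat set set \<Rightarrow> ncp multiset" where
  "restr_mon Y = (if Y = {} then {#} else {#restrict_ncp Y#})"

definition restr_ideal_mon :: "nat set set \<Rightarrow> ncp multiset" where
  "restr_ideal_mon J =
     image_mset (\<lambda>I. restrict_ncp {b \<in> J. b \<subseteq> I}) (mset_set (components (\<Union>J)))"

definition restr_equiv_mon :: "ncp \<Rightarrow> (nat set \<times> nat set) set \<Rightarrow> ncp multiset" where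
  "restr_equiv_mon p r = image_mset restrict_ncp (mset_set (blocks p // r))"

text \<open>
  Commutative algebras over \<open>'k\<close> are given by their structure maps \<open>\<iota>\<close>; a unital algebra
  morphism is a ring homomorphism compatible with these (unitality is the case \<open>c = 1\<close>).
\<close>
definition algebra_hom ::
  "('k \<Rightarrow> 'a) \<Rightarrow> ('k \<Rightarrow> 'b) \<Rightarrow> ('a::comm_ring_1 \<Rightarrow> 'b::comm_ring_1) \<Rightarrow> bool" where
  "algebra_hom \<iota> \<iota>' f \<longleftrightarrow>
     (\<forall>x y. f (x + y) = f x + f y) \<and> (\<forall>x y. f (x * y) = f x * f y) \<and> (\<forall>c. f (\<iota> c) = \<iota>' c)"

text \<open>The algebra morphism with prescribed values on the generators.\<close>
definition free_ext ::
  "('k \<Rightarrow> 'b) \<Rightarrow> (ncp \<Rightarrow> 'b) \<Rightarrow> 'k::comm_ring_1 alg \<Rightarrow> 'b::comm_ring_1" where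
  "free_ext \<iota> f x =
     (\<Sum>m\<in>Poly_Mapping.keys x. \<iota> (Poly_Mapping.lookup x m) * (\<Prod>p\<in>#m. f p))"

definition Delta :: "'k::comm_ring_1 alg \<Rightarrow> 'k alg2" where
  "Delta = free_ext scalar
     (\<lambda>p. \<Sum>J\<in>ideals p. mon (restr_mon (blocks p - J), restr_ideal_mon J))"

definition delta :: "'k::comm_ring_1 alg \<Rightarrow> 'k alg2" where
  "delta = free_ext scalar
     (\<lambda>p. \<Sum>r\<in>nc_equivs p. mon ({#quot_ncp p r#}, restr_equiv_mon p r))"

definition eps_Delta :: "'k::comm_ring_1 alg \<Rightarrow> 'k" where
  "eps_Delta = free_ext id (\<lambda>p. 0)"

definition eps_delta :: "'k::comm_ring_1 alg \<Rightarrow> 'k" where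
  "eps_delta = free_ext id (\<lambda>p. if card (blocks p) = 1 then 1 else 0)"

section \<open>Characters\<close>

definition is_character :: "('k::comm_ring_1 alg \<Rightarrow> 'k) \<Rightarrow> bool" where
  "is_character \<alpha> \<longleftrightarrow> algebra_hom scalar id \<alpha>"

text \<open>
  The linear map on the tensor square induced by a pair of linear maps, followed by a bilinear
  pairing \<open>B\<close> into an algebra with structure map \<open>\<iota>\<close>.
\<close>
definition tensor_ext ::
  "('k \<Rightarrow> 'c) \<Rightarrow> ('b \<Rightarrow> 'b \<Rightarrow> 'c) \<Rightarrow> ('k alg \<Rightarrow> 'b) \<Rightarrow> ('k alg \<Rightarrow> 'b) \<Rightarrow>
     'k::comm_ring_1 alg2 \<Rightarrow> 'c::comm_ring_1" where
  "tensor_ext \<iota> B f g t =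
     (\<Sum>(m, m')\<in>Poly_Mapping.keys t. \<iota> (Poly_Mapping.lookup t (m, m')) * B (f (mon m)) (g (mon m')))"

definition star ::
  "('k alg \<Rightarrow> 'k) \<Rightarrow> ('k alg \<Rightarrow> 'k) \<Rightarrow> 'k::comm_ring_1 alg \<Rightarrow> 'k"  (infixl \<open>\<star>\<close> 70) where
  "\<alpha> \<star> \<beta> = tensor_ext id (*) \<alpha> \<beta> \<circ> delta"

definition star_inverse :: "('k::comm_ring_1 alg \<Rightarrow> 'k) \<Rightarrow> 'k alg \<Rightarrow> 'k" where
  "star_inverse \<alpha> = (THE \<beta>. is_character \<beta> \<and> \<alpha> \<star> \<beta> = eps_delta \<and> \<beta> \<star> \<alpha> = eps_delta)"

definition lam :: "'k::comm_ring_1 alg \<Rightarrow> 'k" where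
  "lam = free_ext id (\<lambda>p. 1)"

definition lam_s :: "'k::comm_ring_1 alg \<Rightarrow> 'k" where
  "lam_s = free_ext id (\<lambda>p. if blocks p = Base p then 1 else 0)"

definition gamma_m1 :: "'k::comm_ring_1 alg \<Rightarrow> 'k" where
  "gamma_m1 = free_ext id (\<lambda>p. if card (blocks p) = 1 then - 1 else 0)"

definition mu :: "'k::comm_ring_1 alg \<Rightarrow> 'k" where
  "mu = star_inverse lam"

definition mu_s :: "'k::comm_ring_1 alg \<Rightarrow> 'k" where
  "mu_s = star_inverse lam_s"

section \<open>The double bialgebra morphism to polynomials\<close>

text \<open>
  The tensor square of \<^typ>\<open>'k poly\<close> is represented by \<^typ>\<open>'k poly poly\<close>: the left factor
  provides the coefficients, the right factor the outer variable.
\<close>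
definition poly_tensor :: "'k::comm_ring_1 poly \<Rightarrow> 'k poly \<Rightarrow> 'k poly poly" where
  "poly_tensor P Q = smult P (map_poly (\<lambda>c. [:c:]) Q)"

definition poly_X :: "'k::comm_ring_1 poly" where
  "poly_X = [:0, 1:]"

definition poly2_at :: "'k::comm_ring_1 poly poly \<Rightarrow> 'k poly \<Rightarrow> 'k poly poly" where
  "poly2_at t P = poly (map_poly (\<lambda>c. [:[:c:]:]) P) t"

definition poly_Delta :: "'k::comm_ring_1 poly \<Rightarrow> 'k poly poly" where
  "poly_Delta = poly2_at (poly_tensor poly_X 1 + poly_tensor 1 poly_X)"

definition poly_delta :: "'k::comm_ring_1 poly \<Rightarrow> 'k poly poly" where
  "poly_delta = poly2_at (poly_tensor poly_X poly_X)"

definition tensor_map ::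
  "('k alg \<Rightarrow> 'k poly) \<Rightarrow> ('k alg \<Rightarrow> 'k poly) \<Rightarrow> 'k::comm_ring_1 alg2 \<Rightarrow> 'k poly poly" where
  "tensor_map = tensor_ext (\<lambda>c. [:[:c:]:]) poly_tensor"

definition double_bialgebra_hom :: "('k::comm_ring_1 alg \<Rightarrow> 'k poly) \<Rightarrow> bool" where
  "double_bialgebra_hom \<phi> \<longleftrightarrow>
     algebra_hom scalar (\<lambda>c. [:c:]) \<phi> \<and>
     tensor_map \<phi> \<phi> \<circ> Delta = poly_Delta \<circ> \<phi> \<and>
     tensor_map \<phi> \<phi> \<circ> delta = poly_delta \<circ> \<phi> \<and>
     (\<forall>x. poly (\<phi> x) 0 = eps_Delta x) \<and>
     (\<forall>x. poly (\<phi> x) 1 = eps_delta x)"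

definition phi_NCP :: "'k::field_char_0 alg \<Rightarrow> 'k poly" where
  "phi_NCP = (THE \<phi>. double_bialgebra_hom \<phi>)"

definition mu_NCP :: "'k::field_char_0 alg \<Rightarrow> 'k" where
  "mu_NCP x = poly (phi_NCP x) (- 1)"

end

theory Submission
  imports Defs "HOL-Library.FuncSet"
begin

text \<open>
  The proof combines three facts. First, evaluating the double bialgebra morphism \<open>\<phi>\<close> at a scalar
  gives a character \<open>\<phi>\<^sub>a\<close>, and compatibility with the coproducts means \<open>\<phi>\<^sub>a\<^sub>+\<^sub>b = \<phi>\<^sub>a * \<phi>\<^sub>b\<close> and
  \<open>\<phi>\<^sub>a\<^sub>b = \<phi>\<^sub>a \<star> \<phi>\<^sub>b\<close>, where \<open>*\<close> is the convolution product for \<open>\<Delta>\<close>. As \<open>\<phi>\<^sub>0\<close> and \<open>\<phi>\<^sub>1\<close> are the counits,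
  \<open>\<mu>\<^sub>N\<^sub>C\<^sub>P = \<phi>\<^sub>-\<^sub>1\<close> is inverse to \<open>\<epsilon>\<^sub>\<delta>\<close> for \<open>*\<close> and satisfies \<open>\<mu>\<^sub>N\<^sub>C\<^sub>P \<star> \<mu>\<^sub>N\<^sub>C\<^sub>P = \<epsilon>\<^sub>\<delta>\<close>. Second, the coproducts
  cointeract: \<open>(\<alpha> * \<beta>) \<star> \<gamma> = (\<alpha> \<star> \<gamma>) * (\<beta> \<star> \<gamma>)\<close> (\<open>star_conv_distrib\<close>). Third, the ideals of \<open>\<pi>\<close> without
  nested blocks are the sets of maximal blocks of \<open>\<pi>\<close>, so an alternating sum over subsets shows that
  \<open>\<lambda> * \<kappa> = \<epsilon>\<^sub>\<Delta>\<close> for \<open>\<kappa> = \<lambda>\<^sup>s \<star> \<gamma>\<^sub>-\<^sub>1\<close> (\<open>conv_lam\<close>).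

  By cointeraction, \<open>(\<mu>\<^sub>N\<^sub>C\<^sub>P \<star> \<kappa>) * \<kappa> = (\<mu>\<^sub>N\<^sub>C\<^sub>P * \<epsilon>\<^sub>\<delta>) \<star> \<kappa> = \<epsilon>\<^sub>\<Delta> = \<lambda> * \<kappa>\<close>, and \<open>\<kappa>\<close> can be cancelled because
  \<open>*\<close> is triangular with respect to the number of blocks. This is the factorization of \<open>\<lambda>\<close>, and
  inverting it for \<open>\<star>\<close> gives the one of \<open>\<mu>\<close>. For the explicit sum, \<open>\<mu>\<^sup>s(\<pi>)\<close> is \<open>(-1)^(|\<pi>| - 1)\<close> if
  \<open>\<pi>\<close> is flat, that is \<open>\<pi> = Base(\<pi>)\<close>, and \<open>0\<close> otherwise: the flat coarsenings of a flat partition with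
  \<open>k\<close> blocks correspond to the subsets of its \<open>k - 1\<close> inner end points.

  The morphism \<open>\<phi>\<close> is obtained from its values at natural numbers. These must be the convolution
  powers of \<open>\<epsilon>\<^sub>\<delta>\<close>. They are polynomial in the exponent (\<open>eps_power_polynomial\<close>), and coassociativity
  of \<open>\<Delta>\<close> and the cointeraction give the exponent laws for sums and products, which are the two
  compatibilities (\<open>ex1_double_bialgebra_hom\<close>).

  Coassociativity of both coproducts and the cointeraction are proved for functions on
  families of blocks that need not cover an initial segment of the natural numbers
  (\<open>cstar_assoc\<close>, \<open>cconv_assoc\<close>, \<open>cstar_cconv\<close>). There a quotient \<open>\<pi>/\<sim>\<close> becomes a coarsening, an ideal
  is described by its complement, and its components become gaps, that is, sets of elements with
  the same elements of the complement to their left. Each of the three identities then compares two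
  ways of summing over chains, and rests on the fact that coarsenings, or lower parts, can be
  chosen independently in the blocks of a coarser family. Invariance under increasing relabelling
  transports the identities to characters.
\<close>

section \<open>Noncrossing families and coarsenings\<close>

text \<open>
  Families are not required to partition an initial segment: restricting to some of the blocks
  then needs no renumbering, and the empty family plays the role of the unit monomial.
\<close>
definition ncfam :: "nat set set \<Rightarrow> bool" where
  "ncfam P \<longleftrightarrow> finite (\<Union>P) \<and> partition_on (\<Union>P) P \<and> noncrossing P"

definition inside :: "nat set set \<Rightarrow> nat set \<Rightarrow> nat set set" where
  "inside P B = {b \<in> P. b \<subseteq> B}"

text \<open>
  The partitions \<open>\<pi>/\<sim>\<close>. An equivalence with noncrossing quotient and its quotient determine each
  other, and chains of quotients are easier to handle as chains of coarsenings.
\<close>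
definition coarsenings :: "nat set set \<Rightarrow> nat set set set" where
  "coarsenings P = {R. noncrossing R \<and> refines (\<Union>P) P R}"

definition cut :: "nat set \<Rightarrow> nat \<Rightarrow> nat set" where
  "cut W x = {k \<in> W. k < x}"

text \<open>
  When \<open>W\<close> and \<open>U\<close> partition \<open>{1..n}\<close>, these classes are the maximal intervals contained in \<open>U\<close>.
  Describing them by the elements of \<open>W\<close> to their left makes sense for any finite sets, so no
  interval has to be mentioned and the description survives passing to subfamilies.
\<close>
definition gaps :: "nat set \<Rightarrow> nat set \<Rightarrow> nat set set" where
  "gaps W U = (\<lambda>x. {y \<in> U. cut W y = cut W x}) ` U"

text \<open>
  These are the complements of ideals: by noncrossingness, a block outside \<open>K\<close> meets two different
  gaps of \<open>K\<close> exactly if some block of \<open>K\<close> is nested in it.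
\<close>
definition lowers :: "nat set set \<Rightarrow> nat set set set" where
  "lowers P = {K. K \<subseteq> P \<and> (\<forall>b\<in>P - K. \<forall>x\<in>b. \<forall>y\<in>b. cut (\<Union>K) x = cut (\<Union>K) y)}"

text \<open>
  The convolution product for \<open>\<delta>\<close>, on functions whose value at a family stands for the value of a
  character at the renumbered family.
\<close>
definition cstar ::
  "(nat set set \<Rightarrow> 'k) \<Rightarrow> (nat set set \<Rightarrow> 'k) \<Rightarrow> nat set set \<Rightarrow> 'k::comm_ring_1" where
  "cstar A B P = (\<Sum>R\<in>coarsenings P. A R * (\<Prod>C\<in>R. B (inside P C)))"

text \<open>
  The convolution product for \<open>\<Delta>\<close>. The sum runs over the complement \<open>K\<close> of the ideal, and the gaps
  are the connected components of the ideal.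
\<close>
definition cconv ::
  "(nat set set \<Rightarrow> 'k) \<Rightarrow> (nat set set \<Rightarrow> 'k) \<Rightarrow> nat set set \<Rightarrow> 'k::comm_ring_1" where
  "cconv A B P = (\<Sum>K\<in>lowers P. A K * (\<Prod>G\<in>gaps (\<Union>K) (\<Union>(P - K)). B (inside (P - K) G)))"

lemma noncrossing_subset: "noncrossing P \<Longrightarrow> Q \<subseteq> P \<Longrightarrow> noncrossing Q"
  unfolding noncrossing_def by (meson subsetD)

lemma noncrossingD:
  "noncrossing P \<Longrightarrow> b \<in> P \<Longrightarrow> b' \<in> P \<Longrightarrow> x \<in> b \<Longrightarrow> z \<in> b \<Longrightarrow> y \<in> b' \<Longrightarrow> t \<in> b' \<Longrightarrow>
    x < y \<Longrightarrow> y < z \<Longrightarrow> z < t \<Longrightarrow> b = b'"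
  unfolding noncrossing_def by metis

lemma noncrossingI:
  "(\<And>b b' x y z t. b \<in> P \<Longrightarrow> b' \<in> P \<Longrightarrow> x \<in> b \<Longrightarrow> z \<in> b \<Longrightarrow> y \<in> b' \<Longrightarrow> t \<in> b' \<Longrightarrow>
    x < y \<Longrightarrow> y < z \<Longrightarrow> z < t \<Longrightarrow> b = b') \<Longrightarrow> noncrossing P"
  unfolding noncrossing_def by metis

lemma partition_on_Union_iff:
  "partition_on (\<Union>P) P \<longleftrightarrow> {} \<notin> P \<and> (\<forall>b\<in>P. \<forall>b'\<in>P. \<forall>x\<in>b. x \<in> b' \<longrightarrow> b = b')"
  unfolding partition_on_def disjoint_def by blast

lemma ncfam_iff:
  "ncfam P \<longleftrightarrow> finite (\<Union>P) \<and> {} \<notin> P \<and> (\<forall>b\<in>P. \<forall>b'\<in>P. \<forall>x\<in>b. x \<in> b' \<longrightarrow> b = b')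
     \<and> noncrossing P"
  by (simp add: ncfam_def partition_on_Union_iff)

lemma coarsenings_iff:
  "ncfam P \<Longrightarrow> R \<in> coarsenings P \<longleftrightarrow>
     ncfam R \<and> \<Union>R = \<Union>P \<and> (\<forall>b\<in>P. \<exists>B\<in>R. b \<subseteq> B)"
proof -
  assume P: "ncfam P"
  have "partition_on (\<Union>P) R \<longleftrightarrow> \<Union>R = \<Union>P \<and> partition_on (\<Union>R) R"
    by (metis partition_onD1)
  with P show ?thesis
    by (cases "\<Union>R = \<Union>P") (simp_all add: coarsenings_def refines_def ncfam_def conj_ac)
qed

lemma ncfam_finite: "ncfam P \<Longrightarrow> finite P"
  unfolding ncfam_def by (blast intro: finite_UnionD)

lemma ncfam_block_eq: "ncfam P \<Longrightarrow> b \<in> P \<Longrightarrow> b' \<in> P \<Longrightarrow> x \<in> b \<Longrightarrow> x \<in> b' \<Longrightarrow> b = b'"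
  unfolding ncfam_iff by blast

lemma ncfam_nonempty: "ncfam P \<Longrightarrow> b \<in> P \<Longrightarrow> b \<noteq> {}"
  unfolding ncfam_iff by blast

lemma ncfam_block_finite: "ncfam P \<Longrightarrow> b \<in> P \<Longrightarrow> finite b"
  unfolding ncfam_iff by (meson Union_upper finite_subset)

lemma ncfam_subset: "ncfam P \<Longrightarrow> Q \<subseteq> P \<Longrightarrow> ncfam Q"
  unfolding ncfam_iff by (meson Union_mono finite_subset noncrossing_subset subsetD)

lemma inside_subset: "inside P B \<subseteq> P"
  unfolding inside_def by blast

lemma ncfam_inside: "ncfam P \<Longrightarrow> ncfam (inside P B)"
  by (rule ncfam_subset[OF _ inside_subset])

lemma inside_inside: "C \<subseteq> B \<Longrightarrow> inside (inside P B) C = inside P C"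
  unfolding inside_def by blast

lemma Union_Diff_disjoint: "ncfam P \<Longrightarrow> K \<subseteq> P \<Longrightarrow> \<Union>(P - K) = \<Union>P - \<Union>K"
  using ncfam_block_eq[of P] by blast

lemma finite_coarsenings: "ncfam P \<Longrightarrow> finite (coarsenings P)"
proof (rule finite_subset)
  assume "ncfam P"
  then have "\<Union>R = \<Union>P" if "R \<in> coarsenings P" for R
    using that by (simp add: coarsenings_iff)
  then show "coarsenings P \<subseteq> Pow (Pow (\<Union>P))" by blast
  show "finite (Pow (Pow (\<Union>P)))"
    using \<open>ncfam P\<close> by (simp add: ncfam_def)
qed

lemma coarsening_ncfam: "ncfam P \<Longrightarrow> R \<in> coarsenings P \<Longrightarrow> ncfam R"
  by (simp add: coarsenings_iff)

lemma coarsening_Union: "ncfam P \<Longrightarrow> R \<in> coarsenings P \<Longrightarrow> \<Union>R = \<Union>P"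
  by (simp add: coarsenings_iff)

lemma coarsening_covers: "ncfam P \<Longrightarrow> R \<in> coarsenings P \<Longrightarrow> b \<in> P \<Longrightarrow> \<exists>B\<in>R. b \<subseteq> B"
  by (simp add: coarsenings_iff)

lemma coarsening_block_subset:
  assumes "ncfam P" "R \<in> coarsenings P" "b \<in> P" "B \<in> R" "x \<in> b" "x \<in> B"
  shows "b \<subseteq> B"
  using assms by (metis coarsenings_iff ncfam_block_eq subsetD)

lemma Union_inside:
  assumes "ncfam P" "R \<in> coarsenings P" "B \<in> R"
  shows "\<Union>(inside P B) = B"
proof
  show "B \<subseteq> \<Union>(inside P B)"
  proof
    fix x assume "x \<in> B"
    then obtain b where "b \<in> P" "x \<in> b"
      using assms coarsening_Union by blast
    with \<open>x \<in> B\<close> show "x \<in> \<Union>(inside P B)"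
      using coarsening_block_subset[OF assms(1,2) _ assms(3)] unfolding inside_def by blast
  qed
qed (auto simp: inside_def)

lemma Union_of_insides:
  assumes "ncfam P" "R \<in> coarsenings P"
  shows "(\<Union>B\<in>R. inside P B) = P"
proof -
  have "\<forall>b\<in>P. \<exists>B\<in>R. b \<subseteq> B" using assms by (simp add: coarsenings_iff)
  then show ?thesis unfolding inside_def by blast
qed

lemma insides_disjoint:
  assumes "ncfam P" "R \<in> coarsenings P" "B \<in> R" "B' \<in> R" "B \<noteq> B'"
  shows "inside P B \<inter> inside P B' = {}"
proof -
  have "ncfam R" using assms coarsening_ncfam by simp
  then have "B \<inter> B' = {}" using ncfam_block_eq[of R B B'] assms(3-5) by blast
  then show ?thesis
    using ncfam_nonempty[OF assms(1)] unfolding inside_def by blast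
qed

lemma coarsenings_trans:
  "ncfam P \<Longrightarrow> R \<in> coarsenings P \<Longrightarrow> T \<in> coarsenings R \<Longrightarrow> T \<in> coarsenings P"
  using coarsening_ncfam[of P R] by (simp add: coarsenings_iff) (meson subset_trans)

text \<open>
  Since \<open>T\<close> is noncrossing, blocks that lie in different blocks of \<open>T\<close> cannot cross. Hence the
  coarsenings between \<open>P\<close> and \<open>T\<close> arise by choosing a coarsening inside each block of \<open>T\<close>
  independently, which is what allows to expand a product of sums into a single sum.
\<close>
lemma bij_betw_coarsening_choice:
  assumes P: "ncfam P" and T: "T \<in> coarsenings P"
  shows "bij_betw (\<lambda>R. \<lambda>B\<in>T. inside R B) {R \<in> coarsenings P. T \<in> coarsenings R}
    (PiE T (\<lambda>B. coarsenings (inside P B)))"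
proof (rule bij_betw_byWitness[where f' = "\<lambda>h. \<Union>B\<in>T. h B"])
  have ncT: "ncfam T" using assms coarsening_ncfam by blast
  show "\<forall>R\<in>{R \<in> coarsenings P. T \<in> coarsenings R}. (\<Union>B\<in>T. (\<lambda>B\<in>T. inside R B) B) = R"
    using Union_of_insides coarsening_ncfam[OF P] by simp
  show "(\<lambda>R. \<lambda>B\<in>T. inside R B) ` {R \<in> coarsenings P. T \<in> coarsenings R}
      \<subseteq> (\<Pi>\<^sub>E B\<in>T. coarsenings (inside P B))"
  proof (rule image_subsetI, rule restrict_PiE_iff[THEN iffD2], rule ballI)
    fix R B assume "R \<in> {R \<in> coarsenings P. T \<in> coarsenings R}" and B: "B \<in> T"
    then have R: "R \<in> coarsenings P" and TR: "T \<in> coarsenings R" by auto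
    have ncR: "ncfam R" using R P coarsening_ncfam by blast
    have "\<exists>C\<in>inside R B. b \<subseteq> C" if b: "b \<in> inside P B" for b
    proof -
      obtain C where C: "C \<in> R" "b \<subseteq> C"
        using b coarsening_covers[OF P R] unfolding inside_def by blast
      obtain x where x: "x \<in> b" using b P ncfam_nonempty unfolding inside_def by blast
      then have "x \<in> B" "x \<in> C" using b C unfolding inside_def by auto
      then have "C \<subseteq> B" using coarsening_block_subset[OF ncR TR C(1) B] by blast
      with C show ?thesis unfolding inside_def by blast
    qed
    then show "inside R B \<in> coarsenings (inside P B)"
      using ncfam_inside[OF P] ncfam_inside[OF ncR] Union_inside[OF P T B] Union_inside[OF ncR TR B]
      by (simp add: coarsenings_iff)
  qed
  have h_props: "h B \<in> coarsenings (inside P B)" "ncfam (h B)" "\<Union>(h B) = B"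
    if "h \<in> (\<Pi>\<^sub>E B\<in>T. coarsenings (inside P B))" "B \<in> T" for h B
  proof -
    show "h B \<in> coarsenings (inside P B)" using that by auto
    then show "ncfam (h B)" "\<Union>(h B) = B"
      using coarsening_ncfam coarsening_Union ncfam_inside[OF P] Union_inside[OF P T that(2)] by metis+
  qed
  show "\<forall>h\<in>\<Pi>\<^sub>E B\<in>T. coarsenings (inside P B). (\<lambda>B\<in>T. inside (\<Union>B\<in>T. h B) B) = h"
  proof (intro ballI ext)
    fix h B assume h: "h \<in> (\<Pi>\<^sub>E B\<in>T. coarsenings (inside P B))"
    show "(\<lambda>B\<in>T. inside (\<Union>B\<in>T. h B) B) B = h B"
    proof (cases "B \<in> T")
      case True
      have "c \<in> h B" if "c \<in> h B'" "c \<subseteq> B" "B' \<in> T" for c B'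
      proof -
        have "c \<noteq> {}" using ncfam_nonempty[OF h_props(2)[OF h that(3)] that(1)] .
        then obtain x where x: "x \<in> c" by blast
        then have "x \<in> B'" using h_props(3)[OF h that(3)] that(1) by blast
        then have "B = B'" using ncfam_block_eq[OF ncT True that(3)] x that(2) by blast
        then show ?thesis using that by simp
      qed
      moreover have "c \<subseteq> B" if "c \<in> h B" for c using that h_props(3)[OF h True] by blast
      ultimately show ?thesis using True unfolding inside_def by auto
    qed (use h in auto)
  qed
  show "(\<lambda>h. \<Union>B\<in>T. h B) ` (\<Pi>\<^sub>E B\<in>T. coarsenings (inside P B))
    \<subseteq> {R \<in> coarsenings P. T \<in> coarsenings R}"
  proof (rule image_subsetI)
    fix h assume h: "h \<in> (\<Pi>\<^sub>E B\<in>T. coarsenings (inside P B))"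
    let ?R = "\<Union>B\<in>T. h B"
    note hp = h_props[OF h]
    have "\<Union>?R = (\<Union>B\<in>T. \<Union>(h B))" by blast
    then have U: "\<Union>?R = \<Union>T" using hp(3) by simp
    have sub: "c \<subseteq> B" if "c \<in> h B" "B \<in> T" for c B using hp(3) that by blast
    have ncR: "ncfam ?R"
      unfolding ncfam_iff
    proof (intro conjI)
      show "finite (\<Union>?R)" using U ncT by (simp add: ncfam_def)
      show "{} \<notin> ?R" using hp(2) by (simp add: ncfam_iff)
      show "\<forall>b\<in>?R. \<forall>b'\<in>?R. \<forall>x\<in>b. x \<in> b' \<longrightarrow> b = b'"
      proof (intro ballI impI)
        fix b b' x assume "b \<in> ?R" "b' \<in> ?R" and x: "x \<in> b" "x \<in> b'"
        then obtain B B' where B: "B \<in> T" "b \<in> h B" "B' \<in> T" "b' \<in> h B'" by blast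
        then have "x \<in> B" "x \<in> B'" using x sub by (metis subsetD)+
        then have "B = B'" using ncfam_block_eq[OF ncT] B by metis
        then show "b = b'" using ncfam_block_eq[OF hp(2)] B x by metis
      qed
      show "noncrossing ?R"
      proof (rule noncrossingI)
        fix c c' x y z t assume c: "c \<in> ?R" "c' \<in> ?R" and
          *: "x \<in> c" "z \<in> c" "y \<in> c'" "t \<in> c'" "x < y" "y < z" "z < t"
        obtain B B' where B: "B \<in> T" "c \<in> h B" "B' \<in> T" "c' \<in> h B'" using c by blast
        have "x \<in> B" "z \<in> B" "y \<in> B'" "t \<in> B'" using B * sub by (metis subsetD)+
        then have "B = B'"
          using noncrossingD[of T B B' x z y t] ncT B * by (simp add: ncfam_def)
        then show "c = c'" using noncrossingD[of "h B" c c' x z y t] B * hp(2) by (simp add: ncfam_def)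
      qed
    qed
    have "\<exists>C\<in>?R. b \<subseteq> C" if b: "b \<in> P" for b
    proof -
      obtain B where B: "B \<in> T" "b \<in> inside P B"
        using coarsening_covers[OF P T b] b unfolding inside_def by blast
      have "\<forall>b\<in>inside P B. \<exists>C\<in>h B. b \<subseteq> C"
        using hp(1)[OF B(1)] ncfam_inside[OF P] by (simp add: coarsenings_iff)
      then show ?thesis using B by blast
    qed
    then have "?R \<in> coarsenings P" using ncR U T coarsening_Union[OF P T] by (simp add: coarsenings_iff[OF P])
    moreover have "\<forall>b\<in>?R. \<exists>B\<in>T. b \<subseteq> B" using sub by blast
    then have "T \<in> coarsenings ?R" using ncT U by (simp add: coarsenings_iff[OF ncR])
    ultimately show "?R \<in> {R \<in> coarsenings P. T \<in> coarsenings R}" by simp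
  qed
qed

lemma prod_sum_coarsenings:
  fixes F :: "nat set \<Rightarrow> nat set set \<Rightarrow> 'k::comm_ring_1"
  assumes P: "ncfam P" and T: "T \<in> coarsenings P"
  shows "(\<Prod>B\<in>T. \<Sum>R\<in>coarsenings (inside P B). F B R) =
    (\<Sum>R | R \<in> coarsenings P \<and> T \<in> coarsenings R. \<Prod>B\<in>T. F B (inside R B))"
proof -
  have "finite T" using assms coarsening_ncfam ncfam_finite by simp
  then have "(\<Prod>B\<in>T. \<Sum>R\<in>coarsenings (inside P B). F B R) =
      (\<Sum>h\<in>(\<Pi>\<^sub>E B\<in>T. coarsenings (inside P B)). \<Prod>B\<in>T. F B (h B))"
    by (intro prod_sum_PiE) (use finite_coarsenings ncfam_inside[OF P] in auto)
  also have "\<dots> = (\<Sum>R\<in>{R \<in> coarsenings P. T \<in> coarsenings R}. \<Prod>B\<in>T. F B ((\<lambda>B\<in>T. inside R B) B))"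
    by (rule sum.reindex_bij_betw[OF bij_betw_coarsening_choice[OF P T], symmetric])
  finally show ?thesis by simp
qed

lemma prod_coarsening_split:
  fixes f :: "nat set \<Rightarrow> 'k::comm_ring_1"
  assumes R: "ncfam R" and T: "T \<in> coarsenings R"
  shows "(\<Prod>C\<in>R. f C) = (\<Prod>B\<in>T. \<Prod>C\<in>inside R B. f C)"
proof -
  have "(\<Prod>C\<in>(\<Union>B\<in>T. inside R B). f C) = (\<Prod>B\<in>T. \<Prod>C\<in>inside R B. f C)"
  proof (rule prod.UNION_disjoint)
    show "finite T" using assms coarsening_ncfam ncfam_finite by simp
    show "\<forall>B\<in>T. finite (inside R B)" using R ncfam_finite ncfam_inside by simp
    show "\<forall>B\<in>T. \<forall>B'\<in>T. B \<noteq> B' \<longrightarrow> inside R B \<inter> inside R B' = {}"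
      using insides_disjoint[OF assms] by simp
  qed
  then show ?thesis using Union_of_insides[OF assms] by simp
qed

text \<open>
  Both sides sum over chains of two successive coarsenings \<open>R\<close>, \<open>T\<close> of \<open>P\<close>: on the left \<open>R\<close> is chosen
  first, on the right \<open>T\<close> comes first and \<open>R\<close> is chosen inside each block of \<open>T\<close>.
\<close>
lemma cstar_assoc:
  fixes A B C :: "nat set set \<Rightarrow> 'k::comm_ring_1"
  assumes P: "ncfam P"
  shows "cstar (cstar A B) C P = cstar A (cstar B C) P"
proof -
  define g where "g T R = A T * (\<Prod>D\<in>T. B (inside R D)) * (\<Prod>D\<in>R. C (inside P D))" for T R
  have "cstar (cstar A B) C P = (\<Sum>R\<in>coarsenings P. \<Sum>T\<in>coarsenings R. g T R)"
    unfolding cstar_def g_def by (simp add: sum_distrib_right)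
  also have "\<dots> = (\<Sum>R\<in>coarsenings P. \<Sum>T | T \<in> coarsenings P \<and> T \<in> coarsenings R. g T R)"
    by (intro sum.cong refl) (auto dest: coarsenings_trans[OF P])
  also have "\<dots> = (\<Sum>T\<in>coarsenings P. \<Sum>R | R \<in> coarsenings P \<and> T \<in> coarsenings R. g T R)"
    by (rule sum.swap_restrict) (use finite_coarsenings P in auto)
  also have "\<dots> = (\<Sum>T\<in>coarsenings P. A T * (\<Prod>D\<in>T. cstar B C (inside P D)))"
  proof (rule sum.cong[OF refl])
    fix T assume T: "T \<in> coarsenings P"
    have "(\<Prod>D\<in>T. cstar B C (inside P D)) =
      (\<Sum>R | R \<in> coarsenings P \<and> T \<in> coarsenings R.
        \<Prod>D\<in>T. B (inside R D) * (\<Prod>E\<in>inside R D. C (inside (inside P D) E)))"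
      unfolding cstar_def by (rule prod_sum_coarsenings[OF P T])
    also have "\<dots> = (\<Sum>R | R \<in> coarsenings P \<and> T \<in> coarsenings R.
        (\<Prod>D\<in>T. B (inside R D)) * (\<Prod>D\<in>R. C (inside P D)))"
    proof (rule sum.cong[OF refl])
      fix R assume "R \<in> {R. R \<in> coarsenings P \<and> T \<in> coarsenings R}"
      then have R: "ncfam R" "T \<in> coarsenings R" using P coarsening_ncfam by auto
      have "(\<Prod>E\<in>inside R D. C (inside (inside P D) E)) = (\<Prod>E\<in>inside R D. C (inside P E))" for D
        by (intro prod.cong refl arg_cong[where f = C] inside_inside) (simp add: inside_def)
      then show "(\<Prod>D\<in>T. B (inside R D) * (\<Prod>E\<in>inside R D. C (inside (inside P D) E))) =
        (\<Prod>D\<in>T. B (inside R D)) * (\<Prod>D\<in>R. C (inside P D))"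
        by (simp add: prod.distrib prod_coarsening_split[OF R])
    qed
    finally show "(\<Sum>R | R \<in> coarsenings P \<and> T \<in> coarsenings R. g T R) =
      A T * (\<Prod>D\<in>T. cstar B C (inside P D))"
      unfolding g_def by (simp add: sum_distrib_left mult.assoc)
  qed
  finally show ?thesis by (simp add: cstar_def)
qed

section \<open>Ideals and gaps\<close>

lemma cut_mono: "x \<le> y \<Longrightarrow> cut W x \<subseteq> cut W y"
  unfolding cut_def by auto

lemma cut_between:
  assumes "x < k" "k < y" "k \<in> W" shows "cut W x \<noteq> cut W y"
proof -
  have "k \<in> cut W y" "k \<notin> cut W x" using assms by (simp_all add: cut_def)
  then show ?thesis by blast
qed

lemma lowers_subset: "K \<in> lowers P \<Longrightarrow> K \<subseteq> P"
  unfolding lowers_def by blast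

lemma lowers_cut: "K \<in> lowers P \<Longrightarrow> b \<in> P - K \<Longrightarrow> x \<in> b \<Longrightarrow> y \<in> b \<Longrightarrow> cut (\<Union>K) x = cut (\<Union>K) y"
  unfolding lowers_def by blast

lemma lowersI:
  "K \<subseteq> P \<Longrightarrow> (\<And>b x y. b \<in> P - K \<Longrightarrow> x \<in> b \<Longrightarrow> y \<in> b \<Longrightarrow> cut (\<Union>K) x = cut (\<Union>K) y) \<Longrightarrow> K \<in> lowers P"
  unfolding lowers_def by blast

lemma finite_lowers: "ncfam P \<Longrightarrow> finite (lowers P)"
  by (rule finite_subset[of _ "Pow P"]) (use lowers_subset ncfam_finite in auto)

lemma gapsE:
  assumes "G \<in> gaps W U"
  obtains x where "x \<in> U" "G = {y \<in> U. cut W y = cut W x}"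
  using assms unfolding gaps_def by blast

lemma gap_in_gaps: "x \<in> U \<Longrightarrow> {y \<in> U. cut W y = cut W x} \<in> gaps W U"
  unfolding gaps_def by blast

lemma gap_cut: "G \<in> gaps W U \<Longrightarrow> x \<in> G \<Longrightarrow> y \<in> G \<Longrightarrow> cut W x = cut W y"
  unfolding gaps_def by auto

lemma gap_eq: "G \<in> gaps W U \<Longrightarrow> x \<in> G \<Longrightarrow> G = {y \<in> U. cut W y = cut W x}"
  unfolding gaps_def by auto

lemma gap_nonempty: "G \<in> gaps W U \<Longrightarrow> G \<noteq> {}"
  unfolding gaps_def by auto

lemma gap_subset: "G \<in> gaps W U \<Longrightarrow> G \<subseteq> U"
  unfolding gaps_def by auto

lemma Union_gaps: "\<Union>(gaps W U) = U"
  unfolding gaps_def by auto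

lemma gap_unique: "G \<in> gaps W U \<Longrightarrow> G' \<in> gaps W U \<Longrightarrow> x \<in> G \<Longrightarrow> x \<in> G' \<Longrightarrow> G = G'"
  using gap_eq[of G W U x] gap_eq[of G' W U x] by simp

text \<open>
  Cuts grow with the position, so an element between two members of a gap has the same cut as they
  have; hence gaps are noncrossing.
\<close>
lemma ncfam_gaps:
  assumes "finite U"
  shows "ncfam (gaps W U)"
  unfolding ncfam_iff
proof (intro conjI)
  show "finite (\<Union>(gaps W U))" using assms by (simp add: Union_gaps)
  show "{} \<notin> gaps W U" using gap_nonempty by blast
  show "\<forall>b\<in>gaps W U. \<forall>b'\<in>gaps W U. \<forall>x\<in>b. x \<in> b' \<longrightarrow> b = b'"
    by (intro ballI impI) (rule gap_unique)
  show "noncrossing (gaps W U)"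
  proof (rule noncrossingI)
    fix b b' x y z t assume b: "b \<in> gaps W U" "b' \<in> gaps W U" "x \<in> b" "z \<in> b" "y \<in> b'"
      and "x < y" "y < z"
    then have "cut W x \<subseteq> cut W y" "cut W y \<subseteq> cut W z" by (auto intro!: cut_mono)
    then have "cut W y = cut W x" using gap_cut[OF b(1,3,4)] by simp
    then have "y \<in> b" using gap_eq[OF b(1,3)] gap_subset[OF b(2)] b(5) by blast
    then show "b = b'" by (rule gap_unique[OF b(1,2) _ b(5)])
  qed
qed

text \<open>
  This identifies the product over the connected components of an ideal with a product over the
  blocks of one particular coarsening, so that the expansion of products over the blocks of a
  coarsening applies to both coproducts.
\<close>
lemma gaps_coarsening:
  assumes P: "ncfam P" and K: "K \<in> lowers P"
  shows "gaps (\<Union>K) (\<Union>(P - K)) \<in> coarsenings (P - K)"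
proof -
  have nc: "ncfam (P - K)" using P by (rule ncfam_subset) simp
  have fin: "finite (\<Union>(P - K))" using nc by (simp add: ncfam_def)
  have "\<exists>G\<in>gaps (\<Union>K) (\<Union>(P - K)). b \<subseteq> G" if b: "b \<in> P - K" for b
  proof -
    obtain x where x: "x \<in> b" using ncfam_nonempty[OF nc b] by blast
    have "b \<subseteq> {y \<in> \<Union>(P - K). cut (\<Union>K) y = cut (\<Union>K) x}"
    proof
      fix y assume "y \<in> b"
      then have "cut (\<Union>K) y = cut (\<Union>K) x" using lowers_cut[OF K b _ x] by simp
      then show "y \<in> {y \<in> \<Union>(P - K). cut (\<Union>K) y = cut (\<Union>K) x}"
        using b \<open>y \<in> b\<close> by blast
    qed
    moreover have "x \<in> \<Union>(P - K)" using b x by blast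
    ultimately show ?thesis using gap_in_gaps[of x "\<Union>(P - K)" "\<Union>K"] by (meson bexI)
  qed
  then show ?thesis using ncfam_gaps[OF fin] Union_gaps nc by (simp add: coarsenings_iff)
qed

lemma cut_constant_below_gaps:
  assumes nc: "ncfam T" and G: "gaps W U \<in> coarsenings T" and "b \<in> T" "x \<in> b" "y \<in> b"
  shows "cut W x = cut W y"
proof -
  obtain B where "B \<in> gaps W U" "b \<subseteq> B"
    using coarsening_covers[OF nc G assms(3)] by blast
  then show ?thesis using gap_cut[of B W U x y] assms(4,5) by blast
qed

text \<open>
  A crossing between a block of \<open>S\<close> and a block of \<open>T\<close> would put an element of \<open>S\<close> strictly between
  two elements of the block of \<open>T\<close>, which would then have different cuts.
\<close>
lemma ncfam_Un:
  assumes S: "ncfam S" and T: "ncfam T" and disj: "\<Union>S \<inter> \<Union>T = {}"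
    and cut: "\<And>b x y. b \<in> T \<Longrightarrow> x \<in> b \<Longrightarrow> y \<in> b \<Longrightarrow> cut (\<Union>S) x = cut (\<Union>S) y"
  shows "ncfam (S \<union> T)"
  unfolding ncfam_iff
proof (intro conjI)
  show "finite (\<Union>(S \<union> T))" using S T by (simp add: ncfam_def)
  show "{} \<notin> S \<union> T" using S T ncfam_nonempty by blast
  show "\<forall>b\<in>S \<union> T. \<forall>b'\<in>S \<union> T. \<forall>x\<in>b. x \<in> b' \<longrightarrow> b = b'"
  proof (intro ballI impI)
    fix b b' x assume b: "b \<in> S \<union> T" "b' \<in> S \<union> T" "x \<in> b" "x \<in> b'"
    then have "b \<in> S \<and> b' \<in> S \<or> b \<in> T \<and> b' \<in> T" using disj by blast
    then show "b = b'" using ncfam_block_eq[OF S] ncfam_block_eq[OF T] b by metis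
  qed
  show "noncrossing (S \<union> T)"
  proof (rule noncrossingI)
    fix b b' x y z t assume b: "b \<in> S \<union> T" "b' \<in> S \<union> T" and
      *: "x \<in> b" "z \<in> b" "y \<in> b'" "t \<in> b'" "x < y" "y < z" "z < t"
    consider "b \<in> S" "b' \<in> S" | "b \<in> T" "b' \<in> T" | "b \<in> S" "b' \<in> T" | "b \<in> T" "b' \<in> S"
      using b by blast
    then show "b = b'"
    proof cases
      case 1 then show ?thesis using noncrossingD[of S b b' x z y t] S * by (simp add: ncfam_def)
    next
      case 2 then show ?thesis using noncrossingD[of T b b' x z y t] T * by (simp add: ncfam_def)
    next
      case 3
      then have "z \<in> \<Union>S" using * by blast
      then show ?thesis using cut_between[of y z t "\<Union>S"] cut[OF 3(2) *(3,4)] * by blast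
    next
      case 4
      then have "y \<in> \<Union>S" using * by blast
      then show ?thesis using cut_between[of x y z "\<Union>S"] cut[OF 4(1) *(1,2)] * by blast
    qed
  qed
qed

section \<open>Cointeraction\<close>

lemma Union_inside_Union:
  assumes P: "ncfam P" and R: "R \<in> coarsenings P" and S: "S \<subseteq> R"
  shows "\<Union>(inside P (\<Union>S)) = \<Union>S" and "\<Union>(P - inside P (\<Union>S)) = \<Union>(R - S)"
proof -
  have ncR: "ncfam R" using P R coarsening_ncfam by simp
  have "b \<subseteq> \<Union>S" if bx: "b \<in> P" "x \<in> b" "x \<in> \<Union>S" for b x
  proof -
    obtain D where D: "D \<in> S" "x \<in> D" using bx(3) by blast
    then have "D \<in> R" using S by blast
    then have "b \<subseteq> D" using coarsening_block_subset[OF P R bx(1) _ bx(2)] D(2) by simp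
    then show ?thesis using D(1) by blast
  qed
  note block = this
  show 1: "\<Union>(inside P (\<Union>S)) = \<Union>S"
  proof (intro equalityI subsetI)
    fix x assume x: "x \<in> \<Union>S"
    then have "x \<in> \<Union>P" using S by (auto simp: coarsening_Union[OF P R, symmetric])
    then obtain b where "b \<in> P" "x \<in> b" by blast
    then show "x \<in> \<Union>(inside P (\<Union>S))" using block[of b x] x unfolding inside_def by blast
  qed (auto simp: inside_def)
  show "\<Union>(P - inside P (\<Union>S)) = \<Union>(R - S)"
    using Union_Diff_disjoint[OF P inside_subset] Union_Diff_disjoint[OF ncR S] 1
      coarsening_Union[OF P R] by simp
qed

text \<open>
  The next two lemmas set up the bijection behind the cointeraction. A pair of a coarsening \<open>R\<close> of
  \<open>P\<close> and a lower part \<open>S\<close> of \<open>R\<close> corresponds to a lower part \<open>K\<close> of \<open>P\<close>, a coarsening \<open>S\<close> of \<open>K\<close>,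
  and a coarsening \<open>T\<close> of the rest whose blocks respect the gaps of \<open>K\<close>; here \<open>R = S \<union> T\<close>, and \<open>K\<close>
  consists of the blocks covered by \<open>S\<close>. As \<open>K\<close> and \<open>S\<close> have the same underlying set, they have the
  same gaps.
\<close>
lemma cointeraction_forward:
  assumes P: "ncfam P" and K: "K \<in> lowers P" and S: "S \<in> coarsenings K"
    and T: "T \<in> coarsenings (P - K)" and GT: "gaps (\<Union>K) (\<Union>(P - K)) \<in> coarsenings T"
  shows "S \<union> T \<in> coarsenings P" "S \<in> lowers (S \<union> T)" "S \<inter> T = {}"
    "inside P (\<Union>S) = K"
proof -
  have KP: "K \<subseteq> P" using K lowers_subset by blast
  have ncK: "ncfam K" and ncPK: "ncfam (P - K)" using ncfam_subset[OF P] KP by auto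
  have ncS: "ncfam S" and ncT: "ncfam T" using S T ncK ncPK coarsening_ncfam by auto
  have US: "\<Union>S = \<Union>K" and UT: "\<Union>T = \<Union>(P - K)"
    using coarsening_Union ncK ncPK S T by auto
  have disjU: "\<Union>S \<inter> \<Union>T = {}"
    using US UT Union_Diff_disjoint[OF P KP] by blast
  then show disj: "S \<inter> T = {}" using ncfam_nonempty[OF ncS] by blast
  have cutT: "cut (\<Union>S) x = cut (\<Union>S) y" if "b \<in> T" "x \<in> b" "y \<in> b" for b x y
    using cut_constant_below_gaps[OF ncT GT that] US by simp
  have nc: "ncfam (S \<union> T)" by (rule ncfam_Un[OF ncS ncT disjU cutT])
  have "\<Union>(S \<union> T) = \<Union>K \<union> \<Union>(P - K)" using US UT by simp
  then have U: "\<Union>(S \<union> T) = \<Union>P" using KP by blast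
  have "\<exists>B\<in>S \<union> T. b \<subseteq> B" if "b \<in> P" for b
    using coarsening_covers[OF ncK S] coarsening_covers[OF ncPK T] that by blast
  then show "S \<union> T \<in> coarsenings P" using nc U P by (simp add: coarsenings_iff)
  show "S \<in> lowers (S \<union> T)"
    by (rule lowersI) (use cutT in auto)
  have "b \<in> K" if b: "b \<in> P" "b \<subseteq> \<Union>K" for b
  proof -
    obtain x where "x \<in> b" using ncfam_nonempty[OF P b(1)] by blast
    then obtain b' where "b' \<in> K" "x \<in> b'" using b by blast
    then have "b = b'" using ncfam_block_eq[OF P b(1), of b' x] KP \<open>x \<in> b\<close> by (simp add: subset_iff)
    then show ?thesis using \<open>b' \<in> K\<close> by simp
  qed
  then show "inside P (\<Union>S) = K" unfolding US inside_def using KP by blast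
qed

lemma cointeraction_backward:
  assumes P: "ncfam P" and R: "R \<in> coarsenings P" and S: "S \<in> lowers R"
  defines "K \<equiv> inside P (\<Union>S)"
  shows "K \<in> lowers P" "S \<in> coarsenings K" "R - S \<in> coarsenings (P - K)"
    "gaps (\<Union>K) (\<Union>(P - K)) \<in> coarsenings (R - S)" "gaps (\<Union>K) (\<Union>(P - K)) = gaps (\<Union>S) (\<Union>(R - S))"
proof -
  have SR: "S \<subseteq> R" using S lowers_subset by blast
  have ncR: "ncfam R" using P R coarsening_ncfam by simp
  have KP: "K \<subseteq> P" unfolding K_def by (rule inside_subset)
  have ncK: "ncfam K" and ncPK: "ncfam (P - K)" using ncfam_subset[OF P] KP by auto
  have ncS: "ncfam S" and ncRS: "ncfam (R - S)" using ncfam_subset[OF ncR] SR by auto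
  have UK: "\<Union>K = \<Union>S" and UPK: "\<Union>(P - K) = \<Union>(R - S)"
    unfolding K_def by (rule Union_inside_Union[OF P R SR])+
  have cov: "\<exists>D\<in>R - S. b \<subseteq> D" if b: "b \<in> P - K" for b
  proof -
    obtain D where D: "D \<in> R" "b \<subseteq> D" using coarsening_covers[OF P R, of b] b by blast
    then have "D \<notin> S" using b unfolding K_def inside_def by blast
    then show ?thesis using D by blast
  qed
  have covK: "\<exists>D\<in>S. b \<subseteq> D" if b: "b \<in> K" for b
  proof -
    obtain x where x: "x \<in> b" using ncfam_nonempty[OF ncK b] by blast
    then obtain D where D: "D \<in> S" "x \<in> D" using b unfolding K_def inside_def by blast
    then have "b \<subseteq> D" using coarsening_block_subset[OF P R, of b D x] b KP SR x by (simp add: subset_iff)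
    then show ?thesis using D by blast
  qed
  show "K \<in> lowers P"
  proof (rule lowersI[OF KP])
    fix b x y assume b: "b \<in> P - K" "x \<in> b" "y \<in> b"
    then obtain D where "D \<in> R - S" "b \<subseteq> D" using cov by blast
    then show "cut (\<Union>K) x = cut (\<Union>K) y" using lowers_cut[OF S, of D x y] b UK by auto
  qed
  show "S \<in> coarsenings K" using ncK ncS UK covK by (simp add: coarsenings_iff)
  show "R - S \<in> coarsenings (P - K)" using ncPK ncRS UPK cov by (simp add: coarsenings_iff)
  show eq: "gaps (\<Union>K) (\<Union>(P - K)) = gaps (\<Union>S) (\<Union>(R - S))" by (simp add: UK UPK)
  show "gaps (\<Union>K) (\<Union>(P - K)) \<in> coarsenings (R - S)"
    unfolding eq by (rule gaps_coarsening[OF ncR S])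
qed

text \<open>
  This expresses that \<open>\<Delta>\<close> is compatible with the coaction by \<open>\<delta>\<close>: right multiplication by a
  character for \<open>\<star>\<close> is an endomorphism for the convolution product of \<open>\<Delta>\<close>.
\<close>
theorem cstar_cconv:
  fixes A B C :: "nat set set \<Rightarrow> 'k::comm_ring_1"
  assumes P: "ncfam P"
  shows "cstar (cconv A B) C P = cconv (cstar A C) (cstar B C) P"
proof -
  define f where "f S T = A S * (\<Prod>G\<in>gaps (\<Union>S) (\<Union>T). B (inside T G))" for S T
  \<comment> \<open>\<open>Y\<close> indexes the left-hand side; \<open>X\<close> indexes the expanded right-hand side.\<close>
  define X where "X = (SIGMA K:lowers P. SIGMA S:coarsenings K.
    {T \<in> coarsenings (P - K). gaps (\<Union>K) (\<Union>(P - K)) \<in> coarsenings T})"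
  define Y where "Y = (SIGMA R:coarsenings P. lowers R)"
  have nc: "ncfam K" "ncfam (P - K)" if "K \<in> lowers P" for K
    using ncfam_subset[OF P] lowers_subset[OF that] by auto
  have "cstar (cconv A B) C P = (\<Sum>R\<in>coarsenings P. \<Sum>S\<in>lowers R. f S (R - S) * (\<Prod>D\<in>R. C (inside P D)))"
    unfolding cstar_def cconv_def f_def by (simp add: sum_distrib_right)
  also have "\<dots> = (\<Sum>(R, S)\<in>Y. f S (R - S) * (\<Prod>D\<in>R. C (inside P D)))"
    unfolding Y_def by (rule sum.Sigma) (use finite_coarsenings[OF P] finite_lowers coarsening_ncfam[OF P] in auto)
  also have "\<dots> = (\<Sum>(K, S, T)\<in>X. f S T * (\<Prod>D\<in>S. C (inside K D)) * (\<Prod>D\<in>T. C (inside (P - K) D)))"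
  proof (rule sum.reindex_bij_witness[where j = "\<lambda>(R, S). (inside P (\<Union>S), S, R - S)"
        and i = "\<lambda>(K, S, T). (S \<union> T, S)"])
    fix q assume "q \<in> Y"
    then obtain R S where q: "q = (R, S)" "R \<in> coarsenings P" "S \<in> lowers R"
      unfolding Y_def by blast
    note bw = cointeraction_backward[OF P q(2,3)]
    have SR: "S \<subseteq> R" using q(3) lowers_subset by blast
    show "(\<lambda>(K, S, T). (S \<union> T, S)) ((\<lambda>(R, S). (inside P (\<Union>S), S, R - S)) q) = q"
      using SR q(1) by auto
    show "(\<lambda>(R, S). (inside P (\<Union>S), S, R - S)) q \<in> X"
      unfolding X_def q(1) using bw by simp
    have ncR: "ncfam R" using P q coarsening_ncfam by simp
    have "(\<Prod>D\<in>R. C (inside P D)) = (\<Prod>D\<in>R - S. C (inside P D)) * (\<Prod>D\<in>S. C (inside P D))"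
      by (rule prod.subset_diff[OF SR]) (rule ncfam_finite[OF ncR])
    also have "(\<Prod>D\<in>S. C (inside P D)) = (\<Prod>D\<in>S. C (inside (inside P (\<Union>S)) D))"
      by (intro prod.cong refl arg_cong[where f = C] inside_inside[symmetric]) blast
    also have "(\<Prod>D\<in>R - S. C (inside P D)) = (\<Prod>D\<in>R - S. C (inside (P - inside P (\<Union>S)) D))"
    proof (intro prod.cong refl arg_cong[where f = C])
      fix D assume D: "D \<in> R - S"
      have "b \<notin> inside P (\<Union>S)" if b: "b \<in> P" "b \<subseteq> D" for b
      proof
        assume "b \<in> inside P (\<Union>S)"
        then have "b \<subseteq> \<Union>S" by (simp add: inside_def)
        moreover have "b \<noteq> {}" using ncfam_nonempty P b by simp
        moreover have "\<Union>S \<inter> \<Union>(R - S) = {}" using Union_Diff_disjoint[OF ncR SR] by blast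
        ultimately show False using b D by blast
      qed
      then show "inside P D = inside (P - inside P (\<Union>S)) D" unfolding inside_def by blast
    qed
    finally show "(case (\<lambda>(R, S). (inside P (\<Union>S), S, R - S)) q of
        (K, S, T) \<Rightarrow> f S T * (\<Prod>D\<in>S. C (inside K D)) * (\<Prod>D\<in>T. C (inside (P - K) D))) =
      (case q of (R, S) \<Rightarrow> f S (R - S) * (\<Prod>D\<in>R. C (inside P D)))"
      unfolding q(1) by (simp add: ac_simps)
  next
    fix q assume "q \<in> X"
    then obtain K S T where q: "q = (K, S, T)" "K \<in> lowers P" "S \<in> coarsenings K"
      "T \<in> coarsenings (P - K)" "gaps (\<Union>K) (\<Union>(P - K)) \<in> coarsenings T"
      unfolding X_def by blast
    note fw = cointeraction_forward[OF P q(2-5)]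
    have "S \<union> T - S = T" using fw(3) by blast
    then show "(\<lambda>(R, S). (inside P (\<Union>S), S, R - S)) ((\<lambda>(K, S, T). (S \<union> T, S)) q) = q"
      using fw(4) q(1) by simp
    show "(\<lambda>(K, S, T). (S \<union> T, S)) q \<in> Y"
      unfolding Y_def q(1) using fw by simp
  qed
  also have "\<dots> = (\<Sum>K\<in>lowers P. \<Sum>S\<in>coarsenings K.
      \<Sum>T | T \<in> coarsenings (P - K) \<and> gaps (\<Union>K) (\<Union>(P - K)) \<in> coarsenings T.
        f S T * (\<Prod>D\<in>S. C (inside K D)) * (\<Prod>D\<in>T. C (inside (P - K) D)))"
    unfolding X_def
    by (subst sum.Sigma[symmetric],
        use finite_lowers[OF P] finite_coarsenings nc in \<open>auto intro!: sum.cong sum.Sigma[symmetric]\<close>)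
  also have "\<dots> = (\<Sum>K\<in>lowers P. cstar A C K * (\<Prod>G\<in>gaps (\<Union>K) (\<Union>(P - K)). cstar B C (inside (P - K) G)))"
  proof (rule sum.cong[OF refl])
    fix K assume K: "K \<in> lowers P"
    let ?G = "gaps (\<Union>K) (\<Union>(P - K))"
    let ?T = "{T. T \<in> coarsenings (P - K) \<and> ?G \<in> coarsenings T}"
    have "(\<Prod>G\<in>?G. cstar B C (inside (P - K) G)) =
      (\<Sum>T\<in>?T. \<Prod>G\<in>?G. B (inside T G) * (\<Prod>D\<in>inside T G. C (inside (inside (P - K) G) D)))"
      unfolding cstar_def by (rule prod_sum_coarsenings[OF nc(2)[OF K] gaps_coarsening[OF P K]])
    also have "\<dots> = (\<Sum>T\<in>?T. (\<Prod>G\<in>?G. B (inside T G)) * (\<Prod>D\<in>T. C (inside (P - K) D)))"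
    proof (rule sum.cong[OF refl])
      fix T assume "T \<in> ?T"
      then have T: "ncfam T" "?G \<in> coarsenings T" using nc(2)[OF K] coarsening_ncfam by auto
      have "(\<Prod>D\<in>inside T G. C (inside (inside (P - K) G) D)) = (\<Prod>D\<in>inside T G. C (inside (P - K) D))" for G
        by (intro prod.cong refl arg_cong[where f = C] inside_inside) (simp add: inside_def)
      then show "(\<Prod>G\<in>?G. B (inside T G) * (\<Prod>D\<in>inside T G. C (inside (inside (P - K) G) D))) =
        (\<Prod>G\<in>?G. B (inside T G)) * (\<Prod>D\<in>T. C (inside (P - K) D))"
        by (simp add: prod.distrib prod_coarsening_split[OF T])
    qed
    finally have eq: "(\<Prod>G\<in>?G. cstar B C (inside (P - K) G)) =
      (\<Sum>T\<in>?T. (\<Prod>G\<in>?G. B (inside T G)) * (\<Prod>D\<in>T. C (inside (P - K) D)))" .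
    have "cstar A C K * (\<Prod>G\<in>?G. cstar B C (inside (P - K) G)) =
      (\<Sum>S\<in>coarsenings K. \<Sum>T\<in>?T. (A S * (\<Prod>D\<in>S. C (inside K D))) *
        ((\<Prod>G\<in>?G. B (inside T G)) * (\<Prod>D\<in>T. C (inside (P - K) D))))"
      unfolding eq cstar_def[of A C K] by (rule sum_product)
    also have "\<dots> = (\<Sum>S\<in>coarsenings K. \<Sum>T\<in>?T.
      f S T * (\<Prod>D\<in>S. C (inside K D)) * (\<Prod>D\<in>T. C (inside (P - K) D)))"
    proof (intro sum.cong refl)
      fix S T assume "S \<in> coarsenings K" "T \<in> ?T"
      then have "\<Union>S = \<Union>K" "\<Union>T = \<Union>(P - K)" using coarsening_Union nc[OF K] by auto
      then show "(A S * (\<Prod>D\<in>S. C (inside K D))) *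
        ((\<Prod>G\<in>?G. B (inside T G)) * (\<Prod>D\<in>T. C (inside (P - K) D))) =
        f S T * (\<Prod>D\<in>S. C (inside K D)) * (\<Prod>D\<in>T. C (inside (P - K) D))"
        unfolding f_def by (simp add: ac_simps)
    qed
    finally show "(\<Sum>S\<in>coarsenings K. \<Sum>T\<in>?T.
      f S T * (\<Prod>D\<in>S. C (inside K D)) * (\<Prod>D\<in>T. C (inside (P - K) D))) =
      cstar A C K * (\<Prod>G\<in>?G. cstar B C (inside (P - K) G))" by simp
  qed
  finally show ?thesis by (simp add: cconv_def)
qed

section \<open>Coassociativity of the ideal coproduct\<close>

text \<open>
  Used to compare the gaps of \<open>L\<close> in \<open>P\<close> with its gaps in a smaller family \<open>K\<close>: the gaps in \<open>P\<close> that
  contain no block of \<open>K\<close> disappear.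
\<close>
lemma bij_betw_gaps_restrict:
  assumes "V \<subseteq> U"
  shows "bij_betw (\<lambda>G. G \<inter> V) {G \<in> gaps W U. G \<inter> V \<noteq> {}} (gaps W V)"
proof -
  have 1: "{y \<in> U. cut W y = cut W x} \<inter> V = {y \<in> V. cut W y = cut W x}" for x
    using assms by blast
  show ?thesis
    unfolding bij_betw_def
  proof (intro conjI equalityI subsetI)
    show "inj_on (\<lambda>G. G \<inter> V) {G \<in> gaps W U. G \<inter> V \<noteq> {}}"
    proof (rule inj_onI)
      fix G G' assume G: "G \<in> {G \<in> gaps W U. G \<inter> V \<noteq> {}}" "G' \<in> {G \<in> gaps W U. G \<inter> V \<noteq> {}}"
        and eq: "G \<inter> V = G' \<inter> V"
      obtain x where x: "x \<in> G \<inter> V" using G by blast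
      then have "x \<in> G" "x \<in> G'" using eq by blast+
      then show "G = G'" using G gap_unique[of G W U G' x] by simp
    qed
  next
    fix H assume "H \<in> (\<lambda>G. G \<inter> V) ` {G \<in> gaps W U. G \<inter> V \<noteq> {}}"
    then obtain G x where G: "G \<in> gaps W U" "H = G \<inter> V" "x \<in> G" "x \<in> V" by blast
    then have "H = {y \<in> V. cut W y = cut W x}" using gap_eq[OF G(1,3)] 1 by simp
    then show "H \<in> gaps W V" using gap_in_gaps[OF G(4)] by simp
  next
    fix H assume "H \<in> gaps W V"
    then obtain x where x: "x \<in> V" "H = {y \<in> V. cut W y = cut W x}" by (rule gapsE)
    let ?G = "{y \<in> U. cut W y = cut W x}"
    have "?G \<in> gaps W U" using gap_in_gaps x assms by blast
    moreover have "?G \<inter> V = H" using 1 x by simp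
    moreover have "x \<in> H" using x by simp
    ultimately show "H \<in> (\<lambda>G. G \<inter> V) ` {G \<in> gaps W U. G \<inter> V \<noteq> {}}" by blast
  qed
qed

lemma cut_refine:
  assumes "W \<subseteq> W'" "cut W' x = cut W' y" shows "cut W x = cut W y"
proof -
  have "cut W x = cut W' x \<inter> W" "cut W y = cut W' y \<inter> W"
    using assms(1) unfolding cut_def by blast+
  then show ?thesis using assms(2) by simp
qed

text \<open>
  Chains \<open>L \<subseteq> K \<subseteq> P\<close> with \<open>L\<close> lower index the twofold coproduct. The aim of this locale is that being
  lower, the gaps, and the corresponding products for \<open>K\<close> can be computed separately in each gap
  of \<open>L\<close>.
\<close>
locale ideal_chain =
  fixes P L K :: "nat set set"
  assumes P: "ncfam P" and L: "L \<in> lowers P" and LK: "L \<subseteq> K" and KP: "K \<subseteq> P"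
begin

abbreviation Gs :: "nat set set" where "Gs \<equiv> gaps (\<Union>L) (\<Union>(P - L))"

lemma ncQ: "ncfam (P - L)" using P by (rule ncfam_subset) simp

lemma Gs_coarsening: "Gs \<in> coarsenings (P - L)" by (rule gaps_coarsening[OF P L])

lemma block_in_gap: "b \<in> P - L \<Longrightarrow> \<exists>G\<in>Gs. b \<subseteq> G"
  by (rule coarsening_covers[OF ncQ Gs_coarsening])

lemma block_subset_gap: "b \<in> P - L \<Longrightarrow> G \<in> Gs \<Longrightarrow> x \<in> b \<Longrightarrow> x \<in> G \<Longrightarrow> b \<subseteq> G"
  by (rule coarsening_block_subset[OF ncQ Gs_coarsening])

lemma cut_local_aux:
  assumes G: "G \<in> Gs" and xy: "x \<in> G" "y \<in> G"
    and eq: "cut (\<Union>(inside (K - L) G)) x = cut (\<Union>(inside (K - L) G)) y"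
  shows "cut (\<Union>K) x \<subseteq> cut (\<Union>K) y"
proof
  fix k assume "k \<in> cut (\<Union>K) x"
  then obtain c where c: "c \<in> K" "k \<in> c" and kx: "k < x" unfolding cut_def by blast
  have "k < y"
  proof (cases "c \<in> L")
    case True
    then have "k \<in> cut (\<Union>L) x" using c kx unfolding cut_def by blast
    then have "k \<in> cut (\<Union>L) y" using gap_cut[OF G xy] by simp
    then show ?thesis by (simp add: cut_def)
  next
    case False
    then have cQ: "c \<in> P - L" using c KP by blast
    show ?thesis
    proof (cases "k \<in> G")
      case True
      then have "c \<in> inside (K - L) G"
        using block_subset_gap[OF cQ G c(2)] c False unfolding inside_def by blast
      then have "k \<in> cut (\<Union>(inside (K - L) G)) x" using c kx unfolding cut_def by blast
      then show ?thesis unfolding eq by (simp add: cut_def)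
    next
      case kG: False
      show ?thesis
      proof (rule ccontr)
        assume "\<not> k < y"
        then have "cut (\<Union>L) y \<subseteq> cut (\<Union>L) k" "cut (\<Union>L) k \<subseteq> cut (\<Union>L) x"
          using kx by (auto intro!: cut_mono)
        then have "cut (\<Union>L) k = cut (\<Union>L) x" using gap_cut[OF G xy] by simp
        moreover have "k \<in> \<Union>(P - L)" using cQ c by blast
        ultimately have "k \<in> G" using gap_eq[OF G xy(1)] by simp
        then show False using kG by simp
      qed
    qed
  qed
  then show "k \<in> cut (\<Union>K) y" using c unfolding cut_def by blast
qed

text \<open>
  Two positions in the same gap \<open>G\<close> of \<open>L\<close> are separated neither by \<open>L\<close> nor by a block in another gap,
  as such a block lies entirely on one side of \<open>G\<close>.
\<close>
lemma cut_local:
  assumes G: "G \<in> Gs" and xy: "x \<in> G" "y \<in> G"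
  shows "cut (\<Union>K) x = cut (\<Union>K) y \<longleftrightarrow>
    cut (\<Union>(inside (K - L) G)) x = cut (\<Union>(inside (K - L) G)) y"
proof
  assume "cut (\<Union>K) x = cut (\<Union>K) y"
  then show "cut (\<Union>(inside (K - L) G)) x = cut (\<Union>(inside (K - L) G)) y"
    by (rule cut_refine[rotated]) (auto simp: inside_def)
next
  assume "cut (\<Union>(inside (K - L) G)) x = cut (\<Union>(inside (K - L) G)) y"
  then show "cut (\<Union>K) x = cut (\<Union>K) y"
    using cut_local_aux[OF G xy] cut_local_aux[OF G xy(2,1)] by simp
qed

lemma lowers_iff_local:
  "K \<in> lowers P \<longleftrightarrow> (\<forall>G\<in>Gs. inside (K - L) G \<in> lowers (inside (P - L) G))"
proof (intro iffI ballI)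
  fix G assume K: "K \<in> lowers P" and G: "G \<in> Gs"
  show "inside (K - L) G \<in> lowers (inside (P - L) G)"
  proof (rule lowersI)
    show "inside (K - L) G \<subseteq> inside (P - L) G" using KP unfolding inside_def by blast
    fix b x y assume b: "b \<in> inside (P - L) G - inside (K - L) G" "x \<in> b" "y \<in> b"
    then have "b \<in> P - K" and "b \<subseteq> G" unfolding inside_def by blast+
    then have "x \<in> G" "y \<in> G" using b(2,3) by blast+
    moreover have "cut (\<Union>K) x = cut (\<Union>K) y" using lowers_cut[OF K \<open>b \<in> P - K\<close> b(2,3)] .
    ultimately show "cut (\<Union>(inside (K - L) G)) x = cut (\<Union>(inside (K - L) G)) y"
      using cut_local[OF G] by simp
  qed
next
  assume loc: "\<forall>G\<in>Gs. inside (K - L) G \<in> lowers (inside (P - L) G)"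
  show "K \<in> lowers P"
  proof (rule lowersI[OF KP])
    fix b x y assume b: "b \<in> P - K" "x \<in> b" "y \<in> b"
    then have bQ: "b \<in> P - L" using LK by blast
    then obtain G where G: "G \<in> Gs" "b \<subseteq> G" using block_in_gap by blast
    have "b \<in> inside (P - L) G - inside (K - L) G" using b bQ G unfolding inside_def by blast
    then have "cut (\<Union>(inside (K - L) G)) x = cut (\<Union>(inside (K - L) G)) y"
      using lowers_cut[of _ _ b x y] b(2,3) loc G(1) by blast
    moreover have "x \<in> G" "y \<in> G" using b G(2) by auto
    ultimately show "cut (\<Union>K) x = cut (\<Union>K) y" using cut_local[OF G(1)] by simp
  qed
qed

lemma Diff_local: "inside (P - L) G - inside (K - L) G = inside (P - K) G"
  using LK unfolding inside_def by blast

lemma gap_class_local: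
  assumes G: "G \<in> Gs" and x: "x \<in> \<Union>(inside (P - K) G)"
  shows "{y \<in> \<Union>(P - K). cut (\<Union>K) y = cut (\<Union>K) x} =
    {y \<in> \<Union>(inside (P - K) G). cut (\<Union>(inside (K - L) G)) y = cut (\<Union>(inside (K - L) G)) x}"
proof -
  have xG: "x \<in> G" using x unfolding inside_def by blast
  have "y \<in> \<Union>(inside (P - K) G)" if y: "y \<in> \<Union>(P - K)" and cut: "cut (\<Union>K) y = cut (\<Union>K) x" for y
  proof -
    obtain b where b: "b \<in> P - K" "y \<in> b" using y by blast
    then have bQ: "b \<in> P - L" using LK by blast
    have "cut (\<Union>L) y = cut (\<Union>L) x" by (rule cut_refine[OF _ cut]) (use LK in blast)
    moreover have "y \<in> \<Union>(P - L)" using bQ b by blast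
    ultimately have "y \<in> G" using gap_eq[OF G xG] by simp
    then show ?thesis using block_subset_gap[OF bQ G b(2)] b unfolding inside_def by blast
  qed
  moreover have "y \<in> \<Union>(P - K)" "y \<in> G" if "y \<in> \<Union>(inside (P - K) G)" for y
    using that unfolding inside_def by blast+
  ultimately show ?thesis using cut_local[OF G _ xG] by blast
qed

lemma gaps_decompose: "gaps (\<Union>K) (\<Union>(P - K)) =
  (\<Union>G\<in>Gs. gaps (\<Union>(inside (K - L) G)) (\<Union>(inside (P - K) G)))"
proof (intro equalityI subsetI)
  fix H assume "H \<in> gaps (\<Union>K) (\<Union>(P - K))"
  then obtain x where x: "x \<in> \<Union>(P - K)" "H = {y \<in> \<Union>(P - K). cut (\<Union>K) y = cut (\<Union>K) x}"
    by (rule gapsE)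
  then obtain b where b: "b \<in> P - K" "x \<in> b" by blast
  then obtain G where G: "G \<in> Gs" "b \<subseteq> G" using block_in_gap[of b] LK by blast
  have xG: "x \<in> \<Union>(inside (P - K) G)" using b G unfolding inside_def by blast
  show "H \<in> (\<Union>G\<in>Gs. gaps (\<Union>(inside (K - L) G)) (\<Union>(inside (P - K) G)))"
    unfolding x(2) gap_class_local[OF G(1) xG] using gap_in_gaps[OF xG] G(1) by blast
next
  fix H assume "H \<in> (\<Union>G\<in>Gs. gaps (\<Union>(inside (K - L) G)) (\<Union>(inside (P - K) G)))"
  then obtain G where G: "G \<in> Gs" and H: "H \<in> gaps (\<Union>(inside (K - L) G)) (\<Union>(inside (P - K) G))"
    by blast
  from H obtain x where x: "x \<in> \<Union>(inside (P - K) G)"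
    "H = {y \<in> \<Union>(inside (P - K) G). cut (\<Union>(inside (K - L) G)) y = cut (\<Union>(inside (K - L) G)) x}"
    by (rule gapsE)
  have "x \<in> \<Union>(P - K)" using x(1) unfolding inside_def by blast
  then show "H \<in> gaps (\<Union>K) (\<Union>(P - K))"
    unfolding x(2) gap_class_local[OF G x(1), symmetric] by (rule gap_in_gaps)
qed

lemma prod_gaps_decompose:
  fixes C :: "nat set set \<Rightarrow> 'k::comm_ring_1"
  shows "(\<Prod>H\<in>gaps (\<Union>K) (\<Union>(P - K)). C (inside (P - K) H)) =
    (\<Prod>G\<in>Gs. \<Prod>H\<in>gaps (\<Union>(inside (K - L) G)) (\<Union>(inside (P - L) G - inside (K - L) G)).
      C (inside (inside (P - L) G - inside (K - L) G) H))"
proof -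
  let ?g = "\<lambda>G. gaps (\<Union>(inside (K - L) G)) (\<Union>(inside (P - K) G))"
  have fin: "finite (\<Union>P)" using P by (simp add: ncfam_def)
  have sub: "H \<subseteq> G" if "H \<in> ?g G" for H G
    using gap_subset[OF that] unfolding inside_def by blast
  have "(\<Prod>H\<in>(\<Union>G\<in>Gs. ?g G). C (inside (P - K) H)) = (\<Prod>G\<in>Gs. \<Prod>H\<in>?g G. C (inside (P - K) H))"
  proof (rule prod.UNION_disjoint)
    have "\<Union>(P - L) \<subseteq> \<Union>P" by blast
    then show "finite Gs" unfolding gaps_def using fin finite_subset by blast
    have "\<Union>(inside (P - K) G) \<subseteq> \<Union>P" for G unfolding inside_def by blast
    then show "\<forall>G\<in>Gs. finite (?g G)" unfolding gaps_def using fin finite_subset by blast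
    show "\<forall>G\<in>Gs. \<forall>G'\<in>Gs. G \<noteq> G' \<longrightarrow> ?g G \<inter> ?g G' = {}"
    proof (intro ballI impI, rule ccontr)
      fix G G' assume G: "G \<in> Gs" "G' \<in> Gs" "G \<noteq> G'" and "?g G \<inter> ?g G' \<noteq> {}"
      then obtain H where H: "H \<in> ?g G" "H \<in> ?g G'" by blast
      obtain x where "x \<in> H" using gap_nonempty[OF H(1)] by blast
      then have "x \<in> G" "x \<in> G'" using sub H by blast+
      then show False using gap_unique[OF G(1,2)] G(3) by blast
    qed
  qed
  also have "\<dots> = (\<Prod>G\<in>Gs. \<Prod>H\<in>?g G. C (inside (inside (P - K) G) H))"
    by (intro prod.cong refl arg_cong[where f = C] inside_inside[symmetric] sub)
  finally show ?thesis by (simp only: gaps_decompose Diff_local)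
qed

text \<open>
  The condition \<open>B {} = 1\<close> absorbs the gaps of \<open>L\<close> in which \<open>K\<close> has no further blocks.
\<close>
lemma prod_gaps_restrict:
  fixes B :: "nat set set \<Rightarrow> 'k::comm_ring_1"
  assumes B: "B {} = 1"
  shows "(\<Prod>G\<in>Gs. B (inside (K - L) G)) =
    (\<Prod>G\<in>gaps (\<Union>L) (\<Union>(K - L)). B (inside (K - L) G))"
proof -
  let ?V = "\<Union>(K - L)"
  have VU: "?V \<subseteq> \<Union>(P - L)" using KP by blast
  have "finite (\<Union>P)" using P by (simp add: ncfam_def)
  moreover have "\<Union>(P - L) \<subseteq> \<Union>P" by blast
  ultimately have fin: "finite Gs" unfolding gaps_def using finite_subset by blast
  have empty: "inside (K - L) G = {}" if "G \<inter> ?V = {}" for G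
  proof -
    have "b \<noteq> {}" if "b \<in> K - L" for b using ncfam_nonempty[OF P] KP that by blast
    then show ?thesis using that unfolding inside_def by blast
  qed
  have "(\<Prod>G\<in>Gs. B (inside (K - L) G)) = (\<Prod>G\<in>{G \<in> Gs. G \<inter> ?V \<noteq> {}}. B (inside (K - L) G))"
    by (rule prod.mono_neutral_right) (use fin empty B in auto)
  also have "\<dots> = (\<Prod>G\<in>{G \<in> Gs. G \<inter> ?V \<noteq> {}}. B (inside (K - L) (G \<inter> ?V)))"
  proof (intro prod.cong refl arg_cong[where f = B])
    fix G show "inside (K - L) G = inside (K - L) (G \<inter> ?V)" unfolding inside_def by blast
  qed
  also have "\<dots> = (\<Prod>G\<in>gaps (\<Union>L) ?V. B (inside (K - L) G))"
    by (rule prod.reindex_bij_betw[OF bij_betw_gaps_restrict[OF VU]])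
  finally show ?thesis .
qed

end

text \<open>
  Extending \<open>L\<close> to a larger lower part of \<open>P\<close> amounts to an independent choice of a lower part
  in each gap of \<open>L\<close>.
\<close>
lemma bij_betw_lowers_choice:
  assumes P: "ncfam P" and L: "L \<in> lowers P"
  defines "Gs \<equiv> gaps (\<Union>L) (\<Union>(P - L))"
  shows "bij_betw (\<lambda>K. \<lambda>G\<in>Gs. inside (K - L) G) {K \<in> lowers P. L \<subseteq> K}
    (PiE Gs (\<lambda>G. lowers (inside (P - L) G)))"
proof (rule bij_betw_byWitness[where f' = "\<lambda>h. L \<union> (\<Union>G\<in>Gs. h G)"])
  have LP: "L \<subseteq> P" using L lowers_subset by blast
  have chain: "ideal_chain P L K" if "L \<subseteq> K" "K \<subseteq> P" for K
    using P L that by (simp add: ideal_chain_def)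
  show "\<forall>K\<in>{K \<in> lowers P. L \<subseteq> K}. L \<union> (\<Union>G\<in>Gs. (\<lambda>G\<in>Gs. inside (K - L) G) G) = K"
  proof
    fix K assume "K \<in> {K \<in> lowers P. L \<subseteq> K}"
    then have LK: "L \<subseteq> K" and KP: "K \<subseteq> P" using lowers_subset by auto
    have "\<exists>G\<in>Gs. b \<in> inside (K - L) G" if b: "b \<in> K - L" for b
      using ideal_chain.block_in_gap[OF chain[OF LK KP], of b] b KP
      unfolding Gs_def inside_def by blast
    moreover have "inside (K - L) G \<subseteq> K - L" for G by (rule inside_subset)
    ultimately have "(\<Union>G\<in>Gs. inside (K - L) G) = K - L" by blast
    then show "L \<union> (\<Union>G\<in>Gs. (\<lambda>G\<in>Gs. inside (K - L) G) G) = K" using LK by auto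
  qed
  show "(\<lambda>K. \<lambda>G\<in>Gs. inside (K - L) G) ` {K \<in> lowers P. L \<subseteq> K}
    \<subseteq> (\<Pi>\<^sub>E G\<in>Gs. lowers (inside (P - L) G))"
  proof (rule image_subsetI, rule restrict_PiE_iff[THEN iffD2])
    fix K assume K: "K \<in> {K \<in> lowers P. L \<subseteq> K}"
    then have LK: "L \<subseteq> K" and KP: "K \<subseteq> P" using lowers_subset by auto
    show "\<forall>G\<in>Gs. inside (K - L) G \<in> lowers (inside (P - L) G)"
      using ideal_chain.lowers_iff_local[OF chain[OF LK KP]] K unfolding Gs_def by simp
  qed
  have local: "L \<union> (\<Union>G\<in>Gs. h G) \<subseteq> P" "G \<in> Gs \<Longrightarrow> inside ((L \<union> (\<Union>G\<in>Gs. h G)) - L) G = h G"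
    if h: "h \<in> (\<Pi>\<^sub>E G\<in>Gs. lowers (inside (P - L) G))" for h G
  proof -
    have hG: "h G \<subseteq> inside (P - L) G" if "G \<in> Gs" for G
      using h that lowers_subset by (auto simp: PiE_iff)
    then show "L \<union> (\<Union>G\<in>Gs. h G) \<subseteq> P" using LP unfolding inside_def by blast
    have "c \<in> h G" if c: "c \<in> h G'" "G' \<in> Gs" "c \<subseteq> G" and G: "G \<in> Gs" for c G'
    proof -
      have "c \<in> P" "c \<subseteq> G'" using hG[OF c(2)] c(1) unfolding inside_def by blast+
      then obtain x where "x \<in> c" "x \<in> G'" using ncfam_nonempty[OF P, of c] by blast
      then have "G = G'" using gap_unique[of G _ _ G' x] G c unfolding Gs_def by blast
      then show ?thesis using c by simp
    qed
    moreover have "h G \<inter> L = {}" "c \<in> h G \<Longrightarrow> c \<subseteq> G" if "G \<in> Gs" for c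
      using hG[OF that] unfolding inside_def by blast+
    ultimately show "inside ((L \<union> (\<Union>G\<in>Gs. h G)) - L) G = h G" if "G \<in> Gs"
      using that unfolding inside_def by blast
  qed
  show "\<forall>h\<in>\<Pi>\<^sub>E G\<in>Gs. lowers (inside (P - L) G).
    (\<lambda>G\<in>Gs. inside ((L \<union> (\<Union>G\<in>Gs. h G)) - L) G) = h"
  proof (intro ballI ext)
    fix h G assume h: "h \<in> (\<Pi>\<^sub>E G\<in>Gs. lowers (inside (P - L) G))"
    show "(\<lambda>G\<in>Gs. inside ((L \<union> (\<Union>G\<in>Gs. h G)) - L) G) G = h G"
    proof (cases "G \<in> Gs")
      case True then show ?thesis using local(2)[OF h True] by simp
    next
      case False then show ?thesis using h by (simp add: PiE_def extensional_def)
    qed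
  qed
  show "(\<lambda>h. L \<union> (\<Union>G\<in>Gs. h G)) ` (\<Pi>\<^sub>E G\<in>Gs. lowers (inside (P - L) G)) \<subseteq> {K \<in> lowers P. L \<subseteq> K}"
  proof (rule image_subsetI)
    fix h assume h: "h \<in> (\<Pi>\<^sub>E G\<in>Gs. lowers (inside (P - L) G))"
    have "\<forall>G\<in>Gs. inside ((L \<union> (\<Union>G\<in>Gs. h G)) - L) G \<in> lowers (inside (P - L) G)"
      using local(2)[OF h] h by (simp add: PiE_iff)
    then have "L \<union> (\<Union>G\<in>Gs. h G) \<in> lowers P"
      using ideal_chain.lowers_iff_local[OF chain[OF _ local(1)[OF h]]] unfolding Gs_def by simp
    then show "L \<union> (\<Union>G\<in>Gs. h G) \<in> {K \<in> lowers P. L \<subseteq> K}" by simp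
  qed
qed

lemma lowers_trans:
  assumes P: "ncfam P" and K: "K \<in> lowers P"
  shows "L \<in> lowers K \<longleftrightarrow> L \<in> lowers P \<and> L \<subseteq> K"
proof (intro iffI conjI)
  assume L: "L \<in> lowers K"
  then show LK: "L \<subseteq> K" using lowers_subset by blast
  have KP: "K \<subseteq> P" using K lowers_subset by blast
  show "L \<in> lowers P"
  proof (rule lowersI)
    show "L \<subseteq> P" using LK KP by blast
    fix b x y assume b: "b \<in> P - L" "x \<in> b" "y \<in> b"
    show "cut (\<Union>L) x = cut (\<Union>L) y"
    proof (cases "b \<in> K")
      case True then show ?thesis using lowers_cut[OF L, of b x y] b by simp
    next
      case False
      then have "cut (\<Union>K) x = cut (\<Union>K) y" using lowers_cut[OF K, of b x y] b by simp
      then show ?thesis by (rule cut_refine[rotated]) (use LK in blast)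
    qed
  qed
next
  assume "L \<in> lowers P \<and> L \<subseteq> K"
  then show "L \<in> lowers K"
    using lowers_cut[of L P] lowers_subset[OF K] by (auto intro!: lowersI)
qed

text \<open>
  Both sides sum over chains \<open>L \<subseteq> K\<close> of lower parts. On the left \<open>K\<close> is chosen first; on the right
  \<open>L\<close> comes first and \<open>K\<close> is chosen gap by gap.
\<close>
theorem cconv_assoc:
  fixes A B C :: "nat set set \<Rightarrow> 'k::comm_ring_1"
  assumes P: "ncfam P" and B: "B {} = 1"
  shows "cconv (cconv A B) C P = cconv A (cconv B C) P"
proof -
  define g where "g K L = A L * (\<Prod>G\<in>gaps (\<Union>L) (\<Union>(K - L)). B (inside (K - L) G)) *
    (\<Prod>H\<in>gaps (\<Union>K) (\<Union>(P - K)). C (inside (P - K) H))" for K L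
  have "cconv (cconv A B) C P = (\<Sum>K\<in>lowers P. \<Sum>L\<in>lowers K. g K L)"
    unfolding cconv_def g_def by (simp add: sum_distrib_right)
  also have "\<dots> = (\<Sum>K\<in>lowers P. \<Sum>L | L \<in> lowers P \<and> L \<subseteq> K. g K L)"
    by (intro sum.cong refl) (auto simp: lowers_trans[OF P])
  also have "\<dots> = (\<Sum>L\<in>lowers P. \<Sum>K | K \<in> lowers P \<and> L \<subseteq> K. g K L)"
    by (rule sum.swap_restrict) (use finite_lowers P in auto)
  also have "\<dots> = (\<Sum>L\<in>lowers P. A L *
      (\<Prod>G\<in>gaps (\<Union>L) (\<Union>(P - L)). cconv B C (inside (P - L) G)))"
  proof (rule sum.cong[OF refl])
    fix L assume L: "L \<in> lowers P"
    let ?Gs = "gaps (\<Union>L) (\<Union>(P - L))"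
    let ?F = "\<lambda>G M. B M * (\<Prod>H\<in>gaps (\<Union>M) (\<Union>(inside (P - L) G - M)). C (inside (inside (P - L) G - M) H))"
    have ncPL: "ncfam (P - L)" using P by (rule ncfam_subset) simp
    have finG: "finite ?Gs"
      using ncfam_finite coarsening_ncfam[OF ncPL] gaps_coarsening[OF P L] by blast
    have "(\<Prod>G\<in>?Gs. cconv B C (inside (P - L) G)) =
        (\<Sum>h\<in>(\<Pi>\<^sub>E G\<in>?Gs. lowers (inside (P - L) G)). \<Prod>G\<in>?Gs. ?F G (h G))"
      unfolding cconv_def
      by (rule prod_sum_PiE) (use finG finite_lowers ncfam_inside[OF ncPL] in auto)
    also have "\<dots> = (\<Sum>K\<in>{K \<in> lowers P. L \<subseteq> K}. \<Prod>G\<in>?Gs. ?F G ((\<lambda>G\<in>?Gs. inside (K - L) G) G))"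
      by (rule sum.reindex_bij_betw[OF bij_betw_lowers_choice[OF P L], symmetric])
    also have "\<dots> = (\<Sum>K\<in>{K \<in> lowers P. L \<subseteq> K}. \<Prod>G\<in>?Gs. ?F G (inside (K - L) G))"
      by simp
    finally have eq: "(\<Prod>G\<in>?Gs. cconv B C (inside (P - L) G)) =
      (\<Sum>K\<in>{K \<in> lowers P. L \<subseteq> K}. \<Prod>G\<in>?Gs. ?F G (inside (K - L) G))" .
    have "g K L = A L * (\<Prod>G\<in>?Gs. ?F G (inside (K - L) G))" if "K \<in> {K \<in> lowers P. L \<subseteq> K}" for K
    proof -
      interpret ideal_chain P L K
        using P L that lowers_subset by (simp add: ideal_chain_def)
      show ?thesis
        unfolding g_def prod_gaps_decompose prod_gaps_restrict[of B, OF B, symmetric]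
        by (simp add: prod.distrib mult.assoc)
    qed
    then show "(\<Sum>K | K \<in> lowers P \<and> L \<subseteq> K. g K L) =
      A L * (\<Prod>G\<in>?Gs. cconv B C (inside (P - L) G))"
      unfolding eq sum_distrib_left by (intro sum.cong) simp_all
  qed
  finally show ?thesis by (simp add: cconv_def)
qed

section \<open>Units and cancellation\<close>

text \<open>
  The value at \<open>{}\<close> has to be \<open>1\<close>, as for every multiplicative function. With \<open>c = 1\<close> this is
  \<open>\<epsilon>\<^sub>\<delta>\<close>, with \<open>c = -1\<close> it is \<open>\<gamma>\<^sub>-\<^sub>1\<close>.
\<close>
definition one_block :: "'k \<Rightarrow> nat set set \<Rightarrow> 'k::comm_ring_1" where
  "one_block c P = (if P = {} then 1 else if card P = 1 then c else 0)"

definition empty_ind :: "nat set set \<Rightarrow> 'k::comm_ring_1" where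
  "empty_ind P = (if P = {} then 1 else 0)"

lemma ncfam_empty: "ncfam {}"
  by (simp add: ncfam_iff noncrossing_def)

lemma ncfam_Union_empty: "ncfam P \<Longrightarrow> \<Union>P = {} \<longleftrightarrow> P = {}"
  by (auto dest: ncfam_nonempty)

lemma coarsening_empty_iff: "ncfam P \<Longrightarrow> R \<in> coarsenings P \<Longrightarrow> R = {} \<longleftrightarrow> P = {}"
  using ncfam_Union_empty[of P] ncfam_Union_empty[of R] coarsening_Union[of P R] coarsening_ncfam[of P R]
  by simp

lemma coarsening_refl: "ncfam P \<Longrightarrow> P \<in> coarsenings P"
  by (auto simp: coarsenings_iff)

lemma coarsenings_empty: "coarsenings {} = {{}}"
  using coarsening_empty_iff[OF ncfam_empty] coarsening_refl[OF ncfam_empty] by blast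

lemma top_coarsening: "ncfam P \<Longrightarrow> P \<noteq> {} \<Longrightarrow> {\<Union>P} \<in> coarsenings P"
proof -
  assume P: "ncfam P" "P \<noteq> {}"
  then have "\<Union>P \<noteq> {}" using ncfam_Union_empty[of P] by simp
  then have "ncfam {\<Union>P}" using P(1) by (simp add: ncfam_iff noncrossing_def)
  then show ?thesis using P(1) by (auto simp: coarsenings_iff)
qed

lemma inside_Union: "inside P (\<Union>P) = P"
  unfolding inside_def by blast

lemma cstar_empty: "cstar A B {} = A {}"
  by (simp add: cstar_def coarsenings_empty)

lemma cconv_empty: "cconv A B {} = A {}"
proof -
  have "lowers {} = {{}}" unfolding lowers_def by blast
  then show ?thesis by (simp add: cconv_def gaps_def)
qed

text \<open>
  Only the coarsening into a single block contributes.
\<close>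
lemma cstar_one_block_left:
  assumes P: "ncfam P" "P \<noteq> {}"
  shows "cstar (one_block c) B P = c * B P"
proof -
  have "one_block c R * (\<Prod>C\<in>R. B (inside P C)) = 0" if R: "R \<in> coarsenings P - {{\<Union>P}}" for R
  proof -
    have "R \<noteq> {}" using R coarsening_empty_iff[OF P(1), of R] P(2) by simp
    moreover have "card R \<noteq> 1"
    proof
      assume "card R = 1"
      then obtain C where "R = {C}" by (auto simp: card_1_singleton_iff)
      then show False using R coarsening_Union[OF P(1), of R] by simp
    qed
    ultimately show ?thesis by (simp add: one_block_def)
  qed
  then have "cstar (one_block c) B P = (\<Sum>R\<in>{{\<Union>P}}. one_block c R * (\<Prod>C\<in>R. B (inside P C)))"
    unfolding cstar_def
    by (intro sum.mono_neutral_right) (use finite_coarsenings[OF P(1)] top_coarsening[OF P] in auto)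
  then show ?thesis by (simp add: one_block_def inside_Union)
qed

lemma inside_self:
  assumes P: "ncfam P" and b: "b \<in> P" shows "inside P b = {b}"
proof -
  have "c = b" if c: "c \<in> P" "c \<subseteq> b" for c
  proof -
    obtain x where "x \<in> c" using ncfam_nonempty[OF P c(1)] by blast
    then show ?thesis using ncfam_block_eq[OF P c(1) b] c(2) by blast
  qed
  then show ?thesis using b unfolding inside_def by blast
qed

text \<open>
  Only \<open>R = P\<close> contributes: otherwise some block of \<open>R\<close> contains at least two blocks of \<open>P\<close>.
\<close>
lemma cstar_one_block_right:
  assumes P: "ncfam P"
  shows "cstar A (one_block c) P = A P * c ^ card P"
proof -
  have "A R * (\<Prod>C\<in>R. one_block c (inside P C)) = 0" if R: "R \<in> coarsenings P - {P}" for R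
  proof -
    have RP: "R \<in> coarsenings P" using R by simp
    have ncR: "ncfam R" using coarsening_ncfam[OF P RP] .
    have "\<exists>C\<in>R. one_block c (inside P C) = 0"
    proof (rule ccontr)
      assume neg: "\<not> (\<exists>C\<in>R. one_block c (inside P C) = 0)"
      have CP: "C \<in> P" if C: "C \<in> R" for C
      proof -
        have U: "\<Union>(inside P C) = C" by (rule Union_inside[OF P RP C])
        then have "inside P C \<noteq> {}" using ncfam_nonempty[OF ncR C] by auto
        then have "card (inside P C) = 1" using neg C by (auto simp: one_block_def split: if_splits)
        then obtain b where "inside P C = {b}" by (auto simp: card_1_singleton_iff)
        then show ?thesis using U unfolding inside_def by auto
      qed
      have "b \<in> R" if b: "b \<in> P" for b
      proof -
        obtain C where "C \<in> R" "b \<subseteq> C" using coarsening_covers[OF P RP b] by blast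
        then have "b = C" using inside_self[OF P CP[of C]] b unfolding inside_def by blast
        then show ?thesis using \<open>C \<in> R\<close> by simp
      qed
      then show False using R CP by blast
    qed
    then have "(\<Prod>C\<in>R. one_block c (inside P C)) = 0"
      using ncfam_finite[OF ncR] by (auto intro: prod_zero)
    then show ?thesis by simp
  qed
  then have "cstar A (one_block c) P = (\<Sum>R\<in>{P}. A R * (\<Prod>C\<in>R. one_block c (inside P C)))"
    unfolding cstar_def
    by (intro sum.mono_neutral_right) (use finite_coarsenings[OF P] coarsening_refl[OF P] in auto)
  also have "\<dots> = A P * (\<Prod>C\<in>P. c)"
    by (simp add: inside_self[OF P] one_block_def)
  finally show ?thesis by simp
qed

lemma cstar_empty_ind:
  assumes P: "ncfam P" shows "cstar empty_ind B P = empty_ind P"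
proof (cases "P = {}")
  case False
  then have "R \<noteq> {}" if "R \<in> coarsenings P" for R using coarsening_empty_iff[OF P that] by simp
  then show ?thesis using False by (simp add: cstar_def empty_ind_def)
qed (simp add: cstar_empty)

lemma empty_lowers: "{} \<in> lowers P"
  by (rule lowersI) (simp_all add: cut_def)

lemma full_lowers: "P \<in> lowers P"
  by (rule lowersI) simp_all

lemma gaps_empty_cut: "U \<noteq> {} \<Longrightarrow> gaps {} U = {U}"
  by (auto simp: gaps_def cut_def)

lemma gap_product_empty:
  assumes "B {} = (1 :: 'k::comm_ring_1)" "ncfam P"
  shows "(\<Prod>G\<in>gaps (\<Union>{}) (\<Union>(P - {})). B (inside (P - {}) G)) = B P"
proof (cases "P = {}")
  case False
  then have "gaps {} (\<Union>P) = {\<Union>P}" using ncfam_Union_empty[OF assms(2)] by (intro gaps_empty_cut) blast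
  then show ?thesis by (simp add: inside_Union)
qed (simp add: gaps_def assms)

lemma cconv_empty_ind_left:
  assumes B: "B {} = (1 :: 'k::comm_ring_1)" and P: "ncfam P"
  shows "cconv empty_ind B P = B P"
proof -
  have "cconv empty_ind B P =
    (\<Sum>K\<in>{{}}. empty_ind K * (\<Prod>G\<in>gaps (\<Union>K) (\<Union>(P - K)). B (inside (P - K) G)))"
    unfolding cconv_def
    by (intro sum.mono_neutral_right) (use finite_lowers[OF P] empty_lowers in \<open>auto simp: empty_ind_def\<close>)
  then show ?thesis using gap_product_empty[of B, OF B P] by (simp add: empty_ind_def)
qed

text \<open>
  Removing at most one block, which must be minimal for the nesting order, gives a recursion for the
  convolution powers of \<open>\<epsilon>\<^sub>\<delta>\<close> whose correction term only involves smaller families.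
\<close>
lemma cconv_one_block_left:
  assumes B: "B {} = (1 :: 'k::comm_ring_1)" and P: "ncfam P"
  shows "cconv (one_block 1) B P = B P +
    (\<Sum>b | b \<in> P \<and> {b} \<in> lowers P. \<Prod>G\<in>gaps b (\<Union>(P - {b})). B (inside (P - {b}) G))"
proof -
  let ?t = "\<lambda>K. one_block 1 K * (\<Prod>G\<in>gaps (\<Union>K) (\<Union>(P - K)). B (inside (P - K) G))"
  let ?X = "{b. b \<in> P \<and> {b} \<in> lowers P}"
  have finX: "finite ?X" using ncfam_finite[OF P] by simp
  have "cconv (one_block 1) B P = (\<Sum>K\<in>insert {} ((\<lambda>b. {b}) ` ?X). ?t K)"
    unfolding cconv_def
  proof (rule sum.mono_neutral_right)
    show "finite (lowers P)" by (rule finite_lowers[OF P])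
    show "insert {} ((\<lambda>b. {b}) ` ?X) \<subseteq> lowers P" using empty_lowers by auto
    show "\<forall>K\<in>lowers P - insert {} ((\<lambda>b. {b}) ` ?X). ?t K = 0"
    proof
      fix K assume K: "K \<in> lowers P - insert {} ((\<lambda>b. {b}) ` ?X)"
      have "card K \<noteq> 1"
      proof
        assume "card K = 1"
        then obtain b where "K = {b}" by (auto simp: card_1_singleton_iff)
        then show False using K lowers_subset[of K P] by auto
      qed
      then show "?t K = 0" using K by (simp add: one_block_def)
    qed
  qed
  also have "\<dots> = ?t {} + (\<Sum>K\<in>(\<lambda>b. {b}) ` ?X. ?t K)"
    by (rule sum.insert) (use finX in auto)
  also have "(\<Sum>K\<in>(\<lambda>b. {b}) ` ?X. ?t K) = (\<Sum>b\<in>?X. ?t {b})"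
    by (subst sum.reindex) (auto simp: inj_on_def)
  also have "\<dots> = (\<Sum>b\<in>?X. \<Prod>G\<in>gaps b (\<Union>(P - {b})). B (inside (P - {b}) G))"
    by (simp add: one_block_def)
  also have "?t {} = B P" using gap_product_empty[of B, OF B P] by (simp add: one_block_def)
  finally show ?thesis .
qed

text \<open>
  The term \<open>K = P\<close> contributes \<open>A P\<close>, and all other terms involve \<open>A\<close> on smaller families only.
\<close>
lemma cconv_right_cancel:
  assumes eq: "\<And>P. ncfam P \<Longrightarrow> cconv A B P = cconv A' B P"
  shows "ncfam P \<Longrightarrow> A P = A' P"
proof (induction "card P" arbitrary: P rule: less_induct)
  case less
  let ?t = "\<lambda>K. (\<Prod>G\<in>gaps (\<Union>K) (\<Union>(P - K)). B (inside (P - K) G))"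
  have fin: "finite (lowers P)" by (rule finite_lowers[OF less.prems])
  have split: "cconv X B P = X P + (\<Sum>K\<in>lowers P - {P}. X K * ?t K)" for X
    unfolding cconv_def by (subst sum.remove[OF fin full_lowers]) (simp add: gaps_def)
  have "A K = A' K" if K: "K \<in> lowers P - {P}" for K
  proof (rule less.hyps)
    have "K \<subset> P" using K lowers_subset[of K P] by blast
    then show "card K < card P" using ncfam_finite[OF less.prems] by (rule psubset_card_mono[rotated])
    show "ncfam K" using ncfam_subset[OF less.prems] \<open>K \<subset> P\<close> by blast
  qed
  then have "(\<Sum>K\<in>lowers P - {P}. A K * ?t K) = (\<Sum>K\<in>lowers P - {P}. A' K * ?t K)"
    by (intro sum.cong refl) simp
  then show ?case using eq[OF less.prems] split[of A] split[of A'] by simp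
qed

section \<open>Flat families\<close>

text \<open>
  No two blocks are nested; on noncrossing partitions this is \<open>\<pi> = Base(\<pi>)\<close>.
\<close>
definition flat :: "nat set set \<Rightarrow> bool" where
  "flat P \<longleftrightarrow> (\<forall>b\<in>P. \<forall>b'\<in>P. \<forall>x\<in>b. \<forall>z\<in>b. \<forall>y\<in>b'. x < y \<and> y < z \<longrightarrow> b = b')"

lemma flatD: "flat P \<Longrightarrow> b \<in> P \<Longrightarrow> b' \<in> P \<Longrightarrow> x \<in> b \<Longrightarrow> z \<in> b \<Longrightarrow> y \<in> b' \<Longrightarrow> x < y \<Longrightarrow> y < z \<Longrightarrow> b = b'"
  unfolding flat_def by metis

lemma flatI: "(\<And>b b' x y z. b \<in> P \<Longrightarrow> b' \<in> P \<Longrightarrow> x \<in> b \<Longrightarrow> z \<in> b \<Longrightarrow> y \<in> b' \<Longrightarrow> x < y \<Longrightarrow> y < z \<Longrightarrow> b = b')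
  \<Longrightarrow> flat P"
  unfolding flat_def by metis

lemma flat_subset: "flat P \<Longrightarrow> Q \<subseteq> P \<Longrightarrow> flat Q"
  unfolding flat_def by (meson subsetD)

lemma alternating_sum_Pow:
  assumes "finite M"
  shows "(\<Sum>W\<in>Pow M. (- 1) ^ card W) = (if M = {} then 1 else 0 :: 'k::comm_ring_1)"
proof -
  have "(\<Prod>m\<in>M. (- 1) + 1 :: 'k) = (\<Sum>W\<in>Pow M. (\<Prod>m\<in>W. - 1) * (\<Prod>m\<in>M - W. 1))"
    by (rule prod_add[OF assms])
  then have "(\<Sum>W\<in>Pow M. (- 1) ^ card W) = (\<Prod>m\<in>M. 0 :: 'k)" by simp
  also have "\<dots> = (if M = {} then 1 else 0)" using assms by (simp add: power_0_left)
  finally show ?thesis .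
qed

lemma cut_eqI:
  assumes "\<And>k. k \<in> W \<Longrightarrow> x \<le> k \<Longrightarrow> \<not> k < y" "\<And>k. k \<in> W \<Longrightarrow> y \<le> k \<Longrightarrow> \<not> k < x"
  shows "cut W x = cut W y"
  unfolding cut_def using assms by (metis not_less)

text \<open>
  If an element of \<open>b'\<close> lies between elements of \<open>b\<close>, then leaving the span of \<open>b\<close> would create a
  crossing with the minimum and maximum of \<open>b\<close>.
\<close>
lemma noncrossing_nested:
  assumes P: "ncfam P" and b: "b \<in> P" "b' \<in> P" and xyz: "x \<in> b" "z \<in> b" "y \<in> b'" "x < y" "y < z"
  shows "b' \<subseteq> {Min b..Max b}"
proof (cases "b = b'")
  case True
  then show ?thesis using ncfam_block_finite[OF P b(1)] by auto
next
  case False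
  have fin: "finite b" "b \<noteq> {}" using ncfam_block_finite[OF P b(1)] xyz(1) by auto
  have nc: "noncrossing P" using P by (simp add: ncfam_def)
  have mM: "Min b \<in> b" "Max b \<in> b" using fin by auto
  have le: "Min b < y" "y < Max b"
    using Min_le[OF fin(1) xyz(1)] Max_ge[OF fin(1) xyz(2)] xyz(4,5) by linarith+
  show ?thesis
  proof
    fix t assume t: "t \<in> b'"
    have "\<not> Max b < t" using noncrossingD[OF nc b mM xyz(3) t le] False by blast
    moreover have "\<not> t < Min b" using noncrossingD[OF nc b(2,1) t xyz(3) mM _ le] False by blast
    ultimately show "t \<in> {Min b..Max b}" by simp
  qed
qed

text \<open>
  The maximal elements of the nesting order, described without minima and maxima.
\<close>
definition leaves :: "nat set set \<Rightarrow> nat set set" where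
  "leaves P = {m \<in> P. \<forall>b\<in>P. \<forall>x\<in>m. \<forall>z\<in>m. \<forall>y\<in>b. x < y \<and> y < z \<longrightarrow> m = b}"

lemma leaves_nonempty:
  assumes P: "ncfam P" "P \<noteq> {}" shows "leaves P \<noteq> {}"
proof -
  \<comment> \<open>A block of shortest span has no block nested in it.\<close>
  define m where "m = arg_min_on (\<lambda>b. Max b - Min b) P"
  have m: "m \<in> P" "\<And>b. b \<in> P \<Longrightarrow> Max m - Min m \<le> Max b - Min b"
    unfolding m_def using arg_min_if_finite(1)[OF ncfam_finite[OF P(1)] P(2)]
      arg_min_least[OF ncfam_finite[OF P(1)] P(2)] by auto
  have "m = b" if b: "b \<in> P" "x \<in> m" "z \<in> m" "y \<in> b" "x < y" "y < z" for b x y z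
  proof (rule ccontr)
    assume "m \<noteq> b"
    have sub: "b \<subseteq> {Min m..Max m}" by (rule noncrossing_nested[OF P(1) m(1) b(1) b(2-6)])
    have fin: "finite b" "b \<noteq> {}" "finite m" "m \<noteq> {}"
      using ncfam_block_finite[OF P(1)] b m(1) by auto
    then have "Min b \<in> b" "Max b \<in> b" "Min m \<in> m" by auto
    moreover from this have "Min b \<noteq> Min m"
      using ncfam_block_eq[OF P(1) b(1) m(1), of "Min b"] \<open>m \<noteq> b\<close> by auto
    ultimately have "Min m < Min b" "Max b \<le> Max m" "Min b \<le> Max b"
      using sub fin by (auto simp: subset_iff order_less_le)
    then show False using m(2)[OF b(1)] by linarith
  qed
  then have "m \<in> leaves P" using m(1) unfolding leaves_def by blast
  then show ?thesis by blast
qed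

text \<open>
  An ideal without nested blocks is the same as a set of maximal blocks.
\<close>
lemma lower_flat_complement_iff:
  assumes P: "ncfam P" and K: "K \<subseteq> P"
  shows "K \<in> lowers P \<and> flat (P - K) \<longleftrightarrow> P - K \<subseteq> leaves P"
proof (intro iffI conjI)
  assume *: "K \<in> lowers P \<and> flat (P - K)"
  show "P - K \<subseteq> leaves P"
  proof
    fix m assume m: "m \<in> P - K"
    have "m = b" if b: "b \<in> P" "x \<in> m" "z \<in> m" "y \<in> b" "x < y" "y < z" for b x y z
    proof (cases "b \<in> K")
      case True
      then have "y \<in> \<Union>K" using b by blast
      then show ?thesis
        using cut_between[OF b(5,6), of "\<Union>K"] lowers_cut[of K P m x z] * m b by blast
    next
      case False
      then show ?thesis using flatD[of "P - K" m b x z y] * m b by simp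
    qed
    then show "m \<in> leaves P" using m unfolding leaves_def by blast
  qed
next
  assume *: "P - K \<subseteq> leaves P"
  have leaf: "m = b" if "m \<in> P - K" "b \<in> P" "x \<in> m" "z \<in> m" "y \<in> b" "x < y" "y < z" for m b x y z
    using * that unfolding leaves_def by blast
  show "flat (P - K)" by (rule flatI) (use leaf in blast)
  have aux: "\<not> k < y" if b: "b \<in> P - K" "x \<in> b" "y \<in> b" and k: "k \<in> \<Union>K" "x \<le> k" for b x y k
  proof
    assume "k < y"
    obtain c where c: "c \<in> K" "k \<in> c" using k by blast
    then have cP: "c \<in> P" using K by blast
    have "x \<noteq> k" using ncfam_block_eq[OF P _ cP, of b x] b c by auto
    then have "b = c" using leaf[OF b(1) cP b(2,3) c(2)] k \<open>k < y\<close> by simp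
    then show False using b c by simp
  qed
  show "K \<in> lowers P"
  proof (rule lowersI[OF K])
    fix b x y assume "b \<in> P - K" "x \<in> b" "y \<in> b"
    then show "cut (\<Union>K) x = cut (\<Union>K) y"
      by (intro cut_eqI) (use aux in blast)+
  qed
qed

text \<open>
  The function of \<open>\<lambda>\<^sup>s \<star> \<gamma>\<^sub>-\<^sub>1\<close>.
\<close>
definition flat_sign :: "nat set set \<Rightarrow> 'k::comm_ring_1" where
  "flat_sign P = (if flat P then (- 1) ^ card P else 0)"

text \<open>
  A block nested in another one lies in the same gap, so nesting is visible inside a single gap.
\<close>
lemma flat_iff_gaps:
  assumes P: "ncfam P" and K: "K \<in> lowers P"
  shows "flat (P - K) \<longleftrightarrow> (\<forall>G\<in>gaps (\<Union>K) (\<Union>(P - K)). flat (inside (P - K) G))"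
proof (intro iffI ballI)
  fix G assume "flat (P - K)"
  then show "flat (inside (P - K) G)" by (rule flat_subset) (rule inside_subset)
next
  assume loc: "\<forall>G\<in>gaps (\<Union>K) (\<Union>(P - K)). flat (inside (P - K) G)"
  have nc: "ncfam (P - K)" using P by (rule ncfam_subset) simp
  note cov = gaps_coarsening[OF P K]
  show "flat (P - K)"
  proof (rule flatI)
    fix b b' x y z assume b: "b \<in> P - K" "b' \<in> P - K" "x \<in> b" "z \<in> b" "y \<in> b'" "x < y" "y < z"
    obtain G where G: "G \<in> gaps (\<Union>K) (\<Union>(P - K))" "b \<subseteq> G"
      using coarsening_covers[OF nc cov b(1)] by blast
    have xz: "x \<in> G" "z \<in> G" using G b by auto
    have "cut (\<Union>K) x \<subseteq> cut (\<Union>K) y" "cut (\<Union>K) y \<subseteq> cut (\<Union>K) z"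
      using b by (auto intro!: cut_mono)
    then have "cut (\<Union>K) y = cut (\<Union>K) x" using gap_cut[OF G(1) xz] by simp
    moreover have "y \<in> \<Union>(P - K)" using b by blast
    ultimately have "y \<in> G" using gap_eq[OF G(1) xz(1)] by simp
    then have "b' \<subseteq> G" using coarsening_block_subset[OF nc cov b(2) G(1) b(5)] by simp
    then have "b \<in> inside (P - K) G" "b' \<in> inside (P - K) G"
      using b G unfolding inside_def by blast+
    then show "b = b'" using flatD[of "inside (P - K) G" b b' x z y] loc G(1) b by simp
  qed
qed

lemma flat_sign_gaps:
  assumes P: "ncfam P" and K: "K \<in> lowers P"
  shows "(\<Prod>G\<in>gaps (\<Union>K) (\<Union>(P - K)). flat_sign (inside (P - K) G)) = flat_sign (P - K)"
proof -
  let ?Gs = "gaps (\<Union>K) (\<Union>(P - K))"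
  have nc: "ncfam (P - K)" using P by (rule ncfam_subset) simp
  note cov = gaps_coarsening[OF P K]
  have fin: "finite ?Gs" using ncfam_finite[OF coarsening_ncfam[OF nc cov]] .
  show ?thesis
  proof (cases "flat (P - K)")
    case True
    then have "\<forall>G\<in>?Gs. flat (inside (P - K) G)" using flat_iff_gaps[OF assms] by simp
    then have "(\<Prod>G\<in>?Gs. flat_sign (inside (P - K) G)) = (\<Prod>G\<in>?Gs. \<Prod>b\<in>inside (P - K) G. - 1)"
      by (intro prod.cong refl) (simp add: flat_sign_def)
    also have "\<dots> = (\<Prod>b\<in>P - K. - 1)" by (rule prod_coarsening_split[OF nc cov, symmetric])
    finally show ?thesis using True by (simp add: flat_sign_def)
  next
    case False
    then obtain G where "G \<in> ?Gs" "\<not> flat (inside (P - K) G)" using flat_iff_gaps[OF assms] by blast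
    then have "(\<Prod>G\<in>?Gs. flat_sign (inside (P - K) G)) = 0"
      by (intro prod_zero[OF fin]) (auto simp: flat_sign_def)
    then show ?thesis using False by (simp add: flat_sign_def)
  qed
qed

text \<open>
  The surviving terms are indexed by the sets \<open>J\<close> of maximal blocks, each with sign
  \<open>(-1) ^ card J\<close>. They cancel because a nonempty family has a maximal block.
\<close>
lemma cconv_const_flat_sign:
  assumes P: "ncfam P"
  shows "cconv (\<lambda>_. 1) flat_sign P = (empty_ind P :: 'k::comm_ring_1)"
proof -
  have finP: "finite P" by (rule ncfam_finite[OF P])
  have "cconv (\<lambda>_. 1) flat_sign P = (\<Sum>K\<in>lowers P. flat_sign (P - K) :: 'k)"
    unfolding cconv_def by (intro sum.cong refl) (simp add: flat_sign_gaps[OF P])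
  also have "\<dots> = (\<Sum>K\<in>{K \<in> lowers P. flat (P - K)}. (- 1) ^ card (P - K))"
    by (rule sum.mono_neutral_cong_right) (use finite_lowers[OF P] in \<open>auto simp: flat_sign_def\<close>)
  also have "\<dots> = (\<Sum>J\<in>Pow (leaves P). (- 1) ^ card J)"
  proof (rule sum.reindex_bij_witness[where i = "\<lambda>J. P - J" and j = "\<lambda>K. P - K"])
    fix K assume "K \<in> {K \<in> lowers P. flat (P - K)}"
    then have K: "K \<subseteq> P" "K \<in> lowers P" "flat (P - K)" using lowers_subset by auto
    show "P - (P - K) = K" using K by blast
    show "P - K \<in> Pow (leaves P)" using lower_flat_complement_iff[OF P K(1)] K by blast
    show "(- 1) ^ card (P - K) = ((- 1) ^ card (P - K) :: 'k)" ..
  next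
    fix J assume J: "J \<in> Pow (leaves P)"
    then have JP: "J \<subseteq> P" unfolding leaves_def by blast
    then show PPJ: "P - (P - J) = J" by blast
    have "P - (P - J) \<subseteq> leaves P" using J PPJ by simp
    then have "P - J \<in> lowers P \<and> flat (P - (P - J))"
      using lower_flat_complement_iff[OF P, of "P - J"] by blast
    then show "P - J \<in> {K \<in> lowers P. flat (P - K)}" by blast
  qed
  also have "\<dots> = (if leaves P = {} then 1 else 0)"
    by (rule alternating_sum_Pow) (use finP in \<open>simp add: leaves_def\<close>)
  also have "\<dots> = empty_ind P"
  proof (cases "P = {}")
    case True then show ?thesis by (simp add: leaves_def empty_ind_def)
  qed (simp add: leaves_nonempty[OF P] empty_ind_def)
  finally show ?thesis .
qed

section \<open>Flat coarsenings\<close>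

text \<open>
  A flat coarsening of a flat family \<open>P\<close> cuts the line into consecutive pieces. It is recovered from the right ends of
  its pieces, except the last one, as the family of gaps of that set of end points; the next lemmas
  show that this is a bijection with the sets of right ends of non-final blocks of \<open>P\<close>.
\<close>
lemma flat_gaps:
  "flat (gaps W U)"
proof (rule flatI)
  fix b b' x y z assume b: "b \<in> gaps W U" "b' \<in> gaps W U" "x \<in> b" "z \<in> b" "y \<in> b'" "x < y" "y < z"
  then have "cut W x \<subseteq> cut W y" "cut W y \<subseteq> cut W z" by (auto intro!: cut_mono)
  then have "cut W y = cut W x" using gap_cut[OF b(1,3,4)] by simp
  then have "y \<in> b" using gap_eq[OF b(1,3)] gap_subset[OF b(2)] b(5) by blast
  then show "b = b'" using gap_unique[OF b(1,2) _ b(5)] by simp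
qed

lemma flat_block_cut:
  assumes R: "ncfam R" "flat R" and W: "W \<subseteq> Max ` R" and C: "C \<in> R" "x \<in> C" "y \<in> C"
  shows "cut W x = cut W y"
proof -
  have "\<not> k < y" if C: "x \<in> C" "y \<in> C" and k: "k \<in> W" "x \<le> k" for k x y
  proof
    assume "k < y"
    obtain D where D: "D \<in> R" "k = Max D" using k W by blast
    have "k \<in> D" using D ncfam_block_finite[OF R(1) D(1)] ncfam_nonempty[OF R(1) D(1)] by simp
    have "D = C"
    proof (cases "x = k")
      case True then show ?thesis using ncfam_block_eq[OF R(1) D(1) assms(4), of x] C \<open>k \<in> D\<close> by simp
    next
      case False
      then show ?thesis
        using flatD[OF R(2) assms(4) D(1) C \<open>k \<in> D\<close> _ \<open>k < y\<close>] k by simp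
    qed
    then have "y \<le> k" using D ncfam_block_finite[OF R(1) D(1)] C by simp
    then show False using \<open>k < y\<close> by simp
  qed
  then show ?thesis using C by (intro cut_eqI) blast+
qed

lemma flat_eq_gaps:
  assumes R: "ncfam R" "flat R"
  shows "gaps (Max ` R - {Max (\<Union>R)}) (\<Union>R) = R"
proof -
  let ?W = "Max ` R - {Max (\<Union>R)}" and ?U = "\<Union>R"
  have fin: "finite ?U" using R by (simp add: ncfam_def)
  have sep: "cut ?W x \<noteq> cut ?W y" if C: "C \<in> R" "D \<in> R" "C \<noteq> D" "x \<in> C" "y \<in> D" "x < y" for C D x y
  proof -
    have finC: "finite C" using ncfam_block_finite[OF R(1) C(1)] .
    have MC: "Max C \<in> C" using finC C(4) by (intro Max_in) auto
    have "\<not> y < Max C" using flatD[OF R(2) C(1,2,4) MC C(5,6)] C(3) by blast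
    moreover have "y \<noteq> Max C" using ncfam_block_eq[OF R(1) C(1,2) MC] C(3,5) by blast
    ultimately have My: "Max C < y" by simp
    have "y \<le> Max ?U" using fin C by (intro Max_ge) auto
    then have "Max C \<in> ?W" using My C(1) by auto
    then have "Max C \<in> cut ?W y" "Max C \<notin> cut ?W x"
      using My Max_ge[OF finC C(4)] by (simp_all add: cut_def)
    then show ?thesis by blast
  qed
  have cls: "{y \<in> ?U. cut ?W y = cut ?W x} = C" if C: "C \<in> R" "x \<in> C" for C x
  proof (intro equalityI subsetI)
    fix y assume "y \<in> C"
    then show "y \<in> {y \<in> ?U. cut ?W y = cut ?W x}"
      using flat_block_cut[OF R _ C(1), of ?W y x] C by blast
  next
    fix y assume "y \<in> {y \<in> ?U. cut ?W y = cut ?W x}"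
    then obtain D where D: "D \<in> R" "y \<in> D" and eq: "cut ?W y = cut ?W x" by blast
    show "y \<in> C"
    proof (rule ccontr)
      assume "y \<notin> C"
      then have "C \<noteq> D" "x \<noteq> y" using D C by auto
      then show False using sep[OF C(1) D(1) _ C(2) D(2)] sep[OF D(1) C(1) _ D(2) C(2)] eq
        by (metis nat_neq_iff)
    qed
  qed
  show ?thesis
  proof (intro equalityI subsetI)
    fix G assume "G \<in> gaps ?W ?U"
    then obtain x where x: "x \<in> ?U" "G = {y \<in> ?U. cut ?W y = cut ?W x}" by (rule gapsE)
    then obtain C where "C \<in> R" "x \<in> C" by blast
    then show "G \<in> R" using cls x by simp
  next
    fix C assume C: "C \<in> R"
    then obtain x where x: "x \<in> C" using ncfam_nonempty[OF R(1)] by blast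
    then have "x \<in> ?U" using C by blast
    from gap_in_gaps[OF this, of ?W] show "C \<in> gaps ?W ?U" unfolding cls[OF C x] .
  qed
qed

lemma Max_gaps:
  assumes U: "finite U" and W: "W \<subseteq> U - {Max U}"
  shows "Max ` gaps W U - {Max U} = W"
proof (intro equalityI subsetI)
  fix k assume k: "k \<in> W"
  let ?G = "{y \<in> U. cut W y = cut W k}"
  have kU: "k \<in> U" using k W by blast
  have "y \<le> k" if "y \<in> ?G" for y
  proof (rule ccontr)
    assume "\<not> y \<le> k"
    then have "k \<in> cut W y" using k by (simp add: cut_def)
    then have "k \<in> cut W k" using that by simp
    then show False by (simp add: cut_def)
  qed
  moreover have "finite ?G" "k \<in> ?G" using U kU by auto
  ultimately have "Max ?G = k" by (intro Max_eqI) auto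
  from imageI[OF gap_in_gaps[OF kU, of W], of Max, unfolded this] have "k \<in> Max ` gaps W U" .
  then show "k \<in> Max ` gaps W U - {Max U}" using k W by blast
next
  fix m assume "m \<in> Max ` gaps W U - {Max U}"
  then obtain G where G: "G \<in> gaps W U" "m = Max G" and mU: "m \<noteq> Max U" by blast
  have finG: "finite G" using gap_subset[OF G(1)] U finite_subset by blast
  have mG: "m \<in> G" using G finG gap_nonempty[OF G(1)] by simp
  then have "m \<in> U" using gap_subset[OF G(1)] by blast
  then have "m < Max U" using mU U by (simp add: order_less_le)
  \<comment> \<open>The next element after \<open>m\<close> starts a new gap, so \<open>m\<close> itself must be a cut point.\<close>
  define u where "u = Min {u \<in> U. m < u}"
  have "finite {u \<in> U. m < u}" "Max U \<in> {u \<in> U. m < u}"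
    using U \<open>m < Max U\<close> \<open>m \<in> U\<close> by (auto intro: Max_in)
  then have u: "u \<in> U" "m < u" "\<And>v. v \<in> U \<Longrightarrow> m < v \<Longrightarrow> u \<le> v"
    unfolding u_def using Min_in[of "{u \<in> U. m < u}"] Min_le[of "{u \<in> U. m < u}"] by blast+
  have "u \<notin> G" using Max_ge[OF finG, of u] G(2) u(2) by auto
  then have "cut W u \<noteq> cut W m" using gap_eq[OF G(1) mG] u(1) by blast
  moreover have "cut W m \<subseteq> cut W u" using u(2) by (intro cut_mono) simp
  ultimately obtain k where "k \<in> cut W u" "k \<notin> cut W m" by blast
  then have k: "k \<in> W" "k < u" "m \<le> k" by (auto simp: cut_def)
  then have "k = m" using u(3)[of k] W by force
  then show "m \<in> W" using k by simp
qed

text \<open>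
  For a family of \<open>k\<close> blocks, choosing end points gives the alternating sum over all subsets of a
  set with \<open>k - 1\<close> elements.
\<close>
lemma sum_flat_coarsenings:
  assumes P: "ncfam P" "flat P" "P \<noteq> {}"
  shows "(\<Sum>R | R \<in> coarsenings P \<and> flat R. (- 1) ^ card R) =
    (if card P = 1 then - 1 else 0 :: 'k::comm_ring_1)"
proof -
  let ?U = "\<Union>P" and ?M = "Max ` P - {Max (\<Union>P)}"
  have fin: "finite ?U" using P by (simp add: ncfam_def)
  have Max_sub: "Max ` R \<subseteq> Max ` P" if R: "R \<in> coarsenings P" for R
  proof
    fix m assume "m \<in> Max ` R"
    then obtain C where C: "C \<in> R" "m = Max C" by blast
    have ncR: "ncfam R" by (rule coarsening_ncfam[OF P(1) R])
    have finC: "finite C" by (rule ncfam_block_finite[OF ncR C(1)])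
    have mC: "m \<in> C" using C finC ncfam_nonempty[OF ncR C(1)] by simp
    then obtain b where b: "b \<in> P" "m \<in> b" using C(1) coarsening_Union[OF P(1) R] by blast
    then have "b \<subseteq> C" using coarsening_block_subset[OF P(1) R b(1) C(1) b(2) mC] by simp
    then have "Max b = m" using b finC C by (intro Max_eqI) (auto intro: finite_subset)
    then show "m \<in> Max ` P" using b by blast
  qed
  have inj: "inj_on Max R" if R: "ncfam R" for R
  proof (rule inj_onI)
    fix b b' assume b: "b \<in> R" "b' \<in> R" "Max b = Max b'"
    have "Max b \<in> b" if "b \<in> R" for b
      using that ncfam_block_finite[OF R] ncfam_nonempty[OF R] by simp
    from this[OF b(1)] this[OF b(2)] have "Max b \<in> b" "Max b' \<in> b'" .
    then show "b = b'" using ncfam_block_eq[OF R b(1,2), of "Max b"] b(3) by simp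
  qed
  have MaxU: "Max ?U \<in> Max ` R" if R: "R \<in> coarsenings P" for R
  proof -
    have ncR: "ncfam R" by (rule coarsening_ncfam[OF P(1) R])
    have "?U \<noteq> {}" using P ncfam_Union_empty by blast
    then have "Max ?U \<in> \<Union>R" using fin coarsening_Union[OF P(1) R] by (metis Max_in)
    then obtain C where C: "C \<in> R" "Max ?U \<in> C" by blast
    have "C \<subseteq> ?U" using C(1) coarsening_Union[OF P(1) R] by blast
    then have "Max C = Max ?U" using C fin by (meson Max_eqI Max_ge finite_subset subsetD)
    then show ?thesis using C(1) by (metis image_eqI)
  qed
  have card: "card R = Suc (card (Max ` R - {Max ?U}))" if R: "R \<in> coarsenings P" for R
  proof -
    have ncR: "ncfam R" by (rule coarsening_ncfam[OF P(1) R])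
    have "card R = card (Max ` R)" using card_image[OF inj[OF ncR]] by simp
    also have "\<dots> = Suc (card (Max ` R - {Max ?U}))"
      using MaxU[OF R] ncfam_finite[OF ncR] by (intro card.remove) auto
    finally show ?thesis .
  qed
  have "(\<Sum>R | R \<in> coarsenings P \<and> flat R. (- 1) ^ card R) =
    (\<Sum>W\<in>Pow ?M. (- 1) ^ Suc (card W) :: 'k)"
  proof (rule sum.reindex_bij_witness[where j = "\<lambda>R. Max ` R - {Max ?U}" and i = "\<lambda>W. gaps W ?U"])
    fix R assume "R \<in> {R. R \<in> coarsenings P \<and> flat R}"
    then have R: "R \<in> coarsenings P" "flat R" by auto
    have U: "\<Union>R = ?U" by (rule coarsening_Union[OF P(1) R(1)])
    show "gaps (Max ` R - {Max ?U}) ?U = R"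
      using flat_eq_gaps[OF coarsening_ncfam[OF P(1) R(1)] R(2)] unfolding U .
    show "Max ` R - {Max ?U} \<in> Pow ?M" using Max_sub[OF R(1)] by blast
    show "(- 1) ^ Suc (card (Max ` R - {Max ?U})) = ((- 1) ^ card R :: 'k)"
      by (simp only: card[OF R(1)])
  next
    fix W assume W: "W \<in> Pow ?M"
    have "Max b \<in> ?U" if "b \<in> P" for b
      using that ncfam_block_finite[OF P(1)] ncfam_nonempty[OF P(1)] by (meson Max_in UnionI)
    then have "W \<subseteq> ?U - {Max ?U}" using W by blast
    then show "Max ` gaps W ?U - {Max ?U} = W" by (rule Max_gaps[OF fin])
    have "\<exists>G\<in>gaps W ?U. b \<subseteq> G" if b: "b \<in> P" for b
    proof -
      obtain x where x: "x \<in> b" using ncfam_nonempty[OF P(1) b] by blast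
      have "b \<subseteq> {y \<in> ?U. cut W y = cut W x}"
      proof
        fix y assume "y \<in> b"
        then show "y \<in> {y \<in> ?U. cut W y = cut W x}"
          using flat_block_cut[OF P(1,2) _ b, of W y x] W b x by blast
      qed
      moreover have "x \<in> ?U" using b x by blast
      ultimately show ?thesis using gap_in_gaps[of x ?U W] by (meson bexI)
    qed
    then show "gaps W ?U \<in> {R. R \<in> coarsenings P \<and> flat R}"
      using ncfam_gaps[OF fin] flat_gaps by (simp add: coarsenings_iff[OF P(1)] Union_gaps)
  qed
  also have "\<dots> = - (\<Sum>W\<in>Pow ?M. (- 1) ^ card W)" by (simp add: sum_negf)
  also have "\<dots> = - (if ?M = {} then 1 else 0)"
    by (subst alternating_sum_Pow) (use ncfam_finite[OF P(1)] in auto)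
  also have "?M = {} \<longleftrightarrow> card P = 1"
    using card[OF coarsening_refl[OF P(1)]] ncfam_finite[OF P(1)] by simp
  finally show ?thesis by simp
qed

definition flat_ind :: "nat set set \<Rightarrow> 'k::comm_ring_1" where
  "flat_ind P = (if flat P then 1 else 0)"

text \<open>
  This will turn out to be the function of \<open>\<mu>\<^sup>s\<close>.
\<close>
definition flat_inv :: "nat set set \<Rightarrow> 'k::comm_ring_1" where
  "flat_inv P = (if flat P then (- 1) ^ (card P - 1) else 0)"

lemma flat_if_coarsening_flat:
  assumes P: "ncfam P" and R: "R \<in> coarsenings P" "flat R" and ins: "\<And>C. C \<in> R \<Longrightarrow> flat (inside P C)"
  shows "flat P"
proof (rule flatI)
  fix b b' x y z assume b: "b \<in> P" "b' \<in> P" "x \<in> b" "z \<in> b" "y \<in> b'" "x < y" "y < z"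
  obtain C where C: "C \<in> R" "b \<subseteq> C" using coarsening_covers[OF P R(1) b(1)] by blast
  obtain D where D: "D \<in> R" "b' \<subseteq> D" using coarsening_covers[OF P R(1) b(2)] by blast
  have "x \<in> C" "z \<in> C" "y \<in> D" using b C D by auto
  then have "C = D" using flatD[OF R(2) C(1) D(1)] b(6,7) by blast
  then have "b \<in> inside P C" "b' \<in> inside P C" using b C D by (auto simp: inside_def)
  then show "b = b'" using flatD[OF ins[OF C(1)]] b(3-7) by blast
qed

lemma card_inside_coarsening:
  assumes P: "ncfam P" and R: "R \<in> coarsenings P"
  shows "card P = (\<Sum>C\<in>R. card (inside P C))" "C \<in> R \<Longrightarrow> 1 \<le> card (inside P C)"
proof -
  have ncR: "ncfam R" by (rule coarsening_ncfam[OF P R])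
  have "card P = card (\<Union>C\<in>R. inside P C)" using Union_of_insides[OF P R] by simp
  also have "\<dots> = (\<Sum>C\<in>R. card (inside P C))"
    by (rule card_UN_disjoint)
      (use ncfam_finite[OF ncR] ncfam_finite[OF ncfam_inside[OF P]] insides_disjoint[OF P R] in auto)
  finally show "card P = (\<Sum>C\<in>R. card (inside P C))" .
  assume C: "C \<in> R"
  have "\<Union>(inside P C) = C" by (rule Union_inside[OF P R C])
  then have "inside P C \<noteq> {}" using ncfam_nonempty[OF ncR C] by auto
  then show "1 \<le> card (inside P C)" using ncfam_finite[OF ncfam_inside[OF P, of C]]
    by (simp add: Suc_le_eq card_gt_0_iff)
qed

lemma cstar_not_flat:
  fixes A B :: "nat set set \<Rightarrow> 'k::comm_ring_1"
  assumes P: "ncfam P" and "\<not> flat P" and A: "\<And>R. \<not> flat R \<Longrightarrow> A R = 0" and B: "\<And>R. \<not> flat R \<Longrightarrow> B R = 0"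
  shows "cstar A B P = 0"
  unfolding cstar_def
proof (rule sum.neutral, rule ballI)
  fix R assume R: "R \<in> coarsenings P"
  show "A R * (\<Prod>C\<in>R. B (inside P C)) = 0"
  proof (cases "flat R")
    case True
    then obtain C where "C \<in> R" "\<not> flat (inside P C)"
      using flat_if_coarsening_flat[OF P R] assms(2) by blast
    then have "(\<Prod>C\<in>R. B (inside P C)) = 0"
      using ncfam_finite[OF coarsening_ncfam[OF P R]] B by (intro prod_zero) auto
    then show ?thesis by simp
  qed (simp add: A)
qed

lemma flat_one_block: "ncfam P \<Longrightarrow> \<not> flat P \<Longrightarrow> one_block c P = 0"
proof -
  assume P: "ncfam P" "\<not> flat P"
  have "P \<noteq> {}" using P by (auto simp: flat_def)
  moreover have "card P \<noteq> 1" using P by (auto simp: flat_def card_1_singleton_iff)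
  ultimately show ?thesis by (simp add: one_block_def)
qed

text \<open>
  For flat \<open>P\<close> with \<open>k\<close> blocks, the term of a flat coarsening with \<open>r\<close> blocks is \<open>(-1)^(k - r)\<close>,
  so the alternating sum over flat coarsenings applies. If \<open>P\<close> is not flat, then every coarsening
  is not flat or has a block in which \<open>P\<close> is not flat.
\<close>
lemma cstar_flat_ind_flat_inv:
  assumes P: "ncfam P"
  shows "cstar flat_ind flat_inv P = (one_block 1 P :: 'k::comm_ring_1)"
proof (cases "flat P \<and> P \<noteq> {}")
  case True
  then have flat: "flat P" and ne: "P \<noteq> {}" by auto
  have fin: "finite (coarsenings P)" by (rule finite_coarsenings[OF P])
  have "flat_ind R * (\<Prod>C\<in>R. flat_inv (inside P C)) = (if flat R then (- 1) ^ card P * (- 1) ^ card R else 0 :: 'k)"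
    if R: "R \<in> coarsenings P" for R
  proof -
    have "(\<Prod>C\<in>R. flat_inv (inside P C)) * (\<Prod>C\<in>R. - 1) = (\<Prod>C\<in>R. (- 1) ^ card (inside P C) :: 'k)"
      unfolding prod.distrib[symmetric]
    proof (intro prod.cong refl)
      fix C assume C: "C \<in> R"
      have "flat (inside P C)" using flat by (rule flat_subset) (rule inside_subset)
      moreover have "card (inside P C) = Suc (card (inside P C) - 1)"
        using card_inside_coarsening(2)[OF P R C] by simp
      then have "(- 1) ^ card (inside P C) = (- 1 :: 'k) ^ Suc (card (inside P C) - 1)" by argo
      ultimately show "flat_inv (inside P C) * - 1 = ((- 1) ^ card (inside P C) :: 'k)"
        by (simp add: flat_inv_def)
    qed
    also have "\<dots> = (- 1) ^ card P"
      unfolding card_inside_coarsening(1)[OF P R] by (simp add: power_sum)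
    finally have eq: "(\<Prod>C\<in>R. flat_inv (inside P C)) * (- 1) ^ card R = ((- 1) ^ card P :: 'k)" by simp
    have "(\<Prod>C\<in>R. flat_inv (inside P C)) = ((- 1) ^ card P * (- 1) ^ card R :: 'k)"
      unfolding eq[symmetric] by (simp add: mult.assoc flip: power_mult_distrib)
    then show ?thesis by (simp add: flat_ind_def)
  qed
  then have "cstar flat_ind flat_inv P =
    (\<Sum>R\<in>coarsenings P. if flat R then (- 1) ^ card P * (- 1) ^ card R else 0 :: 'k)"
    unfolding cstar_def by (intro sum.cong refl)
  also have "\<dots> = (\<Sum>R | R \<in> coarsenings P \<and> flat R. (- 1) ^ card P * (- 1) ^ card R)"
    by (simp add: sum.If_cases[OF fin] Int_def)
  also have "\<dots> = (- 1) ^ card P * (\<Sum>R | R \<in> coarsenings P \<and> flat R. (- 1) ^ card R)"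
    by (simp add: sum_distrib_left)
  also have "\<dots> = one_block 1 P"
    unfolding sum_flat_coarsenings[OF P flat ne] using ne by (simp add: one_block_def)
  finally show ?thesis .
next
  case False
  show ?thesis
  proof (cases "P = {}")
    case True then show ?thesis by (simp add: cstar_empty flat_ind_def flat_def one_block_def)
  next
    case False
    then have "\<not> flat P" using \<open>\<not> (flat P \<and> P \<noteq> {})\<close> by simp
    then show ?thesis using cstar_not_flat[OF P, of flat_ind flat_inv] flat_one_block[OF P, of "1 :: 'k"]
      by (simp add: flat_ind_def flat_inv_def)
  qed
qed

lemma cstar_flat_inv_flat_ind:
  assumes P: "ncfam P"
  shows "cstar flat_inv flat_ind P = (one_block 1 P :: 'k::comm_ring_1)"
proof (cases "flat P \<and> P \<noteq> {}")
  case True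
  then have flat: "flat P" and ne: "P \<noteq> {}" by auto
  have fin: "finite (coarsenings P)" by (rule finite_coarsenings[OF P])
  have "flat_inv R * (\<Prod>C\<in>R. flat_ind (inside P C)) = (if flat R then - ((- 1) ^ card R) else 0 :: 'k)"
    if R: "R \<in> coarsenings P" for R
  proof -
    have "flat (inside P C)" for C using flat by (rule flat_subset) (rule inside_subset)
    then have "(\<Prod>C\<in>R. flat_ind (inside P C)) = (1 :: 'k)" by (simp add: flat_ind_def)
    moreover have "R \<noteq> {}" using coarsening_empty_iff[OF P R] ne by simp
    then have "card R = Suc (card R - 1)"
      using ncfam_finite[OF coarsening_ncfam[OF P R]] by (simp add: card_gt_0_iff)
    then have "(- 1) ^ card R = (- 1 :: 'k) ^ Suc (card R - 1)" by argo
    ultimately show ?thesis by (simp add: flat_inv_def)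
  qed
  then have "cstar flat_inv flat_ind P = (\<Sum>R\<in>coarsenings P. if flat R then - ((- 1) ^ card R) else 0 :: 'k)"
    unfolding cstar_def by (intro sum.cong refl)
  also have "\<dots> = (\<Sum>R | R \<in> coarsenings P \<and> flat R. - ((- 1) ^ card R))"
    by (simp add: sum.If_cases[OF fin] Int_def)
  also have "\<dots> = - (\<Sum>R | R \<in> coarsenings P \<and> flat R. (- 1) ^ card R)"
    by (simp add: sum_negf)
  also have "\<dots> = one_block 1 P"
    unfolding sum_flat_coarsenings[OF P flat ne] using ne by (simp add: one_block_def)
  finally show ?thesis .
next
  case False
  show ?thesis
  proof (cases "P = {}")
    case True then show ?thesis by (simp add: cstar_empty flat_inv_def flat_def one_block_def)
  next
    case False
    then have "\<not> flat P" using \<open>\<not> (flat P \<and> P \<noteq> {})\<close> by simp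
    then show ?thesis using cstar_not_flat[OF P, of flat_inv flat_ind] flat_one_block[OF P, of "1 :: 'k"]
      by (simp add: flat_ind_def flat_inv_def)
  qed
qed

section \<open>Invariance under relabelling\<close>

definition relabel :: "(nat \<Rightarrow> nat) \<Rightarrow> nat set set \<Rightarrow> nat set set" where
  "relabel f P = (`) f ` P"

text \<open>
  Renumbering is relabelling by a strictly increasing map. Invariance of \<open>cstar\<close> and \<open>cconv\<close> allows to
  compare values at a family and at its renumbering.
\<close>
definition relabel_invariant :: "(nat set set \<Rightarrow> 'a) \<Rightarrow> bool" where
  "relabel_invariant A \<longleftrightarrow>
     (\<forall>P f. ncfam P \<longrightarrow> strict_mono_on (\<Union>P) f \<longrightarrow> A (relabel f P) = A P)"

lemma relabel_invariantD:
  "relabel_invariant A \<Longrightarrow> ncfam P \<Longrightarrow> strict_mono_on (\<Union>P) f \<Longrightarrow> A (relabel f P) = A P"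
  unfolding relabel_invariant_def by blast

lemma Union_relabel: "\<Union>(relabel f P) = f ` \<Union>P"
  unfolding relabel_def by blast

locale relabeling =
  fixes U :: "nat set" and f :: "nat \<Rightarrow> nat"
  assumes mono: "strict_mono_on U f"
begin

lemma inj: "inj_on f U"
  using mono by (rule strict_mono_on_imp_inj_on)

lemma less_iff: "x \<in> U \<Longrightarrow> y \<in> U \<Longrightarrow> f x < f y \<longleftrightarrow> x < y"
  using mono unfolding strict_mono_on_def by (metis linorder_neqE_nat order_less_asym)

lemma mono_subset: "V \<subseteq> U \<Longrightarrow> strict_mono_on V f"
  using mono unfolding strict_mono_on_def by blast

lemma inj_eq: "x \<in> U \<Longrightarrow> y \<in> U \<Longrightarrow> f x = f y \<longleftrightarrow> x = y"
  using inj by (auto dest: inj_onD)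

lemma inj_image: "\<Union>P \<subseteq> U \<Longrightarrow> inj_on ((`) f) P"
  using inj by (intro inj_onI) (metis Union_upper inj_on_image_eq_iff subset_trans)

lemma image_subset_iff': "b \<subseteq> U \<Longrightarrow> C \<subseteq> U \<Longrightarrow> f ` b \<subseteq> f ` C \<longleftrightarrow> b \<subseteq> C"
proof -
  assume b: "b \<subseteq> U" and C: "C \<subseteq> U"
  have "x \<in> C" if "x \<in> b" "f x \<in> f ` C" for x
    using that inj_on_image_mem_iff[OF inj _ C, of x] b by blast
  then show ?thesis by blast
qed

lemma ncfam_relabel:
  assumes P: "ncfam P" and U: "\<Union>P \<subseteq> U" shows "ncfam (relabel f P)"
  unfolding ncfam_iff
proof (intro conjI)
  have sub: "x \<in> U" if "x \<in> b" "b \<in> P" for x b using that U by blast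
  show "finite (\<Union>(relabel f P))" using P by (simp add: Union_relabel ncfam_def)
  show "{} \<notin> relabel f P" using ncfam_nonempty[OF P] unfolding relabel_def by blast
  show "\<forall>b\<in>relabel f P. \<forall>b'\<in>relabel f P. \<forall>x\<in>b. x \<in> b' \<longrightarrow> b = b'"
  proof (intro ballI impI)
    fix b b' x assume "b \<in> relabel f P" "b' \<in> relabel f P" "x \<in> b" "x \<in> b'"
    then obtain c c' u u' where c: "c \<in> P" "c' \<in> P" "b = f ` c" "b' = f ` c'"
      "u \<in> c" "u' \<in> c'" "x = f u" "x = f u'" unfolding relabel_def by blast
    then have "u = u'" using inj_eq[of u u'] sub by metis
    then show "b = b'" using ncfam_block_eq[OF P c(1,2)] c by metis
  qed
  show "noncrossing (relabel f P)"
  proof (rule noncrossingI)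
    fix b b' x y z t assume b: "b \<in> relabel f P" "b' \<in> relabel f P" "x \<in> b" "z \<in> b" "y \<in> b'" "t \<in> b'"
      and lt: "x < y" "y < z" "z < t"
    obtain c where c: "c \<in> P" "b = f ` c" using b(1) unfolding relabel_def by blast
    obtain c' where c': "c' \<in> P" "b' = f ` c'" using b(2) unfolding relabel_def by blast
    obtain x' where x': "x' \<in> c" "x = f x'" using b c by blast
    obtain y' where y': "y' \<in> c'" "y = f y'" using b c' by blast
    obtain z' where z': "z' \<in> c" "z = f z'" using b c by blast
    obtain t' where t': "t' \<in> c'" "t = f t'" using b c' by blast
    have "x' \<in> U" "y' \<in> U" "z' \<in> U" "t' \<in> U" using sub x' y' z' t' c c' by blast+
    then have "x' < y'" "y' < z'" "z' < t'"
      using lt less_iff x' y' z' t' by simp_all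
    then have "c = c'"
      using noncrossingD[of P c c' x' z' y' t'] P c c' x' y' z' t' by (simp add: ncfam_def)
    then show "b = b'" using c c' by simp
  qed
qed

lemma relabel_coarsening:
  assumes P: "ncfam P" and U: "\<Union>P \<subseteq> U" and R: "R \<in> coarsenings P"
  shows "relabel f R \<in> coarsenings (relabel f P)"
proof -
  have UR: "\<Union>R = \<Union>P" by (rule coarsening_Union[OF P R])
  have ncR: "ncfam R" by (rule coarsening_ncfam[OF P R])
  have "\<exists>B\<in>relabel f R. b \<subseteq> B" if b: "b \<in> relabel f P" for b
  proof -
    obtain c where c: "c \<in> P" "b = f ` c" using b unfolding relabel_def by blast
    obtain C where "C \<in> R" "c \<subseteq> C" using coarsening_covers[OF P R c(1)] by blast
    then have "f ` C \<in> relabel f R" "b \<subseteq> f ` C" using c unfolding relabel_def by blast+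
    then show ?thesis by blast
  qed
  then show ?thesis
    using ncfam_relabel[OF P U] ncfam_relabel[OF ncR] U UR
    by (simp add: coarsenings_iff Union_relabel)
qed

lemma inside_relabel:
  assumes U: "\<Union>P \<subseteq> U" and C: "C \<subseteq> U"
  shows "inside (relabel f P) (f ` C) = relabel f (inside P C)"
proof -
  have "f ` b \<subseteq> f ` C \<longleftrightarrow> b \<subseteq> C" if "b \<in> P" for b
    using that U C by (intro image_subset_iff') blast+
  then show ?thesis unfolding inside_def relabel_def by blast
qed

lemma cut_relabel:
  assumes W: "W \<subseteq> U" and x: "x \<in> U" shows "cut (f ` W) (f x) = f ` cut W x"
proof -
  have "f k < f x \<longleftrightarrow> k < x" if "k \<in> W" for k using that W x less_iff by blast
  then show ?thesis unfolding cut_def by blast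
qed

lemma cut_relabel_eq:
  assumes W: "W \<subseteq> U" and x: "x \<in> U" "y \<in> U"
  shows "cut (f ` W) (f x) = cut (f ` W) (f y) \<longleftrightarrow> cut W x = cut W y"
proof -
  have "cut W x \<subseteq> U" "cut W y \<subseteq> U" using W unfolding cut_def by blast+
  then show ?thesis
    unfolding cut_relabel[OF W x(1)] cut_relabel[OF W x(2)] by (rule inj_on_image_eq_iff[OF inj])
qed

lemma gaps_relabel:
  assumes W: "W \<subseteq> U" and V: "V \<subseteq> U" shows "gaps (f ` W) (f ` V) = relabel f (gaps W V)"
proof -
  have "{y \<in> f ` V. cut (f ` W) y = cut (f ` W) (f x)} = f ` {y \<in> V. cut W y = cut W x}" if "x \<in> V" for x
  proof -
    have "cut (f ` W) (f y) = cut (f ` W) (f x) \<longleftrightarrow> cut W y = cut W x" if "y \<in> V" for y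
      using that \<open>x \<in> V\<close> V by (intro cut_relabel_eq[OF W]) blast+
    then show ?thesis by blast
  qed
  then show ?thesis unfolding gaps_def relabel_def image_image by (intro image_cong refl)
qed

lemma Diff_relabel:
  assumes "\<Union>P \<subseteq> U" "K \<subseteq> P"
  shows "relabel f P - relabel f K = relabel f (P - K)"
  unfolding relabel_def using inj_on_image_set_diff[OF inj_image[OF assms(1)], of P K] assms(2) by simp

lemma lowers_relabel:
  assumes U: "\<Union>P \<subseteq> U" and K: "K \<in> lowers P"
  shows "relabel f K \<in> lowers (relabel f P)"
proof (rule lowersI)
  have KP: "K \<subseteq> P" using K lowers_subset by blast
  then show "relabel f K \<subseteq> relabel f P" unfolding relabel_def by blast
  fix b x y assume "b \<in> relabel f P - relabel f K" "x \<in> b" "y \<in> b"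
  then have b: "b \<in> relabel f (P - K)" "x \<in> b" "y \<in> b" using Diff_relabel[OF U KP] by auto
  then obtain c u v where c: "c \<in> P - K" "u \<in> c" "v \<in> c" "x = f u" "y = f v"
    unfolding relabel_def by blast
  have "u \<in> U" "v \<in> U" "\<Union>K \<subseteq> U" using c U KP by blast+
  then show "cut (\<Union>(relabel f K)) x = cut (\<Union>(relabel f K)) y"
    using lowers_cut[OF K c(1-3)] unfolding c Union_relabel by (simp add: cut_relabel_eq)
qed

lemma inv_relabeling: "relabeling (f ` U) (inv_into U f)"
proof
  show "strict_mono_on (f ` U) (inv_into U f)"
    unfolding strict_mono_on_def using less_iff inj by auto
qed

lemma relabel_inv: "\<Union>P \<subseteq> U \<Longrightarrow> relabel (inv_into U f) (relabel f P) = P"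
proof -
  assume U: "\<Union>P \<subseteq> U"
  have "inv_into U f ` f ` b = b" if "b \<in> P" for b
    using that U inj by (intro inv_into_image_cancel) blast+
  then show ?thesis unfolding relabel_def by (simp add: image_image)
qed

lemma relabel_inv': "\<Union>P \<subseteq> f ` U \<Longrightarrow> relabel f (relabel (inv_into U f) P) = P"
proof -
  assume U: "\<Union>P \<subseteq> f ` U"
  have "f ` inv_into U f ` b = b" if "b \<in> P" for b
    using that U by (intro image_inv_into_cancel[of f U "f ` U"]) blast+
  then show ?thesis unfolding relabel_def by (simp add: image_image)
qed

lemma prod_relabel:
  "\<Union>R \<subseteq> U \<Longrightarrow> (\<Prod>C\<in>relabel f R. F C) = (\<Prod>C\<in>R. F (f ` C) :: 'k::comm_monoid_mult)"
  unfolding relabel_def by (subst prod.reindex[OF inj_image]) auto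

end

lemma cstar_relabel_invariant:
  fixes A B :: "nat set set \<Rightarrow> 'k::comm_ring_1"
  assumes A: "relabel_invariant A" and B: "relabel_invariant B"
  shows "relabel_invariant (cstar A B)"
  unfolding relabel_invariant_def
proof (intro allI impI)
  fix P and f :: "nat \<Rightarrow> nat" assume P: "ncfam P" and f: "strict_mono_on (\<Union>P) f"
  interpret relabeling "\<Union>P" f by standard (rule f)
  interpret i: relabeling "f ` \<Union>P" "inv_into (\<Union>P) f" by (rule inv_relabeling)
  have ncP': "ncfam (relabel f P)" by (rule ncfam_relabel[OF P subset_refl])
  have "(\<Sum>R\<in>coarsenings P. A R * (\<Prod>C\<in>R. B (inside P C))) =
    (\<Sum>R\<in>coarsenings (relabel f P). A R * (\<Prod>C\<in>R. B (inside (relabel f P) C)))"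
  proof (rule sum.reindex_bij_witness[where j = "relabel f" and i = "relabel (inv_into (\<Union>P) f)"])
    fix R assume R: "R \<in> coarsenings P"
    have UR: "\<Union>R = \<Union>P" by (rule coarsening_Union[OF P R])
    show "relabel (inv_into (\<Union>P) f) (relabel f R) = R" by (rule relabel_inv) (simp add: UR)
    show "relabel f R \<in> coarsenings (relabel f P)" by (rule relabel_coarsening[OF P subset_refl R])
    have "(\<Prod>C\<in>relabel f R. B (inside (relabel f P) C)) = (\<Prod>C\<in>R. B (inside (relabel f P) (f ` C)))"
      by (rule prod_relabel) (simp add: UR)
    also have "\<dots> = (\<Prod>C\<in>R. B (inside P C))"
    proof (intro prod.cong refl)
      fix C assume "C \<in> R"
      then have "C \<subseteq> \<Union>P" using UR by blast
      then have "inside (relabel f P) (f ` C) = relabel f (inside P C)"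
        by (intro inside_relabel) simp_all
      moreover have "\<Union>(inside P C) \<subseteq> \<Union>P" unfolding inside_def by blast
      ultimately show "B (inside (relabel f P) (f ` C)) = B (inside P C)"
        using relabel_invariantD[OF B ncfam_inside[OF P] mono_subset] by simp
    qed
    finally show "A (relabel f R) * (\<Prod>C\<in>relabel f R. B (inside (relabel f P) C)) =
      A R * (\<Prod>C\<in>R. B (inside P C))"
      using relabel_invariantD[OF A coarsening_ncfam[OF P R], of f] f UR by simp
  next
    fix R assume R: "R \<in> coarsenings (relabel f P)"
    have UR: "\<Union>R = f ` \<Union>P" using coarsening_Union[OF ncP' R] by (simp add: Union_relabel)
    show "relabel f (relabel (inv_into (\<Union>P) f) R) = R" by (rule relabel_inv') (simp add: UR)
    have "relabel (inv_into (\<Union>P) f) R \<in> coarsenings (relabel (inv_into (\<Union>P) f) (relabel f P))"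
      by (rule i.relabel_coarsening[OF ncP' _ R]) (simp add: Union_relabel)
    then show "relabel (inv_into (\<Union>P) f) R \<in> coarsenings P"
      by (simp only: relabel_inv[OF subset_refl])
  qed
  then show "cstar A B (relabel f P) = cstar A B P" by (simp add: cstar_def)
qed

lemma cconv_relabel_invariant:
  fixes A B :: "nat set set \<Rightarrow> 'k::comm_ring_1"
  assumes A: "relabel_invariant A" and B: "relabel_invariant B"
  shows "relabel_invariant (cconv A B)"
  unfolding relabel_invariant_def
proof (intro allI impI)
  fix P and f :: "nat \<Rightarrow> nat" assume P: "ncfam P" and f: "strict_mono_on (\<Union>P) f"
  interpret relabeling "\<Union>P" f by standard (rule f)
  interpret i: relabeling "f ` \<Union>P" "inv_into (\<Union>P) f" by (rule inv_relabeling)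
  have "(\<Sum>K\<in>lowers P. A K * (\<Prod>G\<in>gaps (\<Union>K) (\<Union>(P - K)). B (inside (P - K) G))) =
    (\<Sum>K\<in>lowers (relabel f P). A K *
      (\<Prod>G\<in>gaps (\<Union>K) (\<Union>(relabel f P - K)). B (inside (relabel f P - K) G)))"
  proof (rule sum.reindex_bij_witness[where j = "relabel f" and i = "relabel (inv_into (\<Union>P) f)"])
    fix K assume K: "K \<in> lowers P"
    have KP: "K \<subseteq> P" using K lowers_subset by blast
    have UK: "\<Union>K \<subseteq> \<Union>P" "\<Union>(P - K) \<subseteq> \<Union>P" using KP by blast+
    show "relabel (inv_into (\<Union>P) f) (relabel f K) = K" by (rule relabel_inv[OF UK(1)])
    show "relabel f K \<in> lowers (relabel f P)" by (rule lowers_relabel[OF subset_refl K])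
    have D: "relabel f P - relabel f K = relabel f (P - K)" by (rule Diff_relabel[OF subset_refl KP])
    have G: "gaps (f ` \<Union>K) (f ` \<Union>(P - K)) = relabel f (gaps (\<Union>K) (\<Union>(P - K)))"
      by (rule gaps_relabel[OF UK])
    have "(\<Prod>G\<in>relabel f (gaps (\<Union>K) (\<Union>(P - K))). B (inside (relabel f (P - K)) G)) =
      (\<Prod>G\<in>gaps (\<Union>K) (\<Union>(P - K)). B (inside (relabel f (P - K)) (f ` G)))"
      by (rule prod_relabel) (use UK in \<open>simp add: Union_gaps\<close>)
    also have "\<dots> = (\<Prod>G\<in>gaps (\<Union>K) (\<Union>(P - K)). B (inside (P - K) G))"
    proof (intro prod.cong refl)
      fix G assume "G \<in> gaps (\<Union>K) (\<Union>(P - K))"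
      then have "G \<subseteq> \<Union>P" using gap_subset UK(2) by blast
      then have "inside (relabel f (P - K)) (f ` G) = relabel f (inside (P - K) G)"
        by (intro inside_relabel UK)
      moreover have "\<Union>(inside (P - K) G) \<subseteq> \<Union>P" unfolding inside_def by blast
      moreover have "ncfam (inside (P - K) G)" using P by (rule ncfam_subset) (auto simp: inside_def)
      ultimately show "B (inside (relabel f (P - K)) (f ` G)) = B (inside (P - K) G)"
        using relabel_invariantD[OF B _ mono_subset] by simp
    qed
    finally show "A (relabel f K) * (\<Prod>G\<in>gaps (\<Union>(relabel f K)) (\<Union>(relabel f P - relabel f K)).
        B (inside (relabel f P - relabel f K) G)) =
      A K * (\<Prod>G\<in>gaps (\<Union>K) (\<Union>(P - K)). B (inside (P - K) G))"
      using relabel_invariantD[OF A ncfam_subset[OF P KP] mono_subset[OF UK(1)]]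
      by (simp only: Union_relabel D G)
  next
    fix K assume K: "K \<in> lowers (relabel f P)"
    have KP: "K \<subseteq> relabel f P" using K lowers_subset by blast
    then have UK: "\<Union>K \<subseteq> f ` \<Union>P" unfolding relabel_def by blast
    show "relabel f (relabel (inv_into (\<Union>P) f) K) = K" by (rule relabel_inv'[OF UK])
    have "relabel (inv_into (\<Union>P) f) K \<in> lowers (relabel (inv_into (\<Union>P) f) (relabel f P))"
      by (rule i.lowers_relabel[OF _ K]) (simp add: Union_relabel)
    then show "relabel (inv_into (\<Union>P) f) K \<in> lowers P"
      by (simp only: relabel_inv[OF subset_refl])
  qed
  then show "cconv A B (relabel f P) = cconv A B P" by (simp add: cconv_def)
qed

lemma (in relabeling) flat_relabel:
  assumes U: "\<Union>P \<subseteq> U" and P: "flat P"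
  shows "flat (relabel f P)"
proof (rule flatI)
  fix b b' x y z assume b: "b \<in> relabel f P" "b' \<in> relabel f P" "x \<in> b" "z \<in> b" "y \<in> b'"
    and lt: "x < y" "y < z"
  obtain c where c: "c \<in> P" "b = f ` c" using b(1) unfolding relabel_def by blast
  obtain c' where c': "c' \<in> P" "b' = f ` c'" using b(2) unfolding relabel_def by blast
  obtain x' where x': "x' \<in> c" "x = f x'" using b c by blast
  obtain y' where y': "y' \<in> c'" "y = f y'" using b c' by blast
  obtain z' where z': "z' \<in> c" "z = f z'" using b c by blast
  have "x' \<in> U" "y' \<in> U" "z' \<in> U" using U x' y' z' c c' by blast+
  then have "x' < y'" "y' < z'" using lt less_iff x' y' z' by simp_all
  then have "c = c'" using flatD[OF P c(1) c'(1) x'(1) z'(1) y'(1)] by simp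
  then show "b = b'" using c c' by simp
qed

lemma flat_relabel_iff:
  assumes "strict_mono_on (\<Union>P) f" shows "flat (relabel f P) \<longleftrightarrow> flat P"
proof -
  interpret relabeling "\<Union>P" f by standard (rule assms)
  interpret i: relabeling "f ` \<Union>P" "inv_into (\<Union>P) f" by (rule inv_relabeling)
  show ?thesis
    using flat_relabel[OF subset_refl] i.flat_relabel[of "relabel f P"] relabel_inv[OF subset_refl]
    by (auto simp: Union_relabel)
qed

lemma card_relabel: "strict_mono_on (\<Union>P) f \<Longrightarrow> card (relabel f P) = card P"
  unfolding relabel_def
  by (rule card_image) (rule relabeling.inj_image[OF relabeling.intro], auto)

section \<open>Algebra morphisms out of monoid algebras\<close>

text \<open>
  The linear extension of a function on monomials; both the morphisms out of the free commutative
  algebra and those out of its tensor square have this form.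
\<close>
definition lin_ext :: "('k \<Rightarrow> 'b) \<Rightarrow> ('m \<Rightarrow> 'b) \<Rightarrow> ('m \<Rightarrow>\<^sub>0 'k::comm_ring_1) \<Rightarrow> 'b::comm_ring_1" where
  "lin_ext \<iota> h x = (\<Sum>m\<in>Poly_Mapping.keys x. \<iota> (Poly_Mapping.lookup x m) * h m)"

definition unital_hom :: "('k::comm_ring_1 \<Rightarrow> 'b::comm_ring_1) \<Rightarrow> bool" where
  "unital_hom \<iota> \<longleftrightarrow> (\<forall>a b. \<iota> (a + b) = \<iota> a + \<iota> b) \<and> (\<forall>a b. \<iota> (a * b) = \<iota> a * \<iota> b) \<and> \<iota> 1 = 1"

lemma unital_hom_zero: "unital_hom \<iota> \<Longrightarrow> \<iota> 0 = 0"
  unfolding unital_hom_def by (metis add_cancel_right_right add_0)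

lemma lin_ext_superset:
  assumes "unital_hom \<iota>" "finite S" "Poly_Mapping.keys x \<subseteq> S"
  shows "lin_ext \<iota> h x = (\<Sum>m\<in>S. \<iota> (Poly_Mapping.lookup x m) * h m)"
  unfolding lin_ext_def
  by (rule sum.mono_neutral_left)
    (use assms in \<open>auto simp: unital_hom_zero not_in_keys_iff_lookup_eq_zero\<close>)

lemma lin_ext_add:
  assumes \<iota>: "unital_hom \<iota>"
  shows "lin_ext \<iota> h (x + y) = lin_ext \<iota> h x + lin_ext \<iota> h y"
proof -
  let ?S = "Poly_Mapping.keys x \<union> Poly_Mapping.keys y"
  have "Poly_Mapping.keys (x + y) \<subseteq> ?S" by (rule Poly_Mapping.keys_add)
  then show ?thesis
    using \<iota> by (simp add: lin_ext_superset[OF \<iota>, of ?S] lookup_add unital_hom_def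
        distrib_right sum.distrib)
qed

lemma lin_ext_single:
  assumes \<iota>: "unital_hom \<iota>"
  shows "lin_ext \<iota> h (Poly_Mapping.single m c) = \<iota> c * h m"
  by (subst lin_ext_superset[OF \<iota>, of "{m}"]) auto

lemma lin_ext_sum:
  assumes \<iota>: "unital_hom \<iota>"
  shows "lin_ext \<iota> h (\<Sum>i\<in>I. x i) = (\<Sum>i\<in>I. lin_ext \<iota> h (x i))"
proof -
  have 0: "lin_ext \<iota> h 0 = 0" by (simp add: lin_ext_def)
  show ?thesis
    by (induction I rule: infinite_finite_induct) (simp_all add: 0 lin_ext_add[OF \<iota>])
qed

lemma sum_single: "(\<Sum>m\<in>Poly_Mapping.keys x. Poly_Mapping.single m (Poly_Mapping.lookup x m)) = x"
  by (rule poly_mapping_eqI) (simp add: lookup_sum lookup_single when_def not_in_keys_iff_lookup_eq_zero)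

lemma lin_ext_mult:
  fixes x y :: "'m::comm_monoid_add \<Rightarrow>\<^sub>0 'k::comm_ring_1"
  assumes \<iota>: "unital_hom \<iota>" and h: "\<And>a b. h (a + b) = h a * h b"
  shows "lin_ext \<iota> h (x * y) = lin_ext \<iota> h x * lin_ext \<iota> h y"
proof -
  let ?s = "\<lambda>x m. Poly_Mapping.single m (Poly_Mapping.lookup x m)"
  have "x * y = (\<Sum>a\<in>Poly_Mapping.keys x. ?s x a) * (\<Sum>b\<in>Poly_Mapping.keys y. ?s y b)"
    by (simp only: sum_single)
  also have "\<dots> = (\<Sum>a\<in>Poly_Mapping.keys x. \<Sum>b\<in>Poly_Mapping.keys y. ?s x a * ?s y b)"
    by (rule sum_product)
  finally have "lin_ext \<iota> h (x * y) =
    (\<Sum>a\<in>Poly_Mapping.keys x. \<Sum>b\<in>Poly_Mapping.keys y. lin_ext \<iota> h (?s x a * ?s y b))"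
    by (simp only: lin_ext_sum[OF \<iota>])
  also have "\<dots> = (\<Sum>a\<in>Poly_Mapping.keys x. \<Sum>b\<in>Poly_Mapping.keys y.
      (\<iota> (Poly_Mapping.lookup x a) * h a) * (\<iota> (Poly_Mapping.lookup y b) * h b))"
    using \<iota> by (simp add: mult_single lin_ext_single[OF \<iota>] h unital_hom_def ac_simps)
  finally show ?thesis by (simp add: lin_ext_def sum_product)
qed

lemma algebra_hom_lin_ext:
  fixes h :: "'m::comm_monoid_add \<Rightarrow> 'b::comm_ring_1"
  assumes \<iota>: "unital_hom \<iota>" and h: "h 0 = 1" "\<And>a b. h (a + b) = h a * h b"
  shows "algebra_hom scalar \<iota> (lin_ext \<iota> h)"
  unfolding algebra_hom_def scalar_def
proof (intro conjI allI)
  fix x y :: "'m \<Rightarrow>\<^sub>0 'a" and c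
  show "lin_ext \<iota> h (x + y) = lin_ext \<iota> h x + lin_ext \<iota> h y" by (rule lin_ext_add[OF \<iota>])
  show "lin_ext \<iota> h (x * y) = lin_ext \<iota> h x * lin_ext \<iota> h y" by (rule lin_ext_mult[OF \<iota> h(2)])
  show "lin_ext \<iota> h (Poly_Mapping.single 0 c) = \<iota> c" by (simp add: lin_ext_single[OF \<iota>] h(1))
qed

lemma lin_ext_mon: "unital_hom \<iota> \<Longrightarrow> lin_ext \<iota> h (mon m) = h m"
  by (simp add: mon_def lin_ext_single) (simp add: unital_hom_def)

lemma free_ext_eq_lin_ext: "free_ext \<iota> f = lin_ext \<iota> (\<lambda>m. \<Prod>p\<in>#m. f p)"
  by (rule ext) (simp add: free_ext_def lin_ext_def)

lemma algebra_hom_free_ext: "unital_hom \<iota> \<Longrightarrow> algebra_hom scalar \<iota> (free_ext \<iota> f)"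
  unfolding free_ext_eq_lin_ext by (rule algebra_hom_lin_ext) simp_all

lemma free_ext_gen: "unital_hom \<iota> \<Longrightarrow> free_ext \<iota> f (gen p) = f p"
  by (simp add: free_ext_eq_lin_ext lin_ext_mon)

lemma algebra_hom_sum:
  assumes "algebra_hom \<iota> \<iota>' f" shows "f (\<Sum>i\<in>I. x i) = (\<Sum>i\<in>I. f (x i))"
proof -
  have add: "f (x + y) = f x + f y" for x y using assms by (simp add: algebra_hom_def)
  then have 0: "f 0 = 0" by (metis add_cancel_right_right add_0)
  show ?thesis by (induction I rule: infinite_finite_induct) (simp_all add: 0 add)
qed

lemma mon_add: "mon (a + b) = mon a * (mon b :: 'm::comm_monoid_add \<Rightarrow>\<^sub>0 'k::comm_ring_1)"
  by (simp add: mon_def mult_single)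

text \<open>
  An algebra morphism is determined on monomials, hence everywhere, by its values on generators.
\<close>
lemma algebra_hom_mon:
  fixes f :: "'k::comm_ring_1 alg \<Rightarrow> 'b::comm_ring_1"
  assumes f: "algebra_hom scalar \<iota> f" and \<iota>: "unital_hom \<iota>"
  shows "f (mon m) = (\<Prod>p\<in>#m. f (gen p))"
proof (induction m)
  case empty
  have "f (scalar 1) = \<iota> 1" using f by (simp add: algebra_hom_def)
  then show ?case using \<iota> by (simp add: mon_def scalar_def unital_hom_def)
next
  case (add p m)
  have "f (gen p * mon m) = f (gen p) * f (mon m)" using f by (simp add: algebra_hom_def)
  then show ?case using add by (simp flip: mon_add)
qed

lemma algebra_hom_eq_free_ext:
  fixes f :: "'k::comm_ring_1 alg \<Rightarrow> 'b::comm_ring_1"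
  assumes f: "algebra_hom scalar \<iota> f" and \<iota>: "unital_hom \<iota>"
  shows "f = free_ext \<iota> (\<lambda>p. f (gen p))"
proof
  fix x :: "'k alg"
  have single: "f (Poly_Mapping.single m c) = \<iota> c * f (mon m)" for m c
  proof -
    have "Poly_Mapping.single m c = scalar c * mon m" by (simp add: scalar_def mon_def mult_single)
    then show ?thesis using f by (simp add: algebra_hom_def)
  qed
  have "f x = f (\<Sum>m\<in>Poly_Mapping.keys x. Poly_Mapping.single m (Poly_Mapping.lookup x m))"
    by (simp only: sum_single)
  also have "\<dots> = (\<Sum>m\<in>Poly_Mapping.keys x. \<iota> (Poly_Mapping.lookup x m) * (\<Prod>p\<in>#m. f (gen p)))"
    unfolding algebra_hom_sum[OF f] single
    by (intro sum.cong refl arg_cong2[where f = "(*)"] algebra_hom_mon[OF f \<iota>])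
  finally show "f x = free_ext \<iota> (\<lambda>p. f (gen p)) x" by (simp add: free_ext_def)
qed

lemma algebra_hom_eqI:
  fixes f g :: "'k::comm_ring_1 alg \<Rightarrow> 'b::comm_ring_1"
  assumes "algebra_hom scalar \<iota> f" "algebra_hom scalar \<iota> g" "unital_hom \<iota>"
    and "\<And>p. f (gen p) = g (gen p)"
  shows "f = g"
  using algebra_hom_eq_free_ext[OF assms(1,3)] algebra_hom_eq_free_ext[OF assms(2,3)] assms(4)
  by simp

lemma algebra_hom_comp:
  "algebra_hom \<iota> \<iota>' f \<Longrightarrow> algebra_hom \<iota>' \<iota>'' g \<Longrightarrow> algebra_hom \<iota> \<iota>'' (g \<circ> f)"
  by (simp add: algebra_hom_def)

lemma unital_hom_id: "unital_hom id"
  by (simp add: unital_hom_def)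

lemma unital_hom_scalar: "unital_hom (scalar :: 'k \<Rightarrow> 'm::comm_monoid_add \<Rightarrow>\<^sub>0 'k::comm_ring_1)"
  by (simp add: unital_hom_def scalar_def single_add mult_single)

lemma tensor_ext_eq_lin_ext:
  "tensor_ext \<iota> B f g = lin_ext \<iota> (\<lambda>(m, m'). B (f (mon m)) (g (mon m')))"
  by (rule ext) (simp add: tensor_ext_def lin_ext_def case_prod_beta')

lemma algebra_hom_tensor_ext:
  fixes f g :: "'k::comm_ring_1 alg \<Rightarrow> 'b::comm_ring_1"
  assumes \<iota>: "unital_hom \<iota>" and f: "algebra_hom scalar \<iota>' f" and g: "algebra_hom scalar \<iota>' g"
    and \<iota>': "unital_hom \<iota>'"
    and B: "B 1 1 = 1" "\<And>a b c d. B (a * b) (c * d) = B a c * B b d"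
  shows "algebra_hom scalar \<iota> (tensor_ext \<iota> B f g)"
  unfolding tensor_ext_eq_lin_ext
proof (rule algebra_hom_lin_ext[OF \<iota>])
  show "(case 0 of (m, m') \<Rightarrow> B (f (mon m)) (g (mon m'))) = 1"
    using algebra_hom_mon[OF f \<iota>', of "{#}"] algebra_hom_mon[OF g \<iota>', of "{#}"]
    by (simp add: zero_prod_def B(1))
  have "f (x * y) = f x * f y" "g (x * y) = g x * g y" for x y
    using f g by (simp_all add: algebra_hom_def)
  then show "(case a + b of (m, m') \<Rightarrow> B (f (mon m)) (g (mon m'))) =
    (case a of (m, m') \<Rightarrow> B (f (mon m)) (g (mon m'))) *
    (case b of (m, m') \<Rightarrow> B (f (mon m)) (g (mon m')))" for a b
    by (simp add: case_prod_beta mon_add B(2))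
qed

lemma tensor_ext_sum_mon:
  "unital_hom \<iota> \<Longrightarrow> tensor_ext \<iota> B f g (\<Sum>i\<in>I. mon (m i, m' i)) = (\<Sum>i\<in>I. B (f (mon (m i))) (g (mon (m' i))))"
  by (simp add: tensor_ext_eq_lin_ext lin_ext_sum lin_ext_mon)

section \<open>Convolution of characters\<close>

text \<open>
  The analogue of \<open>\<star>\<close> for the coproduct \<open>\<Delta>\<close>.
\<close>
definition conv :: "('k alg \<Rightarrow> 'k) \<Rightarrow> ('k alg \<Rightarrow> 'k) \<Rightarrow> 'k::comm_ring_1 alg \<Rightarrow> 'k" where
  "conv \<alpha> \<beta> = tensor_ext id (*) \<alpha> \<beta> \<circ> Delta"

lemma character_star: "is_character \<alpha> \<Longrightarrow> is_character \<beta> \<Longrightarrow> is_character (\<alpha> \<star> \<beta>)"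
  unfolding is_character_def star_def delta_def
  by (rule algebra_hom_comp[OF algebra_hom_free_ext[OF unital_hom_scalar]
        algebra_hom_tensor_ext[OF unital_hom_id _ _ unital_hom_id]]) simp_all

lemma character_conv: "is_character \<alpha> \<Longrightarrow> is_character \<beta> \<Longrightarrow> is_character (conv \<alpha> \<beta>)"
  unfolding is_character_def conv_def Delta_def
  by (rule algebra_hom_comp[OF algebra_hom_free_ext[OF unital_hom_scalar]
        algebra_hom_tensor_ext[OF unital_hom_id _ _ unital_hom_id]]) simp_all

lemma character_mon: "is_character \<alpha> \<Longrightarrow> \<alpha> (mon m) = (\<Prod>p\<in>#m. \<alpha> (gen p))"
  unfolding is_character_def by (rule algebra_hom_mon[OF _ unital_hom_id])

lemma character_free_ext: "is_character (free_ext id f)"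
  unfolding is_character_def by (rule algebra_hom_free_ext[OF unital_hom_id])

lemma character_eqI:
  "is_character \<alpha> \<Longrightarrow> is_character \<beta> \<Longrightarrow> (\<And>p. \<alpha> (gen p) = \<beta> (gen p)) \<Longrightarrow> \<alpha> = \<beta>"
  unfolding is_character_def by (rule algebra_hom_eqI[OF _ _ unital_hom_id])

lemma star_gen: "(\<alpha> \<star> \<beta>) (gen p) =
  (\<Sum>r\<in>nc_equivs p. \<alpha> (gen (quot_ncp p r)) * \<beta> (mon (restr_equiv_mon p r)))"
  by (simp add: star_def delta_def free_ext_gen unital_hom_scalar tensor_ext_sum_mon unital_hom_id)

lemma conv_gen: "(conv \<alpha> \<beta>) (gen p) =
  (\<Sum>J\<in>ideals p. \<alpha> (mon (restr_mon (blocks p - J))) * \<beta> (mon (restr_ideal_mon J)))"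
  by (simp add: conv_def Delta_def free_ext_gen unital_hom_scalar tensor_ext_sum_mon unital_hom_id)

section \<open>From characters to functions on families\<close>

text \<open>
  A character as a function on families; the value at \<open>{}\<close> is its value at the unit monomial.
\<close>
definition fam :: "('k::comm_ring_1 alg \<Rightarrow> 'k) \<Rightarrow> nat set set \<Rightarrow> 'k" where
  "fam \<alpha> P = (if P = {} then 1 else \<alpha> (gen (restrict_ncp P)))"

definition rank :: "nat set \<Rightarrow> nat \<Rightarrow> nat" where
  "rank U x = card {y \<in> U. y \<le> x}"

lemma renumber_eq_relabel: "renumber P = relabel (rank (\<Union>P)) P"
  unfolding renumber_def relabel_def rank_def ..

lemma strict_mono_rank: "finite U \<Longrightarrow> strict_mono_on U (rank U)"
proof (rule strict_mono_onI)
  fix x y assume U: "finite U" and xy: "x \<in> U" "y \<in> U" "x < y"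
  have "{z \<in> U. z \<le> x} \<subset> {z \<in> U. z \<le> y}"
  proof (rule psubsetI)
    show "{z \<in> U. z \<le> x} \<subseteq> {z \<in> U. z \<le> y}" using xy by auto
    have "y \<in> {z \<in> U. z \<le> y}" "y \<notin> {z \<in> U. z \<le> x}" using xy by auto
    then show "{z \<in> U. z \<le> x} \<noteq> {z \<in> U. z \<le> y}" by blast
  qed
  then show "rank U x < rank U y" unfolding rank_def using U by (intro psubset_card_mono) auto
qed

lemma rank_image: "finite U \<Longrightarrow> rank U ` U = {1..card U}"
proof -
  assume U: "finite U"
  have "rank U x \<in> {1..card U}" if "x \<in> U" for x
  proof -
    have "{y \<in> U. y \<le> x} \<noteq> {}" "finite {y \<in> U. y \<le> x}" using that U by auto
    then have "1 \<le> rank U x" by (simp add: rank_def Suc_le_eq card_gt_0_iff)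
    moreover have "rank U x \<le> card U" unfolding rank_def using U by (intro card_mono) auto
    ultimately show ?thesis by simp
  qed
  moreover have "card (rank U ` U) = card U"
    by (rule card_image) (rule strict_mono_on_imp_inj_on[OF strict_mono_rank[OF U]])
  ultimately show ?thesis by (intro card_subset_eq) auto
qed

lemma rank_interval: "x \<in> {1..n} \<Longrightarrow> rank {1..n} x = x"
proof -
  assume "x \<in> {1..n}"
  then have "{y \<in> {1..n}. y \<le> x} = {1..x}" by auto
  then show ?thesis by (simp add: rank_def)
qed

lemma relabel_cong: "(\<And>x. x \<in> \<Union>P \<Longrightarrow> f x = g x) \<Longrightarrow> relabel f P = relabel g P"
  unfolding relabel_def by (intro image_cong refl) blast

lemma relabel_ident: "relabel (\<lambda>x. x) P = P"
  by (simp add: relabel_def)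

lemma renumber_interval:
  assumes "\<Union>P = {1..n}" shows "renumber P = P"
proof -
  have "relabel (rank (\<Union>P)) P = relabel (\<lambda>x. x) P"
    by (rule relabel_cong) (simp only: assms rank_interval)
  then show ?thesis by (simp add: renumber_eq_relabel relabel_ident)
qed

lemma ncfam_blocks: "ncfam (blocks p)"
  and Union_blocks: "\<exists>n\<ge>1. \<Union>(blocks p) = {1..n}"
proof -
  obtain n where n: "n \<ge> 1" "partition_on {1..n} (blocks p)" and nc: "noncrossing (blocks p)"
    using blocks[of p] by blast
  have U: "\<Union>(blocks p) = {1..n}" using partition_onD1[OF n(2)] by simp
  then show "\<exists>n\<ge>1. \<Union>(blocks p) = {1..n}" using n by blast
  show "ncfam (blocks p)" unfolding ncfam_def using n(2) nc U by simp
qed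

lemma blocks_nonempty: "blocks p \<noteq> {}"
proof
  assume "blocks p = {}"
  moreover obtain n :: nat where "n \<ge> 1" "\<Union>(blocks p) = {1..n}" using Union_blocks by blast
  ultimately show False by simp
qed

lemma blocks_ncp_of:
  assumes P: "ncfam P" "P \<noteq> {}" "\<Union>P = {1..n}"
  shows "blocks (ncp_of P) = P"
proof (rule ncp_of_inverse)
  have "\<Union>P \<noteq> {}" using P ncfam_Union_empty by blast
  then have "n \<ge> 1" using P(3) by (cases n) auto
  then show "P \<in> {P. (\<exists>n\<ge>1. partition_on {1..n} P) \<and> noncrossing P}"
    using P unfolding ncfam_def by auto
qed

lemma blocks_restrict_ncp:
  assumes P: "ncfam P" "P \<noteq> {}"
  shows "blocks (restrict_ncp P) = renumber P"
proof -
  have fin: "finite (\<Union>P)" using P by (simp add: ncfam_def)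
  interpret relabeling "\<Union>P" "rank (\<Union>P)" by standard (rule strict_mono_rank[OF fin])
  show ?thesis unfolding restrict_ncp_def renumber_eq_relabel
  proof (rule blocks_ncp_of)
    show "ncfam (relabel (rank (\<Union>P)) P)" by (rule ncfam_relabel[OF P(1) subset_refl])
    show "relabel (rank (\<Union>P)) P \<noteq> {}" using P(2) by (simp add: relabel_def)
    show "\<Union>(relabel (rank (\<Union>P)) P) = {1..card (\<Union>P)}"
      using rank_image[OF fin] by (simp add: Union_relabel)
  qed
qed

lemma restrict_ncp_interval: "\<Union>P = {1..n} \<Longrightarrow> restrict_ncp P = ncp_of P"
  using renumber_interval[of P n] by (simp add: restrict_ncp_def)

lemma restrict_ncp_blocks: "restrict_ncp (blocks p) = p"
  using Union_blocks[of p] by (auto simp: restrict_ncp_interval blocks_inverse)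

lemma fam_blocks: "fam \<alpha> (blocks p) = \<alpha> (gen p)"
  by (simp add: fam_def blocks_nonempty restrict_ncp_blocks)

lemma renumber_relabel:
  assumes P: "ncfam P" and f: "strict_mono_on (\<Union>P) f"
  shows "renumber (relabel f P) = renumber P"
proof -
  interpret relabeling "\<Union>P" f by standard (rule f)
  have "rank (f ` \<Union>P) (f x) = rank (\<Union>P) x" if x: "x \<in> \<Union>P" for x
  proof -
    have "f y \<le> f x \<longleftrightarrow> y \<le> x" if "y \<in> \<Union>P" for y using less_iff[OF x that] by linarith
    then have "{y \<in> f ` \<Union>P. y \<le> f x} = f ` {y \<in> \<Union>P. y \<le> x}" by blast
    moreover have "inj_on f {y \<in> \<Union>P. y \<le> x}" by (rule inj_on_subset[OF inj]) blast
    ultimately show ?thesis unfolding rank_def by (simp add: card_image)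
  qed
  then have "relabel (\<lambda>x. rank (f ` \<Union>P) (f x)) P = relabel (rank (\<Union>P)) P"
    by (rule relabel_cong)
  moreover have "relabel (rank (f ` \<Union>P)) (relabel f P) = relabel (\<lambda>x. rank (f ` \<Union>P) (f x)) P"
    by (simp add: relabel_def image_image)
  ultimately show ?thesis by (simp add: renumber_eq_relabel Union_relabel)
qed

lemma fam_relabel_invariant: "relabel_invariant (fam \<alpha>)"
  unfolding relabel_invariant_def fam_def restrict_ncp_def
  by (simp add: renumber_relabel) (simp add: relabel_def)

text \<open>
  The bridge between both worlds: a formula that holds at the normalized families \<open>blocks p\<close> extends
  to all families by relabelling.
\<close>
lemma fam_eqI:
  assumes A: "relabel_invariant A" "A {} = 1" and eq: "\<And>p. \<alpha> (gen p) = A (blocks p)" and P: "ncfam P"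
  shows "fam \<alpha> P = A P"
proof (cases "P = {}")
  case False
  have "fam \<alpha> P = A (renumber P)" using False eq by (simp add: fam_def blocks_restrict_ncp[OF P])
  also have "\<dots> = A P"
    unfolding renumber_eq_relabel
    using P by (intro relabel_invariantD[OF A(1) P] strict_mono_rank) (simp add: ncfam_def)
  finally show ?thesis .
qed (simp add: fam_def A)

lemma character_eq_fam:
  assumes "is_character \<alpha>" "is_character \<beta>" and eq: "\<And>P. ncfam P \<Longrightarrow> fam \<alpha> P = fam \<beta> P"
  shows "\<alpha> = \<beta>"
  using assms(1,2) by (rule character_eqI) (use eq[OF ncfam_blocks] in \<open>simp add: fam_blocks\<close>)

section \<open>The ideal coproduct\<close>

text \<open>
  If a block \<open>c\<close> outside \<open>J\<close> separates two elements of a block \<open>b\<close> of \<open>J\<close>, then \<open>c\<close> is nested in \<open>b\<close> by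
  noncrossingness.
\<close>
lemma ideal_iff_lower:
  assumes P: "ncfam P" and J: "J \<subseteq> P"
  shows "(\<forall>b\<in>J. \<forall>b'\<in>P. nest_le b b' \<longrightarrow> b' \<in> J) \<longleftrightarrow> P - J \<in> lowers P"
proof
  assume up: "\<forall>b\<in>J. \<forall>b'\<in>P. nest_le b b' \<longrightarrow> b' \<in> J"
  have aux: "\<not> k < y" if b: "b \<in> J" "x \<in> b" "y \<in> b" and k: "k \<in> \<Union>(P - J)" "x \<le> k" for b x y k
  proof
    assume "k < y"
    obtain c where c: "c \<in> P" "c \<notin> J" "k \<in> c" using k by blast
    have bP: "b \<in> P" using b J by blast
    have "x \<noteq> k" using ncfam_block_eq[OF P bP c(1), of x] b c by auto
    then have "c \<subseteq> {Min b..Max b}"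
      using noncrossing_nested[OF P bP c(1) b(2,3) c(3)] k \<open>k < y\<close> by simp
    then show False using up b(1) c unfolding nest_le_def by blast
  qed
  show "P - J \<in> lowers P"
  proof (rule lowersI)
    fix b x y assume "b \<in> P - (P - J)" "x \<in> b" "y \<in> b"
    then show "cut (\<Union>(P - J)) x = cut (\<Union>(P - J)) y" by (intro cut_eqI) (use aux in blast)+
  qed blast
next
  assume low: "P - J \<in> lowers P"
  show "\<forall>b\<in>J. \<forall>b'\<in>P. nest_le b b' \<longrightarrow> b' \<in> J"
  proof (intro ballI impI, rule ccontr)
    fix b b' assume b: "b \<in> J" "b' \<in> P" "nest_le b b'" "b' \<notin> J"
    have bP: "b \<in> P" using b J by blast
    have mM: "Min b \<in> b" "Max b \<in> b"
      using ncfam_block_finite[OF P bP] ncfam_nonempty[OF P bP] by auto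
    obtain y where y: "y \<in> b'" using ncfam_nonempty[OF P b(2)] by blast
    have "y \<notin> b" using ncfam_block_eq[OF P bP b(2), of y] y b by blast
    then have "y \<noteq> Min b" "y \<noteq> Max b" using mM by auto
    moreover have "Min b \<le> y" "y \<le> Max b" using b(3) y by (auto simp: nest_le_def)
    ultimately have "Min b < y" "y < Max b" by auto
    moreover have "y \<in> \<Union>(P - J)" using y b by blast
    ultimately have "cut (\<Union>(P - J)) (Min b) \<noteq> cut (\<Union>(P - J)) (Max b)" by (rule cut_between)
    then show False using lowers_cut[OF low _ mM] bP b(1) by blast
  qed
qed

lemma cut_sandwich: "x \<le> y \<Longrightarrow> y \<le> z \<Longrightarrow> cut W x = cut W z \<Longrightarrow> cut W y = cut W x"
  using cut_mono[of x y W] cut_mono[of y z W] by simp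

text \<open>
  Every element of the ground set lies in \<open>W\<close> or \<open>U\<close>, so two elements of \<open>U\<close> have no element of \<open>W\<close>
  between them exactly if the whole interval between them is contained in \<open>U\<close>.
\<close>
lemma components_eq_gaps:
  assumes WU: "W \<union> U = {1..n}" "W \<inter> U = {}"
  shows "components U = gaps W U"
proof -
  have flat_cut: "cut W x = cut W y" if "{a..b} \<subseteq> U" "x \<in> {a..b}" "y \<in> {a..b}" for a b x y
  proof (rule cut_eqI)
    fix k assume k: "k \<in> W"
    then have "k \<notin> {a..b}" using that(1) WU(2) by blast
    then show "x \<le> k \<Longrightarrow> \<not> k < y" "y \<le> k \<Longrightarrow> \<not> k < x" using that(2,3) by auto
  qed
  have fin: "finite U" using WU(1) by (metis finite_Un finite_atLeastAtMost)
  have gap_interval: "G = {Min G..Max G}" if G: "G \<in> gaps W U" for G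
  proof -
    have GU: "G \<subseteq> U" by (rule gap_subset[OF G])
    have finG: "finite G" using GU fin finite_subset by blast
    have mM: "Min G \<in> G" "Max G \<in> G" using finG gap_nonempty[OF G] by auto
    show ?thesis
    proof (intro equalityI subsetI)
      fix z assume "z \<in> G" then show "z \<in> {Min G..Max G}" using finG by simp
    next
      fix z assume z: "z \<in> {Min G..Max G}"
      have eq: "cut W (Min G) = cut W (Max G)" by (rule gap_cut[OF G mM])
      have "Min G \<in> {1..n}" "Max G \<in> {1..n}" using mM GU WU(1) by blast+
      then have "z \<in> {1..n}" using z by auto
      moreover have "z \<notin> W"
      proof
        assume zW: "z \<in> W"
        then have "z \<noteq> Min G" "z \<noteq> Max G" using mM GU WU(2) by blast+
        then have "Min G < z" "z < Max G" using z by auto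
        then show False using cut_between[OF _ _ zW] eq by blast
      qed
      ultimately have "z \<in> U" using WU(1) by blast
      moreover have "cut W z = cut W (Min G)" using z by (intro cut_sandwich[OF _ _ eq]) auto
      ultimately show "z \<in> G" using gap_eq[OF G mM(1)] by blast
    qed
  qed
  have gap_max: "{a..b} \<subseteq> G" if G: "G \<in> gaps W U" and x: "x \<in> G" "x \<in> {a..b}" and ab: "{a..b} \<subseteq> U" for G a b x
  proof
    fix z assume z: "z \<in> {a..b}"
    then have "cut W z = cut W x" using flat_cut[OF ab] x by blast
    then show "z \<in> G" using gap_eq[OF G x(1)] z ab by blast
  qed
  show ?thesis
  proof (intro equalityI subsetI)
    fix I assume "I \<in> components U"
    then obtain a b where I: "I \<noteq> {}" "I \<subseteq> U" "I = {a..b}"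
      and mx: "\<And>a b. I \<subseteq> {a..b} \<and> {a..b} \<subseteq> U \<Longrightarrow> {a..b} = I"
      unfolding components_def by blast
    obtain x where x: "x \<in> I" using I by blast
    then have "x \<in> U" using I by blast
    let ?G = "{y \<in> U. cut W y = cut W x}"
    have G: "?G \<in> gaps W U" by (rule gap_in_gaps[OF \<open>x \<in> U\<close>])
    have "I \<subseteq> ?G" using gap_max[OF G _ _ I(2)[unfolded I(3)], of x] x \<open>x \<in> U\<close> unfolding I(3) by simp
    moreover have "?G \<subseteq> U" by blast
    ultimately have "{Min ?G..Max ?G} = I" using gap_interval[OF G] by (intro mx) auto
    then show "I \<in> gaps W U" using G gap_interval[OF G] by simp
  next
    fix G assume G: "G \<in> gaps W U"
    obtain x where x: "x \<in> G" using gap_nonempty[OF G] by blast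
    have "{a..b} = G" if ab: "G \<subseteq> {a..b} \<and> {a..b} \<subseteq> U" for a b
    proof -
      have "{a..b} \<subseteq> G" using ab x by (intro gap_max[OF G x]) auto
      then show ?thesis using ab by blast
    qed
    moreover have "G \<noteq> {}" "G \<subseteq> U" using gap_nonempty[OF G] gap_subset[OF G] by auto
    moreover have "\<exists>a b. G = {a..b}" using gap_interval[OF G] by blast
    ultimately show "G \<in> components U" unfolding components_def by simp
  qed
qed

lemma prod_mset_image_set: "(\<Prod>p\<in>#image_mset f (mset_set S). g p) = (\<Prod>x\<in>S. g (f x))"
  by (simp add: prod_unfold_prod_mset image_mset.compositionality comp_def)

lemma character_restr_mon: "is_character \<alpha> \<Longrightarrow> \<alpha> (mon (restr_mon K)) = fam \<alpha> K"
  using character_mon[of \<alpha> "{#}"] by (simp add: restr_mon_def fam_def)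

lemma character_restr_ideal_mon:
  assumes \<alpha>: "is_character \<alpha>" and K: "K \<in> lowers (blocks p)"
  shows "\<alpha> (mon (restr_ideal_mon (blocks p - K))) =
    (\<Prod>G\<in>gaps (\<Union>K) (\<Union>(blocks p - K)). fam \<alpha> (inside (blocks p - K) G))"
proof -
  let ?J = "blocks p - K"
  have P: "ncfam (blocks p)" by (rule ncfam_blocks)
  have nc: "ncfam ?J" using P by (rule ncfam_subset) simp
  have KP: "K \<subseteq> blocks p" using K lowers_subset by blast
  obtain n where n: "\<Union>(blocks p) = {1..n}" using Union_blocks by blast
  have comp: "components (\<Union>?J) = gaps (\<Union>K) (\<Union>?J)"
  proof (rule components_eq_gaps)
    show "\<Union>K \<union> \<Union>?J = {1..n}" using n KP by blast
    show "\<Union>K \<inter> \<Union>?J = {}" using Union_Diff_disjoint[OF P KP] by blast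
  qed
  have "\<alpha> (mon (restr_ideal_mon ?J)) = (\<Prod>q\<in>#restr_ideal_mon ?J. \<alpha> (gen q))"
    by (rule character_mon[OF \<alpha>])
  also have "\<dots> = (\<Prod>G\<in>gaps (\<Union>K) (\<Union>?J). \<alpha> (gen (restrict_ncp {b \<in> ?J. b \<subseteq> G})))"
    unfolding restr_ideal_mon_def comp by (rule prod_mset_image_set)
  also have "\<dots> = (\<Prod>G\<in>gaps (\<Union>K) (\<Union>?J). fam \<alpha> (inside ?J G))"
  proof (intro prod.cong refl)
    fix G assume G: "G \<in> gaps (\<Union>K) (\<Union>?J)"
    have "\<Union>(inside ?J G) = G" by (rule Union_inside[OF nc gaps_coarsening[OF P K] G])
    then have "inside ?J G \<noteq> {}" using gap_nonempty[OF G] by auto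
    then have "fam \<alpha> (inside ?J G) = \<alpha> (gen (restrict_ncp (inside ?J G)))" by (simp add: fam_def)
    then show "\<alpha> (gen (restrict_ncp {b \<in> ?J. b \<subseteq> G})) = fam \<alpha> (inside ?J G)"
      by (simp only: inside_def)
  qed
  finally show ?thesis .
qed

lemma conv_gen_eq_cconv:
  assumes \<alpha>: "is_character \<alpha>" and \<beta>: "is_character \<beta>"
  shows "(conv \<alpha> \<beta>) (gen p) = cconv (fam \<alpha>) (fam \<beta>) (blocks p)"
proof -
  let ?P = "blocks p"
  have P: "ncfam ?P" by (rule ncfam_blocks)
  have "(\<Sum>J\<in>ideals p. \<alpha> (mon (restr_mon (?P - J))) * \<beta> (mon (restr_ideal_mon J))) =
    (\<Sum>K\<in>lowers ?P. fam \<alpha> K * (\<Prod>G\<in>gaps (\<Union>K) (\<Union>(?P - K)). fam \<beta> (inside (?P - K) G)))"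
  proof (rule sum.reindex_bij_witness[where i = "\<lambda>K. ?P - K" and j = "\<lambda>J. ?P - J"])
    fix J assume "J \<in> ideals p"
    then have J: "J \<subseteq> ?P" "\<forall>b\<in>J. \<forall>b'\<in>?P. nest_le b b' \<longrightarrow> b' \<in> J" unfolding ideals_def by blast+
    show PPJ: "?P - (?P - J) = J" using J(1) by blast
    show low: "?P - J \<in> lowers ?P" using ideal_iff_lower[OF P J(1)] J(2) by blast
    show "fam \<alpha> (?P - J) * (\<Prod>G\<in>gaps (\<Union>(?P - J)) (\<Union>(?P - (?P - J))).
        fam \<beta> (inside (?P - (?P - J)) G)) =
      \<alpha> (mon (restr_mon (?P - J))) * \<beta> (mon (restr_ideal_mon J))"
      using character_restr_ideal_mon[OF \<beta> low] character_restr_mon[OF \<alpha>] by (simp add: PPJ)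
  next
    fix K assume K: "K \<in> lowers ?P"
    then have KP: "K \<subseteq> ?P" using lowers_subset by blast
    then show PPK: "?P - (?P - K) = K" by blast
    show "?P - K \<in> ideals p"
      using ideal_iff_lower[OF P, of "?P - K"] K unfolding ideals_def PPK by blast
  qed
  then show ?thesis by (simp add: conv_gen cconv_def)
qed

lemma fam_conv:
  assumes \<alpha>: "is_character \<alpha>" and \<beta>: "is_character \<beta>" and P: "ncfam P"
  shows "fam (conv \<alpha> \<beta>) P = cconv (fam \<alpha>) (fam \<beta>) P"
  using conv_gen_eq_cconv[OF \<alpha> \<beta>] P
  by (intro fam_eqI cconv_relabel_invariant fam_relabel_invariant)
    (simp_all add: cconv_empty, simp add: fam_def)

section \<open>The contraction coproduct\<close>

lemma inside_Union_subset:
  assumes P: "ncfam P" and X: "X \<subseteq> P" shows "inside P (\<Union>X) = X"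
proof -
  have "b \<in> X" if b: "b \<in> P" "b \<subseteq> \<Union>X" for b
  proof -
    obtain x where x: "x \<in> b" using ncfam_nonempty[OF P b(1)] by blast
    then obtain c where c: "c \<in> X" "x \<in> c" using b by blast
    then have "b = c" using ncfam_block_eq[OF P b(1), of c x] X x by (simp add: subset_iff)
    then show ?thesis using c by simp
  qed
  then show ?thesis using X unfolding inside_def by blast
qed

text \<open>
  The equivalence on the blocks of \<open>P\<close> whose quotient is the coarsening \<open>R\<close>.
\<close>
definition same_block :: "nat set set \<Rightarrow> nat set set \<Rightarrow> (nat set \<times> nat set) set" where
  "same_block P R = {(b, b'). b \<in> P \<and> b' \<in> P \<and> (\<exists>C\<in>R. b \<subseteq> C \<and> b' \<subseteq> C)}"

lemma quotient_same_block:
  assumes P: "ncfam P" and R: "R \<in> coarsenings P"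
  shows "equiv P (same_block P R)" "P // same_block P R = inside P ` R"
    "Union ` (P // same_block P R) = R"
proof -
  have ncR: "ncfam R" by (rule coarsening_ncfam[OF P R])
  have uniq: "C = D" if b: "b \<in> P" "b \<subseteq> C" "b \<subseteq> D" "C \<in> R" "D \<in> R" for b C D
  proof -
    have "b \<noteq> {}" using ncfam_nonempty[OF P b(1)] .
    then obtain x where "x \<in> C" "x \<in> D" using b(2,3) by blast
    then show ?thesis by (rule ncfam_block_eq[OF ncR b(4,5)])
  qed
  show "equiv P (same_block P R)"
  proof (rule equivI)
    show "same_block P R \<subseteq> P \<times> P" unfolding same_block_def by blast
    show "refl_on P (same_block P R)"
      using coarsening_covers[OF P R] unfolding same_block_def refl_on_def by blast
    show "sym (same_block P R)" unfolding same_block_def sym_def by blast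
    show "trans (same_block P R)"
    proof (rule transI)
      fix a b c assume "(a, b) \<in> same_block P R" "(b, c) \<in> same_block P R"
      then obtain C D where "a \<in> P" "b \<in> P" "c \<in> P" "C \<in> R" "a \<subseteq> C" "b \<subseteq> C" "D \<in> R" "b \<subseteq> D" "c \<subseteq> D"
        unfolding same_block_def by blast
      moreover from this have "C = D" by (intro uniq[of b])
      ultimately show "(a, c) \<in> same_block P R" unfolding same_block_def by blast
    qed
  qed
  have cls: "same_block P R `` {b} = inside P C" if "b \<in> P" "C \<in> R" "b \<subseteq> C" for b C
  proof (intro equalityI subsetI)
    fix b' assume "b' \<in> same_block P R `` {b}"
    then obtain D where D: "b' \<in> P" "D \<in> R" "b \<subseteq> D" "b' \<subseteq> D" unfolding same_block_def by blast
    then have "D = C" using uniq[of b D C] that by blast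
    then show "b' \<in> inside P C" using D unfolding inside_def by blast
  next
    fix b' assume "b' \<in> inside P C"
    then show "b' \<in> same_block P R `` {b}" using that unfolding inside_def same_block_def by blast
  qed
  show q: "P // same_block P R = inside P ` R"
  proof (intro equalityI subsetI)
    fix X assume "X \<in> P // same_block P R"
    then obtain b where b: "b \<in> P" "X = same_block P R `` {b}" by (rule quotientE)
    obtain C where C: "C \<in> R" "b \<subseteq> C" using coarsening_covers[OF P R b(1)] by blast
    then show "X \<in> inside P ` R" using cls[OF b(1) C] b(2) by blast
  next
    fix X assume "X \<in> inside P ` R"
    then obtain C where C: "C \<in> R" "X = inside P C" by blast
    have "\<Union>(inside P C) = C" by (rule Union_inside[OF P R C(1)])
    moreover have "C \<noteq> {}" by (rule ncfam_nonempty[OF ncR C(1)])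
    ultimately obtain b where b: "b \<in> inside P C" by blast
    then have "b \<in> P" "b \<subseteq> C" unfolding inside_def by blast+
    then have "X = same_block P R `` {b}" using cls C by simp
    then show "X \<in> P // same_block P R" using \<open>b \<in> P\<close> by (simp add: quotientI)
  qed
  have "(\<lambda>C. \<Union>(inside P C)) ` R = (\<lambda>C. C) ` R"
    by (rule image_cong) (simp_all add: Union_inside[OF P R])
  then show "Union ` (P // same_block P R) = R" unfolding q by (simp add: image_image)
qed

lemma quotient_class:
  assumes P: "ncfam P" and r: "equiv P r" and X: "X \<in> P // r"
  shows "X \<noteq> {}" "X \<subseteq> P" "inside P (\<Union>X) = X"
proof -
  show "X \<noteq> {}" using in_quotient_imp_non_empty[OF r X] .
  show "X \<subseteq> P" using in_quotient_imp_subset[OF r X] .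
  then show "inside P (\<Union>X) = X" by (rule inside_Union_subset[OF P])
qed

text \<open>
  The class \<open>X\<close> is recovered from the merged block as the set of blocks of \<open>P\<close> contained in \<open>\<Union>X\<close>.
\<close>
lemma merge_coarsening:
  assumes P: "ncfam P" and r: "equiv P r" and nc: "noncrossing (Union ` (P // r))"
  shows "Union ` (P // r) \<in> coarsenings P" "same_block P (Union ` (P // r)) = r"
    "inj_on Union (P // r)"
proof -
  let ?R = "Union ` (P // r)"
  note cls = quotient_class[OF P r]
  have UP: "\<Union>(P // r) = P" by (rule Union_quotient[OF r])
  have "\<Union>?R = \<Union>(\<Union>(P // r))" by blast
  then have U: "\<Union>?R = \<Union>P" using UP by simp
  show "inj_on Union (P // r)" by (rule inj_on_inverseI[where g = "inside P"]) (rule cls(3))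
  have ncR: "ncfam ?R"
    unfolding ncfam_iff
  proof (intro conjI)
    show "finite (\<Union>?R)" using U P by (simp add: ncfam_def)
    show "{} \<notin> ?R"
    proof
      assume "{} \<in> ?R"
      then obtain X where X: "X \<in> P // r" "\<Union>X = {}" by blast
      then obtain b where "b \<in> X" "b = {}" using cls(1)[OF X(1)] by blast
      then show False using cls(2)[OF X(1)] ncfam_nonempty[OF P, of b] by blast
    qed
    show "\<forall>b\<in>?R. \<forall>b'\<in>?R. \<forall>x\<in>b. x \<in> b' \<longrightarrow> b = b'"
    proof (intro ballI impI)
      fix B B' x assume "B \<in> ?R" "B' \<in> ?R" "x \<in> B" "x \<in> B'"
      then obtain X X' b b' where X: "X \<in> P // r" "X' \<in> P // r" "B = \<Union>X" "B' = \<Union>X'"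
        "b \<in> X" "x \<in> b" "b' \<in> X'" "x \<in> b'" by blast
      have "b = b'" using ncfam_block_eq[OF P _ _ X(6,8)] cls(2)[OF X(1)] cls(2)[OF X(2)] X by blast
      then have "X = X'" using quotient_disj[OF r X(1,2)] X by blast
      then show "B = B'" using X by simp
    qed
  qed (rule nc)
  have "\<exists>B\<in>?R. b \<subseteq> B" if "b \<in> P" for b
  proof -
    have "b \<in> \<Union>(P // r)" using UP that by simp
    then show ?thesis by blast
  qed
  then show "?R \<in> coarsenings P" using ncR U P by (simp add: coarsenings_iff)
  show "same_block P ?R = r"
  proof (intro equalityI subsetI)
    fix q assume "q \<in> same_block P ?R"
    then obtain b b' X where q: "q = (b, b')" "b \<in> P" "b' \<in> P" "X \<in> P // r" "b \<subseteq> \<Union>X" "b' \<subseteq> \<Union>X"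
      unfolding same_block_def by blast
    then have "b \<in> inside P (\<Union>X)" "b' \<in> inside P (\<Union>X)" unfolding inside_def by blast+
    then have "b \<in> X" "b' \<in> X" using cls(3)[OF q(4)] by simp_all
    then show "q \<in> r" using in_quotient_imp_in_rel[OF r q(4)] q(1) by blast
  next
    fix q assume q: "q \<in> r"
    obtain b b' where bb: "q = (b, b')" by (cases q)
    have bP: "b \<in> P" "b' \<in> P" using q equiv_type[OF r] unfolding bb by blast+
    have "r `` {b} \<in> P // r" using bP(1) by (rule quotientI)
    then have "\<Union>(r `` {b}) \<in> ?R" by (rule imageI)
    moreover have "b \<in> r `` {b}" "b' \<in> r `` {b}"
      using q equiv_class_self[OF r bP(1)] unfolding bb by auto
    then have "b \<subseteq> \<Union>(r `` {b})" "b' \<subseteq> \<Union>(r `` {b})" by blast+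
    ultimately have "\<exists>C\<in>?R. b \<subseteq> C \<and> b' \<subseteq> C" by (intro bexI conjI)
    then show "q \<in> same_block P ?R" using bP by (simp add: same_block_def bb)
  qed
qed

lemma star_gen_eq_cstar:
  assumes \<alpha>: "is_character \<alpha>" and \<beta>: "is_character \<beta>"
  shows "(\<alpha> \<star> \<beta>) (gen p) = cstar (fam \<alpha>) (fam \<beta>) (blocks p)"
proof -
  let ?P = "blocks p"
  have P: "ncfam ?P" by (rule ncfam_blocks)
  obtain n where n: "\<Union>?P = {1..n}" using Union_blocks by blast
  have "(\<Sum>r\<in>nc_equivs p. \<alpha> (gen (quot_ncp p r)) * \<beta> (mon (restr_equiv_mon p r))) =
    (\<Sum>R\<in>coarsenings ?P. fam \<alpha> R * (\<Prod>C\<in>R. fam \<beta> (inside ?P C)))"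
  proof (rule sum.reindex_bij_witness[where i = "same_block ?P" and j = "merge p"])
    fix r assume "r \<in> nc_equivs p"
    then have r: "equiv ?P r" "noncrossing (Union ` (?P // r))"
      unfolding nc_equivs_def merge_def by blast+
    note m = merge_coarsening[OF P r]
    show "same_block ?P (merge p r) = r" unfolding merge_def by (rule m(2))
    show R: "merge p r \<in> coarsenings ?P" unfolding merge_def by (rule m(1))
    have "merge p r \<noteq> {}" using coarsening_empty_iff[OF P R] blocks_nonempty by simp
    moreover have "\<Union>(merge p r) = {1..n}" using coarsening_Union[OF P R] n by simp
    ultimately have 1: "fam \<alpha> (merge p r) = \<alpha> (gen (quot_ncp p r))"
      using restrict_ncp_interval[of "merge p r" n] by (simp add: fam_def quot_ncp_def)
    have "\<beta> (mon (restr_equiv_mon p r)) = (\<Prod>q\<in>#restr_equiv_mon p r. \<beta> (gen q))"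
      by (rule character_mon[OF \<beta>])
    also have "\<dots> = (\<Prod>X\<in>?P // r. \<beta> (gen (restrict_ncp X)))"
      unfolding restr_equiv_mon_def by (rule prod_mset_image_set)
    also have "\<dots> = (\<Prod>X\<in>?P // r. fam \<beta> (inside ?P (\<Union>X)))"
      by (intro prod.cong refl) (simp add: quotient_class[OF P r(1)] fam_def)
    also have "\<dots> = (\<Prod>C\<in>merge p r. fam \<beta> (inside ?P C))"
      unfolding merge_def by (simp add: prod.reindex[OF m(3)])
    finally show "fam \<alpha> (merge p r) * (\<Prod>C\<in>merge p r. fam \<beta> (inside ?P C)) =
      \<alpha> (gen (quot_ncp p r)) * \<beta> (mon (restr_equiv_mon p r))" using 1 by simp
  next
    fix R assume R: "R \<in> coarsenings ?P"
    note q = quotient_same_block[OF P R]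
    show m: "merge p (same_block ?P R) = R" unfolding merge_def by (rule q(3))
    show "same_block ?P R \<in> nc_equivs p"
      using q(1) coarsening_ncfam[OF P R] by (simp add: nc_equivs_def m ncfam_def)
  qed
  then show ?thesis by (simp add: star_gen cstar_def)
qed

lemma fam_star:
  assumes \<alpha>: "is_character \<alpha>" and \<beta>: "is_character \<beta>" and P: "ncfam P"
  shows "fam (\<alpha> \<star> \<beta>) P = cstar (fam \<alpha>) (fam \<beta>) P"
  using star_gen_eq_cstar[OF \<alpha> \<beta>] P
  by (intro fam_eqI cstar_relabel_invariant fam_relabel_invariant)
    (simp_all add: cstar_empty, simp add: fam_def)

section \<open>The two products of characters\<close>

lemma cstar_cong:
  assumes P: "ncfam P" and "\<And>R. ncfam R \<Longrightarrow> A R = A' R" "\<And>R. ncfam R \<Longrightarrow> B R = B' R"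
  shows "cstar A B P = cstar A' B' P"
  unfolding cstar_def
  using coarsening_ncfam[OF P] ncfam_inside[OF P] assms(2,3) by (intro sum.cong prod.cong refl arg_cong2[where f = "(*)"]) auto

lemma cconv_cong:
  assumes P: "ncfam P" and "\<And>R. ncfam R \<Longrightarrow> A R = A' R" "\<And>R. ncfam R \<Longrightarrow> B R = B' R"
  shows "cconv A B P = cconv A' B' P"
proof -
  have "ncfam K" "ncfam (inside (P - K) G)" if "K \<in> lowers P" for K G
    using ncfam_subset[OF P] lowers_subset[OF that] by (auto simp: inside_def)
  then show ?thesis
    unfolding cconv_def using assms(2,3) by (intro sum.cong prod.cong refl arg_cong2[where f = "(*)"]) auto
qed

lemma fam_empty: "fam \<alpha> {} = 1"
  by (simp add: fam_def)

lemma star_assoc: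
  assumes "is_character \<alpha>" "is_character \<beta>" "is_character \<gamma>"
  shows "\<alpha> \<star> \<beta> \<star> \<gamma> = \<alpha> \<star> (\<beta> \<star> \<gamma>)"
proof (rule character_eq_fam)
  fix P assume P: "ncfam P"
  have "fam (\<alpha> \<star> \<beta> \<star> \<gamma>) P = cstar (cstar (fam \<alpha>) (fam \<beta>)) (fam \<gamma>) P"
    using assms P by (simp add: fam_star character_star cong: cstar_cong)
  moreover have "fam (\<alpha> \<star> (\<beta> \<star> \<gamma>)) P = cstar (fam \<alpha>) (cstar (fam \<beta>) (fam \<gamma>)) P"
    using assms P by (simp add: fam_star character_star cong: cstar_cong)
  ultimately show "fam (\<alpha> \<star> \<beta> \<star> \<gamma>) P = fam (\<alpha> \<star> (\<beta> \<star> \<gamma>)) P" using cstar_assoc[OF P] by metis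
qed (intro character_star assms)+

lemma conv_assoc:
  assumes "is_character \<alpha>" "is_character \<beta>" "is_character \<gamma>"
  shows "conv (conv \<alpha> \<beta>) \<gamma> = conv \<alpha> (conv \<beta> \<gamma>)"
proof (rule character_eq_fam)
  fix P assume P: "ncfam P"
  have "fam (conv (conv \<alpha> \<beta>) \<gamma>) P = cconv (cconv (fam \<alpha>) (fam \<beta>)) (fam \<gamma>) P"
    using assms P by (simp add: fam_conv character_conv cong: cconv_cong)
  moreover have "fam (conv \<alpha> (conv \<beta> \<gamma>)) P = cconv (fam \<alpha>) (cconv (fam \<beta>) (fam \<gamma>)) P"
    using assms P by (simp add: fam_conv character_conv cong: cconv_cong)
  ultimately show "fam (conv (conv \<alpha> \<beta>) \<gamma>) P = fam (conv \<alpha> (conv \<beta> \<gamma>)) P"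
    using cconv_assoc[OF P, where A = "fam \<alpha>" and B = "fam \<beta>" and C = "fam \<gamma>", OF fam_empty] by simp
qed (intro character_conv assms)+

text \<open>
  The cointeraction on the level of characters; everything about \<open>\<phi>\<close> and its value at \<open>-1\<close> rests on
  it.
\<close>
lemma star_conv_distrib:
  assumes "is_character \<alpha>" "is_character \<beta>" "is_character \<gamma>"
  shows "conv \<alpha> \<beta> \<star> \<gamma> = conv (\<alpha> \<star> \<gamma>) (\<beta> \<star> \<gamma>)"
proof (rule character_eq_fam)
  fix P assume P: "ncfam P"
  have "fam (conv \<alpha> \<beta> \<star> \<gamma>) P = cstar (cconv (fam \<alpha>) (fam \<beta>)) (fam \<gamma>) P"
    using assms P by (simp add: fam_star fam_conv character_conv cong: cstar_cong)
  moreover have "fam (conv (\<alpha> \<star> \<gamma>) (\<beta> \<star> \<gamma>)) P = cconv (cstar (fam \<alpha>) (fam \<gamma>)) (cstar (fam \<beta>) (fam \<gamma>)) P"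
    using assms P by (simp add: fam_star fam_conv character_star cong: cconv_cong)
  ultimately show "fam (conv \<alpha> \<beta> \<star> \<gamma>) P = fam (conv (\<alpha> \<star> \<gamma>) (\<beta> \<star> \<gamma>)) P"
    using cstar_cconv[OF P] by metis
qed (intro character_conv character_star assms)+

lemma one_block_relabel_invariant: "relabel_invariant (one_block c)"
  unfolding relabel_invariant_def one_block_def
  by (simp add: card_relabel) (simp add: relabel_def)

lemma fam_one_block:
  "ncfam P \<Longrightarrow> fam (free_ext id (\<lambda>p. if card (blocks p) = 1 then c else 0)) P = one_block c P"
  by (rule fam_eqI[OF one_block_relabel_invariant])
    (simp_all add: free_ext_gen unital_hom_id one_block_def blocks_nonempty)

lemma fam_eps_delta: "ncfam P \<Longrightarrow> fam eps_delta P = one_block 1 P"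
  unfolding eps_delta_def by (rule fam_one_block)

lemma fam_gamma_m1: "ncfam P \<Longrightarrow> fam gamma_m1 P = one_block (- 1) P"
  unfolding gamma_m1_def by (rule fam_one_block)

lemma fam_eps_Delta: "ncfam P \<Longrightarrow> fam eps_Delta P = empty_ind P"
  by (simp add: fam_def empty_ind_def eps_Delta_def free_ext_gen unital_hom_id)

lemma fam_lam: "ncfam P \<Longrightarrow> fam lam P = 1"
  by (simp add: fam_def lam_def free_ext_gen unital_hom_id)

lemma Base_iff_flat: "blocks p = Base p \<longleftrightarrow> flat (blocks p)"
proof -
  let ?P = "blocks p"
  have P: "ncfam ?P" by (rule ncfam_blocks)
  have "blocks p = Base p \<longleftrightarrow> (\<forall>b\<in>?P. \<forall>b'\<in>?P. b \<subseteq> {Min b'..Max b'} \<longrightarrow> b' = b)"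
    unfolding Base_def nest_le_def by blast
  also have "\<dots> \<longleftrightarrow> flat ?P"
  proof
    assume *: "\<forall>b\<in>?P. \<forall>b'\<in>?P. b \<subseteq> {Min b'..Max b'} \<longrightarrow> b' = b"
    show "flat ?P"
    proof (rule flatI)
      fix b b' x y z assume b: "b \<in> ?P" "b' \<in> ?P" "x \<in> b" "z \<in> b" "y \<in> b'" "x < y" "y < z"
      have "b' \<subseteq> {Min b..Max b}" by (rule noncrossing_nested[OF P b])
      then show "b = b'" using *[rule_format, OF b(2,1)] by simp
    qed
  next
    assume flat: "flat ?P"
    show "\<forall>b\<in>?P. \<forall>b'\<in>?P. b \<subseteq> {Min b'..Max b'} \<longrightarrow> b' = b"
    proof (intro ballI impI, rule ccontr)
      fix b b' assume b: "b \<in> ?P" "b' \<in> ?P" "b \<subseteq> {Min b'..Max b'}" "b' \<noteq> b"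
      have mM: "Min b' \<in> b'" "Max b' \<in> b'"
        using ncfam_block_finite[OF P b(2)] ncfam_nonempty[OF P b(2)] by auto
      obtain y where y: "y \<in> b" using ncfam_nonempty[OF P b(1)] by blast
      have "y \<notin> b'" using ncfam_block_eq[OF P b(1,2) y] b by blast
      then have "Min b' \<noteq> y" "y \<noteq> Max b'" using mM by auto
      then have "Min b' < y" "y < Max b'" using b(3) y by (auto simp: order_less_le)
      then show False using flatD[OF flat b(2,1) mM y] b(4) by blast
    qed
  qed
  finally show ?thesis .
qed

lemma flat_ind_relabel_invariant: "relabel_invariant flat_ind"
  by (simp add: relabel_invariant_def flat_ind_def flat_relabel_iff)

lemma fam_lam_s: "ncfam P \<Longrightarrow> fam lam_s P = flat_ind P"
  unfolding lam_s_def
  by (rule fam_eqI[OF flat_ind_relabel_invariant])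
    (simp_all add: free_ext_gen unital_hom_id flat_ind_def Base_iff_flat, simp add: flat_def)

lemma character_constants:
  "is_character eps_delta" "is_character eps_Delta" "is_character lam" "is_character lam_s" "is_character gamma_m1"
  by (simp_all add: eps_delta_def eps_Delta_def lam_def lam_s_def gamma_m1_def character_free_ext)

lemma eps_delta_star: "is_character \<alpha> \<Longrightarrow> eps_delta \<star> \<alpha> = \<alpha>"
proof (rule character_eq_fam)
  fix P assume \<alpha>: "is_character \<alpha>" and P: "ncfam P"
  have "fam (eps_delta \<star> \<alpha>) P = cstar (one_block 1) (fam \<alpha>) P"
    using P \<alpha> by (simp add: fam_star character_constants fam_eps_delta cong: cstar_cong)
  then show "fam (eps_delta \<star> \<alpha>) P = fam \<alpha> P"
    using cstar_one_block_left[OF P, of 1 "fam \<alpha>"] by (cases "P = {}") (simp_all add: fam_empty)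
qed (simp_all add: character_star character_constants)

lemma star_eps_delta: "is_character \<alpha> \<Longrightarrow> \<alpha> \<star> eps_delta = \<alpha>"
proof (rule character_eq_fam)
  fix P assume \<alpha>: "is_character \<alpha>" and P: "ncfam P"
  have "fam (\<alpha> \<star> eps_delta) P = cstar (fam \<alpha>) (one_block 1) P"
    using P \<alpha> by (simp add: fam_star character_constants fam_eps_delta cong: cstar_cong)
  then show "fam (\<alpha> \<star> eps_delta) P = fam \<alpha> P"
    using cstar_one_block_right[OF P, of "fam \<alpha>" 1] by simp
qed (simp_all add: character_star character_constants)

lemma eps_Delta_star: "is_character \<alpha> \<Longrightarrow> eps_Delta \<star> \<alpha> = eps_Delta"
proof (rule character_eq_fam)
  fix P assume \<alpha>: "is_character \<alpha>" and P: "ncfam P"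
  have "fam (eps_Delta \<star> \<alpha>) P = cstar empty_ind (fam \<alpha>) P"
    using P \<alpha> by (simp add: fam_star character_constants fam_eps_Delta cong: cstar_cong)
  then show "fam (eps_Delta \<star> \<alpha>) P = fam eps_Delta P"
    using cstar_empty_ind[OF P, of "fam \<alpha>"] P by (simp add: fam_eps_Delta)
qed (simp_all add: character_star character_constants)

lemma eps_Delta_conv: "is_character \<alpha> \<Longrightarrow> conv eps_Delta \<alpha> = \<alpha>"
proof (rule character_eq_fam)
  fix P assume \<alpha>: "is_character \<alpha>" and P: "ncfam P"
  have "fam (conv eps_Delta \<alpha>) P = cconv empty_ind (fam \<alpha>) P"
    using P \<alpha> by (simp add: fam_conv character_constants fam_eps_Delta cong: cconv_cong)
  then show "fam (conv eps_Delta \<alpha>) P = fam \<alpha> P"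
    using cconv_empty_ind_left[of "fam \<alpha>", OF fam_empty P] by simp
qed (simp_all add: character_conv character_constants)

lemma conv_right_cancel:
  assumes "is_character \<alpha>" "is_character \<beta>" "is_character \<gamma>" and eq: "conv \<alpha> \<gamma> = conv \<beta> \<gamma>"
  shows "\<alpha> = \<beta>"
proof (rule character_eq_fam[OF assms(1,2)])
  fix P assume P: "ncfam P"
  show "fam \<alpha> P = fam \<beta> P"
  proof (rule cconv_right_cancel[OF _ P, where B = "fam \<gamma>"])
    fix P assume P: "ncfam P"
    show "cconv (fam \<alpha>) (fam \<gamma>) P = cconv (fam \<beta>) (fam \<gamma>) P"
      using fam_conv[OF assms(1,3) P] fam_conv[OF assms(2,3) P] eq by simp
  qed
qed

section \<open>Polynomials and their values at natural numbers\<close>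

lemma poly_eqI_infinite:
  fixes p q :: "'a::idom poly"
  assumes "infinite A" "\<And>x. x \<in> A \<Longrightarrow> poly p x = poly q x"
  shows "p = q"
proof (rule ccontr)
  assume "p \<noteq> q"
  then have "finite {x. poly (p - q) x = 0}" by (intro poly_roots_finite) simp
  moreover have "A \<subseteq> {x. poly (p - q) x = 0}" using assms(2) by auto
  ultimately show False using assms(1) finite_subset by blast
qed

lemma poly_eqI_nat:
  fixes p q :: "'k::field_char_0 poly"
  assumes "\<And>n::nat. poly p (of_nat n) = poly q (of_nat n)"
  shows "p = q"
proof (rule poly_eqI_infinite)
  show "infinite (range (of_nat :: nat \<Rightarrow> 'k))" by (rule range_inj_infinite) (rule inj_of_nat)
qed (use assms in auto)

text \<open>
  Telescoping the differences \<open>(i + 1)^(k + 1) - i^(k + 1)\<close> expresses \<open>(k + 1)\<close> times the sum of \<open>k\<close>-th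
  powers by \<open>n^(k + 1)\<close> and sums of lower powers.
\<close>
lemma sum_powers_polynomial:
  "\<exists>r :: 'k::field_char_0 poly. \<forall>n::nat. poly r (of_nat n) = (\<Sum>i<n. of_nat i ^ k)"
proof (induction k rule: less_induct)
  case (less k)
  define R where "R j = (SOME r :: 'k poly. \<forall>n::nat. poly r (of_nat n) = (\<Sum>i<n. of_nat i ^ j))" for j
  have R: "poly (R j) (of_nat n) = (\<Sum>i<n. of_nat i ^ j)" if "j < k" for j n
    using someI_ex[OF less[OF that]] unfolding R_def by blast
  define r :: "'k poly" where
    "r = smult (1 / of_nat (Suc k)) (monom 1 (Suc k) - (\<Sum>j<k. smult (of_nat (Suc k choose j)) (R j)))"
  have "poly r (of_nat n) = (\<Sum>i<n. of_nat i ^ k)" for n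
  proof -
    have tele: "(\<Sum>i<n. of_nat (Suc i) ^ Suc k - of_nat i ^ Suc k) = (of_nat n ^ Suc k :: 'k)"
      by (subst sum_lessThan_telescope) simp
    have expand: "of_nat (Suc i) ^ Suc k - of_nat i ^ Suc k =
      (of_nat (Suc k) * of_nat i ^ k + (\<Sum>j<k. of_nat (Suc k choose j) * of_nat i ^ j) :: 'k)" for i
    proof -
      have "(of_nat (Suc i) :: 'k) ^ Suc k = (of_nat i + 1) ^ Suc k" by (simp add: add.commute)
      also have "\<dots> = (\<Sum>j\<le>Suc k. of_nat (Suc k choose j) * of_nat i ^ j * 1 ^ (Suc k - j))"
        by (rule binomial_ring)
      also have "\<dots> = (\<Sum>j\<le>Suc k. of_nat (Suc k choose j) * of_nat i ^ j)" by simp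
      also have "\<dots> = (\<Sum>j<k. of_nat (Suc k choose j) * of_nat i ^ j) +
          of_nat (Suc k) * of_nat i ^ k + of_nat i ^ Suc k"
        by (simp only: lessThan_Suc_atMost[symmetric] sum.lessThan_Suc binomial_n_n binomial_Suc_n of_nat_1 mult_1)
      finally show ?thesis by simp
    qed
    have "of_nat n ^ Suc k = (of_nat (Suc k) * (\<Sum>i<n. of_nat i ^ k) +
      (\<Sum>j<k. of_nat (Suc k choose j) * (\<Sum>i<n. of_nat i ^ j)) :: 'k)"
      unfolding tele[symmetric] expand sum.distrib sum_distrib_left
      by (subst (2) sum.swap) (rule refl)
    then have "of_nat n ^ Suc k - (\<Sum>j<k. of_nat (Suc k choose j) * (\<Sum>i<n. of_nat i ^ j)) =
      (of_nat (Suc k) * (\<Sum>i<n. of_nat i ^ k) :: 'k)" by simp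
    moreover have "poly r (of_nat n) = 1 / of_nat (Suc k) *
        (of_nat n ^ Suc k - (\<Sum>j<k. of_nat (Suc k choose j) * poly (R j) (of_nat n)))"
      by (simp only: r_def poly_smult poly_diff poly_monom poly_sum mult_1)
    moreover have "(\<Sum>j<k. of_nat (Suc k choose j) * poly (R j) (of_nat n)) =
        (\<Sum>j<k. of_nat (Suc k choose j) * (\<Sum>i<n. of_nat i ^ j))"
      by (intro sum.cong refl) (simp add: R)
    ultimately show ?thesis by (simp del: of_nat_Suc)
  qed
  then show ?case by blast
qed

lemma sum_polynomial:
  fixes q :: "'k::field_char_0 poly"
  shows "\<exists>r. \<forall>n::nat. poly r (of_nat n) = (\<Sum>i<n. poly q (of_nat i))"
proof -
  obtain R :: "nat \<Rightarrow> 'k poly" where R: "\<And>k n. poly (R k) (of_nat n) = (\<Sum>i<n. of_nat i ^ k)"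
    using sum_powers_polynomial by metis
  have "poly (\<Sum>k\<le>degree q. smult (coeff q k) (R k)) (of_nat n) = (\<Sum>i<n. poly q (of_nat i))" for n
    unfolding poly_sum poly_smult R poly_altdef[of q] sum_distrib_left by (rule sum.swap)
  then show ?thesis by blast
qed

section \<open>Convolution powers of the counit\<close>

text \<open>
  These characters are the values of the double bialgebra morphism at the natural numbers.
\<close>
definition eps_power :: "nat \<Rightarrow> 'k::comm_ring_1 alg \<Rightarrow> 'k" where
  "eps_power n = (conv eps_delta ^^ n) eps_Delta"

lemma eps_power_0: "eps_power 0 = eps_Delta"
  by (simp add: eps_power_def)

lemma eps_power_Suc: "eps_power (Suc n) = conv eps_delta (eps_power n)"
  by (simp add: eps_power_def)

lemma character_eps_power: "is_character (eps_power n)"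
  by (induction n) (simp_all add: eps_power_0 eps_power_Suc character_constants character_conv)

lemma eps_power_add: "eps_power (m + n) = conv (eps_power m) (eps_power n)"
proof (induction m)
  case (Suc m)
  then show ?case
    by (simp add: eps_power_Suc conv_assoc[OF character_constants(1) character_eps_power character_eps_power])
qed (simp add: eps_power_0 eps_Delta_conv character_eps_power)

text \<open>
  By the cointeraction, \<open>(\<epsilon>\<^sub>\<delta> * ... * \<epsilon>\<^sub>\<delta>) \<star> \<gamma> = (\<epsilon>\<^sub>\<delta> \<star> \<gamma>) * ... * (\<epsilon>\<^sub>\<delta> \<star> \<gamma>) = \<gamma> * ... * \<gamma>\<close>, where \<open>*\<close>
  denotes the convolution for \<open>\<Delta>\<close>.
\<close>
lemma eps_power_mult: "(eps_power (m * n) :: 'k::comm_ring_1 alg \<Rightarrow> 'k) = eps_power m \<star> eps_power n"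
proof (induction m)
  case (Suc m)
  have "(eps_power (Suc m * n) :: 'k alg \<Rightarrow> 'k) = conv (eps_power n) (eps_power m \<star> eps_power n)"
    using Suc by (simp add: eps_power_add)
  also have "\<dots> = conv (eps_delta \<star> eps_power n) (eps_power m \<star> eps_power n)"
    by (simp add: eps_delta_star character_eps_power)
  also have "\<dots> = conv eps_delta (eps_power m) \<star> eps_power n"
    by (rule star_conv_distrib[OF character_constants(1) character_eps_power character_eps_power, symmetric])
  finally show ?case by (simp add: eps_power_Suc)
qed (simp add: eps_power_0 eps_Delta_star character_eps_power)

text \<open>
  Cancelling \<open>\<epsilon>\<^sub>\<Delta>\<close> on the right shows that it is also a right unit, since it is an idempotent left
  unit.
\<close>
lemma eps_power_1: "eps_power 1 = eps_delta"
proof (rule conv_right_cancel)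
  have "conv (conv eps_delta eps_Delta) eps_Delta = conv eps_delta (conv eps_Delta eps_Delta)"
    by (rule conv_assoc) (rule character_constants)+
  then show "conv (eps_power 1) eps_Delta = conv eps_delta eps_Delta"
    by (simp add: eps_power_def eps_Delta_conv character_constants)
qed (rule character_eps_power character_constants)+

text \<open>
  The difference of the values at \<open>n + 1\<close> and \<open>n\<close> is a polynomial in \<open>n\<close> by induction on the number of
  blocks, and sums of polynomials are polynomials in characteristic zero.
\<close>
lemma eps_power_polynomial:
  assumes "ncfam P"
  shows "\<exists>q :: 'k::field_char_0 poly. \<forall>n. poly q (of_nat n) = fam (eps_power n) P"
  using assms
proof (induction "card P" arbitrary: P rule: less_induct)
  case less
  note P = less.prems
  show ?case
  proof (cases "P = {}")
    case True
    then have "\<forall>n. poly 1 (of_nat n) = fam (eps_power n) P" by (simp add: fam_empty)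
    then show ?thesis by blast
  next
    case False
    define Q where "Q R = (SOME q :: 'k poly. \<forall>n. poly q (of_nat n) = fam (eps_power n) R)" for R
    have Q: "poly (Q R) (of_nat n) = fam (eps_power n) R" if "R \<subset> P" for R n
    proof -
      have "card R < card P" using that ncfam_finite[OF P] by (intro psubset_card_mono)
      moreover have "ncfam R" using ncfam_subset[OF P] that by blast
      ultimately have "\<exists>q :: 'k poly. \<forall>n. poly q (of_nat n) = fam (eps_power n) R"
        by (rule less.hyps)
      from someI_ex[OF this] show ?thesis unfolding Q_def by blast
    qed
    let ?X = "{b. b \<in> P \<and> {b} \<in> lowers P}"
    define D where "D = (\<Sum>b\<in>?X. \<Prod>G\<in>gaps b (\<Union>(P - {b})). Q (inside (P - {b}) G))"
    have D: "poly D (of_nat n) = (\<Sum>b\<in>?X. \<Prod>G\<in>gaps b (\<Union>(P - {b})). fam (eps_power n) (inside (P - {b}) G))" for n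
      unfolding D_def poly_sum poly_prod
    proof (intro sum.cong prod.cong refl Q)
      fix b G assume "b \<in> ?X"
      then show "inside (P - {b}) G \<subset> P" unfolding inside_def by blast
    qed
    obtain r where r: "\<And>n. poly r (of_nat n) = (\<Sum>i<n. poly D (of_nat i))"
      using sum_polynomial[of D] by blast
    have "poly r (of_nat n) = fam (eps_power n) P" for n
    proof (induction n)
      case 0
      show ?case using r[of 0] P False by (simp add: eps_power_0 fam_eps_Delta empty_ind_def)
    next
      case (Suc n)
      have "fam (eps_power (Suc n)) P = cconv (one_block 1) (fam (eps_power n)) P"
        using P by (simp add: eps_power_Suc fam_conv character_constants character_eps_power
            fam_eps_delta cong: cconv_cong)
      also have "\<dots> = fam (eps_power n) P + poly D (of_nat n)"
        unfolding D by (rule cconv_one_block_left[where B = "fam (eps_power n)", OF fam_empty P])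
      also have "\<dots> = poly r (of_nat (Suc n))"
        unfolding r sum.lessThan_Suc using Suc r[of n] by simp
      finally show ?case ..
    qed
    then show ?thesis by blast
  qed
qed

section \<open>The double bialgebra morphism\<close>

definition eval_at :: "('k::comm_ring_1 alg \<Rightarrow> 'k poly) \<Rightarrow> 'k \<Rightarrow> 'k alg \<Rightarrow> 'k" where
  "eval_at \<phi> a x = poly (\<phi> x) a"

text \<open>
  The outer variable, which belongs to the right tensor factor, is evaluated at \<open>b\<close>.
\<close>
definition eval2 :: "'k::comm_ring_1 \<Rightarrow> 'k \<Rightarrow> 'k poly poly \<Rightarrow> 'k" where
  "eval2 a b t = poly (poly t [:b:]) a"

lemma character_eval_at:
  "algebra_hom scalar (\<lambda>c. [:c:]) \<phi> \<Longrightarrow> is_character (eval_at \<phi> a)"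
  by (simp add: is_character_def algebra_hom_def eval_at_def)

lemma eval2_add: "eval2 a b (s + t) = eval2 a b s + eval2 a b t"
  by (simp add: eval2_def)

lemma eval2_mult: "eval2 a b (s * t) = eval2 a b s * eval2 a b t"
  by (simp add: eval2_def)

lemma eval2_sum: "eval2 a b (\<Sum>i\<in>I. t i) = (\<Sum>i\<in>I. eval2 a b (t i))"
  by (simp add: eval2_def poly_sum)

lemma eval2_smult: "eval2 a b (smult P t) = poly P a * eval2 a b t"
  by (simp add: eval2_def)

lemma eval2_const: "eval2 a b [:[:c:]:] = c"
  by (simp add: eval2_def)

lemma poly_map_const: "poly (map_poly (\<lambda>c. [:c:]) Q) [:b:] = [:poly Q b:]"
  by (induction Q) (simp_all add: map_poly_pCons mult.commute)

lemma eval2_tensor: "eval2 a b (poly_tensor P Q) = poly P a * poly Q b"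
  by (simp add: eval2_def poly_tensor_def poly_map_const)

lemma eval2_poly2_at: "eval2 a b (poly2_at t P) = poly P (eval2 a b t)"
  unfolding poly2_at_def
proof (induction P)
  case (pCons c P)
  then show ?case by (simp add: map_poly_pCons eval2_add eval2_mult eval2_const)
qed (simp add: eval2_def)

lemma eval2_poly_Delta: "eval2 a b (poly_Delta P) = poly P (a + b)"
  by (simp add: poly_Delta_def eval2_poly2_at eval2_add eval2_tensor poly_X_def)

lemma eval2_poly_delta: "eval2 a b (poly_delta P) = poly P (a * b)"
  by (simp add: poly_delta_def eval2_poly2_at eval2_tensor poly_X_def)

lemma eval2_tensor_map:
  "eval2 a b (tensor_map \<phi> \<psi> t) = tensor_ext id (*) (eval_at \<phi> a) (eval_at \<psi> b) t"
  by (simp add: tensor_map_def tensor_ext_def eval2_sum eval2_smult eval2_tensor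
      eval_at_def case_prod_beta)

text \<open>
  Identities in the tensor square of the polynomial ring may be tested at pairs of natural numbers.
\<close>
lemma eval2_eqI:
  fixes s t :: "'k::field_char_0 poly poly"
  assumes "\<And>m n :: nat. eval2 (of_nat m) (of_nat n) s = eval2 (of_nat m) (of_nat n) t"
  shows "s = t"
proof (rule poly_eqI_infinite)
  have "inj (\<lambda>n::nat. [:of_nat n :: 'k:])" by (rule injI) simp
  then show "infinite (range (\<lambda>n::nat. [:of_nat n :: 'k:]))" by (rule range_inj_infinite)
  fix x assume "x \<in> range (\<lambda>n::nat. [:of_nat n :: 'k:])"
  then obtain n :: nat where x: "x = [:of_nat n:]" by blast
  show "poly s x = poly t x"
    unfolding x by (rule poly_eqI_nat) (use assms in \<open>simp add: eval2_def\<close>)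
qed

text \<open>
  Compatibility with \<open>\<Delta>\<close> and \<open>\<delta>\<close> says that evaluation turns sums of scalars into convolution
  products for \<open>\<Delta>\<close>, and products of scalars into \<open>\<star>\<close>-products.
\<close>
lemma eval_at_add:
  assumes "tensor_map \<phi> \<phi> \<circ> Delta = poly_Delta \<circ> \<phi>"
  shows "eval_at \<phi> (a + b) = conv (eval_at \<phi> a) (eval_at \<phi> b)"
proof
  fix x
  have "eval2 a b (tensor_map \<phi> \<phi> (Delta x)) = eval2 a b (poly_Delta (\<phi> x))"
    using assms by (metis comp_apply)
  then show "eval_at \<phi> (a + b) x = conv (eval_at \<phi> a) (eval_at \<phi> b) x"
    by (simp add: eval2_tensor_map eval2_poly_Delta conv_def) (simp add: eval_at_def)
qed

lemma eval_at_mult: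
  assumes "tensor_map \<phi> \<phi> \<circ> delta = poly_delta \<circ> \<phi>"
  shows "eval_at \<phi> (a * b) = eval_at \<phi> a \<star> eval_at \<phi> b"
proof
  fix x
  have "eval2 a b (tensor_map \<phi> \<phi> (delta x)) = eval2 a b (poly_delta (\<phi> x))"
    using assms by (metis comp_apply)
  then show "eval_at \<phi> (a * b) x = (eval_at \<phi> a \<star> eval_at \<phi> b) x"
    by (simp add: eval2_tensor_map eval2_poly_delta star_def) (simp add: eval_at_def)
qed

text \<open>
  Both compatibilities reduce to the exponent laws for convolution powers of \<open>\<epsilon>\<^sub>\<delta>\<close>.
\<close>
lemma double_bialgebra_homI:
  fixes \<phi> :: "'k::field_char_0 alg \<Rightarrow> 'k poly"
  assumes hom: "algebra_hom scalar (\<lambda>c. [:c:]) \<phi>" and ev: "\<And>n. eval_at \<phi> (of_nat n) = eps_power n"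
  shows "double_bialgebra_hom \<phi>"
  unfolding double_bialgebra_hom_def
proof (intro conjI allI ext)
  fix x
  show "(tensor_map \<phi> \<phi> \<circ> Delta) x = (poly_Delta \<circ> \<phi>) x"
  proof (rule eval2_eqI)
    fix m n :: nat
    have "eval2 (of_nat m) (of_nat n) ((tensor_map \<phi> \<phi> \<circ> Delta) x) = conv (eps_power m) (eps_power n) x"
      by (simp add: eval2_tensor_map ev conv_def)
    also have "\<dots> = eval_at \<phi> (of_nat (m + n)) x" by (simp only: ev eps_power_add)
    finally show "eval2 (of_nat m) (of_nat n) ((tensor_map \<phi> \<phi> \<circ> Delta) x) =
        eval2 (of_nat m) (of_nat n) ((poly_Delta \<circ> \<phi>) x)"
      by (simp add: eval2_poly_Delta eval_at_def)
  qed
  show "(tensor_map \<phi> \<phi> \<circ> delta) x = (poly_delta \<circ> \<phi>) x"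
  proof (rule eval2_eqI)
    fix m n :: nat
    have "eval2 (of_nat m) (of_nat n) ((tensor_map \<phi> \<phi> \<circ> delta) x) = (eps_power m \<star> eps_power n) x"
      by (simp add: eval2_tensor_map ev star_def)
    also have "\<dots> = eval_at \<phi> (of_nat (m * n)) x" by (simp only: ev eps_power_mult)
    finally show "eval2 (of_nat m) (of_nat n) ((tensor_map \<phi> \<phi> \<circ> delta) x) =
        eval2 (of_nat m) (of_nat n) ((poly_delta \<circ> \<phi>) x)"
      by (simp add: eval2_poly_delta eval_at_def)
  qed
  show "poly (\<phi> x) 0 = eps_Delta x"
    using ev[of 0] by (simp add: eps_power_0 eval_at_def fun_eq_iff)
  show "poly (\<phi> x) 1 = eps_delta x"
    using ev[of 1] unfolding eps_power_1 by (simp add: eval_at_def fun_eq_iff)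
qed (rule hom)

lemma double_bialgebra_hom_eval_nat:
  assumes \<phi>: "double_bialgebra_hom \<phi>"
  shows "eval_at \<phi> (of_nat n) = eps_power n"
proof (induction n)
  case 0
  then show ?case using \<phi> by (auto simp: double_bialgebra_hom_def eval_at_def eps_power_0)
next
  case (Suc n)
  have "eval_at \<phi> 1 = eps_delta" using \<phi> by (auto simp: double_bialgebra_hom_def eval_at_def)
  moreover have "eval_at \<phi> (1 + of_nat n) = conv (eval_at \<phi> 1) (eval_at \<phi> (of_nat n))"
    using \<phi> by (intro eval_at_add) (simp add: double_bialgebra_hom_def)
  ultimately show ?case using Suc by (simp add: eps_power_Suc)
qed

lemma unital_hom_const: "unital_hom (\<lambda>c. [:c:])"
  by (simp add: unital_hom_def one_pCons)

text \<open>
  Uniqueness: the values at natural numbers are forced, starting from the counits at \<open>0\<close> and \<open>1\<close>.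
  Existence: the forced values are polynomial in \<open>n\<close> on each generator.
\<close>
lemma ex1_double_bialgebra_hom:
  "\<exists>!\<phi> :: 'k::field_char_0 alg \<Rightarrow> 'k poly. double_bialgebra_hom \<phi>"
proof (rule ex_ex1I)
  obtain q :: "nat set set \<Rightarrow> 'k poly" where
    q: "\<And>P n. ncfam P \<Longrightarrow> poly (q P) (of_nat n) = fam (eps_power n) P"
    using eps_power_polynomial by metis
  define \<phi> :: "'k alg \<Rightarrow> 'k poly" where "\<phi> = free_ext (\<lambda>c. [:c:]) (\<lambda>p. q (blocks p))"
  have hom: "algebra_hom scalar (\<lambda>c. [:c:]) \<phi>"
    unfolding \<phi>_def by (rule algebra_hom_free_ext[OF unital_hom_const])
  have "eval_at \<phi> (of_nat n) = eps_power n" for n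
  proof (rule character_eqI[OF character_eval_at[OF hom] character_eps_power])
    fix p
    show "eval_at \<phi> (of_nat n) (gen p) = eps_power n (gen p)"
      unfolding eval_at_def \<phi>_def free_ext_gen[OF unital_hom_const] q[OF ncfam_blocks]
      by (rule fam_blocks)
  qed
  then show "\<exists>\<phi> :: 'k alg \<Rightarrow> 'k poly. double_bialgebra_hom \<phi>"
    using double_bialgebra_homI[OF hom] by blast
next
  fix \<phi> \<psi> :: "'k alg \<Rightarrow> 'k poly"
  assume "double_bialgebra_hom \<phi>" "double_bialgebra_hom \<psi>"
  then have "eval_at \<phi> (of_nat n) = eval_at \<psi> (of_nat n)" for n
    by (simp add: double_bialgebra_hom_eval_nat)
  then show "\<phi> = \<psi>"
    by (intro ext poly_eqI_nat) (metis eval_at_def)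
qed

lemma double_bialgebra_hom_phi_NCP: "double_bialgebra_hom phi_NCP"
  unfolding phi_NCP_def by (rule theI'[OF ex1_double_bialgebra_hom])

lemma double_bialgebra_homD:
  assumes "double_bialgebra_hom \<phi>"
  shows "algebra_hom scalar (\<lambda>c. [:c:]) \<phi>"
    "tensor_map \<phi> \<phi> \<circ> Delta = poly_Delta \<circ> \<phi>"
    "tensor_map \<phi> \<phi> \<circ> delta = poly_delta \<circ> \<phi>"
    "eval_at \<phi> 0 = eps_Delta" "eval_at \<phi> 1 = eps_delta"
  using assms by (auto simp: double_bialgebra_hom_def eval_at_def)

lemmas phi_NCP_hom = double_bialgebra_homD[OF double_bialgebra_hom_phi_NCP]

lemma mu_NCP_eq_eval_at: "mu_NCP = eval_at phi_NCP (- 1)"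
  by (rule ext) (simp add: mu_NCP_def eval_at_def)

lemma character_mu_NCP: "is_character mu_NCP"
  unfolding mu_NCP_eq_eval_at by (rule character_eval_at[OF phi_NCP_hom(1)])

text \<open>
  Evaluation at \<open>(-1) + 1 = 0\<close>; the next lemma is evaluation at \<open>(-1) * (-1) = 1\<close>.
\<close>
lemma conv_mu_NCP_eps_delta: "conv mu_NCP eps_delta = (eps_Delta :: 'k::field_char_0 alg \<Rightarrow> 'k)"
  using eval_at_add[OF phi_NCP_hom(2), of "- 1 :: 'k" 1] by (simp add: phi_NCP_hom mu_NCP_eq_eval_at)

lemma mu_NCP_star_mu_NCP: "mu_NCP \<star> mu_NCP = (eps_delta :: 'k::field_char_0 alg \<Rightarrow> 'k)"
  using eval_at_mult[OF phi_NCP_hom(3), of "- 1 :: 'k" "- 1"] by (simp add: phi_NCP_hom mu_NCP_eq_eval_at)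

section \<open>The inverses of the constant characters\<close>

lemma fam_lam_s_gamma:
  assumes P: "ncfam P"
  shows "fam (lam_s \<star> gamma_m1) P = (flat_sign P :: 'k::comm_ring_1)"
proof -
  have "fam (lam_s \<star> gamma_m1) P = (cstar flat_ind (one_block (- 1)) P :: 'k)"
    using P by (simp add: fam_star character_constants fam_lam_s fam_gamma_m1 cong: cstar_cong)
  then show ?thesis by (simp add: cstar_one_block_right[OF P] flat_ind_def flat_sign_def)
qed

lemma conv_lam: "conv lam (lam_s \<star> gamma_m1) = (eps_Delta :: 'k::comm_ring_1 alg \<Rightarrow> 'k)"
proof (rule character_eq_fam)
  fix P assume P: "ncfam P"
  have "fam (conv lam (lam_s \<star> gamma_m1)) P = (cconv (\<lambda>_. 1) flat_sign P :: 'k)"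
    using P by (simp add: fam_conv character_star character_constants fam_lam fam_lam_s_gamma
        cong: cconv_cong)
  then show "fam (conv lam (lam_s \<star> gamma_m1)) P = (fam eps_Delta P :: 'k)"
    by (simp add: cconv_const_flat_sign[OF P] fam_eps_Delta[OF P])
qed (intro character_conv character_star character_constants)+

text \<open>
  Put \<open>\<kappa> = \<lambda>\<^sup>s \<star> \<gamma>\<^sub>-\<^sub>1\<close>. Both \<open>\<lambda>\<close> and \<open>\<mu>\<^sub>N\<^sub>C\<^sub>P \<star> \<kappa>\<close> are left inverse to \<open>\<kappa>\<close> for the convolution of
  \<open>\<Delta>\<close>, the latter by the cointeraction since \<open>\<mu>\<^sub>N\<^sub>C\<^sub>P\<close> is inverse to \<open>\<epsilon>\<^sub>\<delta>\<close>.
\<close>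
lemma lam_eq: "(lam :: 'k::field_char_0 alg \<Rightarrow> 'k) = mu_NCP \<star> lam_s \<star> gamma_m1"
proof -
  let ?k = "lam_s \<star> gamma_m1 :: 'k alg \<Rightarrow> 'k"
  have k: "is_character ?k" by (intro character_star character_constants)
  have "conv (mu_NCP \<star> ?k) (eps_delta \<star> ?k) = conv mu_NCP eps_delta \<star> ?k"
    by (rule star_conv_distrib[OF character_mu_NCP character_constants(1) k, symmetric])
  then have "conv (mu_NCP \<star> ?k) ?k = conv lam ?k"
    by (simp add: eps_delta_star k conv_mu_NCP_eps_delta eps_Delta_star conv_lam)
  then have "mu_NCP \<star> ?k = lam"
    by (rule conv_right_cancel[OF character_star[OF character_mu_NCP k] character_constants(3) k])
  then show ?thesis
    by (simp add: star_assoc character_mu_NCP character_constants)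
qed

lemma star_inverse_eqI:
  assumes "is_character \<alpha>" "is_character \<beta>" "\<alpha> \<star> \<beta> = eps_delta" "\<beta> \<star> \<alpha> = eps_delta"
  shows "star_inverse \<alpha> = \<beta>"
  unfolding star_inverse_def
proof (rule the_equality)
  fix \<gamma> assume \<gamma>: "is_character \<gamma> \<and> \<alpha> \<star> \<gamma> = eps_delta \<and> \<gamma> \<star> \<alpha> = eps_delta"
  have "\<gamma> = \<gamma> \<star> (\<alpha> \<star> \<beta>)" using \<gamma> assms by (simp add: star_eps_delta)
  also have "\<dots> = \<gamma> \<star> \<alpha> \<star> \<beta>" using \<gamma> assms by (intro star_assoc[symmetric]) auto
  also have "\<dots> = \<beta>" using \<gamma> assms by (simp add: eps_delta_star)
  finally show "\<gamma> = \<beta>" .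
qed (use assms in simp)

text \<open>
  The explicit candidate for \<open>\<mu>\<^sup>s\<close>.
\<close>
definition nu_s :: "'k::comm_ring_1 alg \<Rightarrow> 'k" where
  "nu_s = free_ext id (\<lambda>p. flat_inv (blocks p))"

lemma character_nu_s: "is_character nu_s"
  unfolding nu_s_def by (rule character_free_ext)

lemma fam_nu_s: "ncfam P \<Longrightarrow> fam nu_s P = flat_inv P"
proof (rule fam_eqI)
  show "relabel_invariant flat_inv"
    by (simp add: relabel_invariant_def flat_inv_def flat_relabel_iff card_relabel)
qed (simp_all add: nu_s_def free_ext_gen unital_hom_id flat_inv_def flat_def)

lemma lam_s_star_nu_s: "lam_s \<star> nu_s = (eps_delta :: 'k::comm_ring_1 alg \<Rightarrow> 'k)"
proof (rule character_eq_fam)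
  fix P assume P: "ncfam P"
  have "fam (lam_s \<star> nu_s) P = (cstar flat_ind flat_inv P :: 'k)"
    using P by (simp add: fam_star character_constants character_nu_s fam_lam_s fam_nu_s cong: cstar_cong)
  then show "fam (lam_s \<star> nu_s) P = (fam eps_delta P :: 'k)"
    by (simp add: cstar_flat_ind_flat_inv[OF P] fam_eps_delta[OF P])
qed (intro character_star character_constants character_nu_s)+

lemma nu_s_star_lam_s: "nu_s \<star> lam_s = (eps_delta :: 'k::comm_ring_1 alg \<Rightarrow> 'k)"
proof (rule character_eq_fam)
  fix P assume P: "ncfam P"
  have "fam (nu_s \<star> lam_s) P = (cstar flat_inv flat_ind P :: 'k)"
    using P by (simp add: fam_star character_constants character_nu_s fam_lam_s fam_nu_s cong: cstar_cong)
  then show "fam (nu_s \<star> lam_s) P = (fam eps_delta P :: 'k)"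
    by (simp add: cstar_flat_inv_flat_ind[OF P] fam_eps_delta[OF P])
qed (intro character_star character_constants character_nu_s)+

lemma mu_s_eq: "mu_s = nu_s"
  unfolding mu_s_def
  by (rule star_inverse_eqI[OF character_constants(4) character_nu_s lam_s_star_nu_s nu_s_star_lam_s])

lemma fam_gamma_star:
  assumes "is_character \<alpha>" and P: "ncfam P" "P \<noteq> {}"
  shows "fam (gamma_m1 \<star> \<alpha>) P = - fam \<alpha> P"
proof -
  have "fam (gamma_m1 \<star> \<alpha>) P = cstar (one_block (- 1)) (fam \<alpha>) P"
    using assms by (simp add: fam_star character_constants fam_gamma_m1 cong: cstar_cong)
  then show ?thesis by (simp add: cstar_one_block_left[OF P])
qed

lemma gamma_star_gamma: "gamma_m1 \<star> gamma_m1 = (eps_delta :: 'k::comm_ring_1 alg \<Rightarrow> 'k)"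
proof (rule character_eq_fam)
  fix P assume P: "ncfam P"
  show "fam (gamma_m1 \<star> gamma_m1) P = (fam eps_delta P :: 'k)"
  proof (cases "P = {}")
    case False
    then show ?thesis
      using P by (simp add: fam_gamma_star character_constants fam_gamma_m1 fam_eps_delta one_block_def)
  qed (simp add: fam_empty)
qed (intro character_star character_constants)+

text \<open>
  Inversion reverses the factorization of \<open>\<lambda>\<close>, and \<open>\<gamma>\<^sub>-\<^sub>1\<close> and \<open>\<mu>\<^sub>N\<^sub>C\<^sub>P\<close> are involutions for \<open>\<star>\<close>.
\<close>
lemma mu_eq: "(mu :: 'k::field_char_0 alg \<Rightarrow> 'k) = gamma_m1 \<star> mu_s \<star> mu_NCP"
proof -
  let ?b = "gamma_m1 \<star> nu_s \<star> mu_NCP :: 'k alg \<Rightarrow> 'k"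
  note char = character_star character_constants character_nu_s character_mu_NCP
  have cancel: "\<alpha> \<star> (\<beta> \<star> \<gamma>) = \<gamma>" if "\<alpha> \<star> \<beta> = eps_delta" "is_character \<alpha>" "is_character \<beta>" "is_character \<gamma>"
    for \<alpha> \<beta> \<gamma> :: "'k alg \<Rightarrow> 'k"
    using that by (simp add: eps_delta_star flip: star_assoc)
  have "lam \<star> ?b = eps_delta"
    unfolding lam_eq
    by (simp add: star_assoc char cancel[OF gamma_star_gamma] cancel[OF lam_s_star_nu_s]
        mu_NCP_star_mu_NCP)
  moreover have "?b \<star> lam = eps_delta"
    unfolding lam_eq
    by (simp add: star_assoc char cancel[OF mu_NCP_star_mu_NCP] cancel[OF nu_s_star_lam_s]
        gamma_star_gamma)
  ultimately show ?thesis
    unfolding mu_def mu_s_eq by (intro star_inverse_eqI char)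
qed

lemma blocks_quot_ncp:
  assumes r: "r \<in> nc_equivs p"
  shows "blocks (quot_ncp p r) = merge p r" "card (merge p r) = card (blocks p // r)"
proof -
  have P: "ncfam (blocks p)" by (rule ncfam_blocks)
  have eq: "equiv (blocks p) r" "noncrossing (Union ` (blocks p // r))"
    using r unfolding nc_equivs_def merge_def by blast+
  note m = merge_coarsening[OF P eq]
  obtain n where n: "\<Union>(blocks p) = {1..n}" using Union_blocks by blast
  show "blocks (quot_ncp p r) = merge p r"
    unfolding quot_ncp_def merge_def
  proof (rule blocks_ncp_of)
    show "ncfam (Union ` (blocks p // r))" by (rule coarsening_ncfam[OF P m(1)])
    show "Union ` (blocks p // r) \<noteq> {}"
      using coarsening_empty_iff[OF P m(1)] blocks_nonempty by simp
    show "\<Union>(Union ` (blocks p // r)) = {1..n}" using coarsening_Union[OF P m(1)] n by simp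
  qed
  show "card (merge p r) = card (blocks p // r)" unfolding merge_def by (rule card_image[OF m(3)])
qed

lemma finite_nc_equivs: "finite (nc_equivs p)"
proof (rule finite_subset)
  show "nc_equivs p \<subseteq> Pow (blocks p \<times> blocks p)"
    using equiv_type unfolding nc_equivs_def by blast
  show "finite (Pow (blocks p \<times> blocks p))" using ncfam_finite[OF ncfam_blocks] by simp
qed

lemma gamma_star_nu_s_gen:
  "(gamma_m1 \<star> nu_s) (gen q) =
    (if blocks q = Base q then (- 1) ^ card (blocks q) else 0 :: 'k::comm_ring_1)"
proof -
  have Q: "ncfam (blocks q)" "blocks q \<noteq> {}" by (rule ncfam_blocks blocks_nonempty)+
  have "card (blocks q) = Suc (card (blocks q) - 1)"
    using ncfam_finite[OF Q(1)] Q(2) by (simp add: card_gt_0_iff)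
  then have "(- 1 :: 'k) ^ card (blocks q) = (- 1) ^ Suc (card (blocks q) - 1)" by argo
  moreover have "(gamma_m1 \<star> nu_s) (gen q) = (- nu_s (gen q) :: 'k)"
    using fam_gamma_star[OF character_nu_s Q] by (simp add: fam_blocks)
  moreover have "nu_s (gen q) = (flat_inv (blocks q) :: 'k)"
    using fam_nu_s[OF Q(1)] by (simp add: fam_blocks)
  ultimately show ?thesis by (simp add: flat_inv_def Base_iff_flat)
qed

theorem proposition4p20:
  shows "(lam :: 'k::field_char_0 alg \<Rightarrow> 'k) = mu_NCP \<star> lam_s \<star> gamma_m1 \<and>
    (mu :: 'k alg \<Rightarrow> 'k) = gamma_m1 \<star> mu_s \<star> mu_NCP \<and>
    (\<forall>p :: ncp. (mu (gen p) :: 'k) =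
      (\<Sum>r \<in> {r \<in> nc_equivs p. blocks (quot_ncp p r) = Base (quot_ncp p r)}.
         (- 1) ^ card (blocks p // r) * mu_NCP (mon (restr_equiv_mon p r))))"
proof (intro conjI allI)
  show "(lam :: 'k alg \<Rightarrow> 'k) = mu_NCP \<star> lam_s \<star> gamma_m1" by (rule lam_eq)
  show mu: "(mu :: 'k alg \<Rightarrow> 'k) = gamma_m1 \<star> mu_s \<star> mu_NCP" by (rule mu_eq)
  fix p :: ncp
  have "(mu (gen p) :: 'k) =
    (\<Sum>r\<in>nc_equivs p. (gamma_m1 \<star> nu_s) (gen (quot_ncp p r)) * mu_NCP (mon (restr_equiv_mon p r)))"
    unfolding mu mu_s_eq by (rule star_gen)
  also have "\<dots> = (\<Sum>r \<in> {r \<in> nc_equivs p. blocks (quot_ncp p r) = Base (quot_ncp p r)}.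
         (- 1) ^ card (blocks p // r) * mu_NCP (mon (restr_equiv_mon p r)))"
  proof (rule sum.mono_neutral_cong_right[OF finite_nc_equivs])
    have "(gamma_m1 \<star> nu_s) (gen (quot_ncp p r)) =
        (if blocks (quot_ncp p r) = Base (quot_ncp p r) then (- 1) ^ card (blocks p // r) else 0 :: 'k)"
      if "r \<in> nc_equivs p" for r
      by (simp only: gamma_star_nu_s_gen blocks_quot_ncp[OF that])
    note gamma = this
    show "\<forall>r\<in>nc_equivs p - {r \<in> nc_equivs p. blocks (quot_ncp p r) = Base (quot_ncp p r)}.
        (gamma_m1 \<star> nu_s) (gen (quot_ncp p r)) * mu_NCP (mon (restr_equiv_mon p r)) = (0 :: 'k)"
      by (simp add: gamma)
    show "(gamma_m1 \<star> nu_s) (gen (quot_ncp p r)) * mu_NCP (mon (restr_equiv_mon p r)) =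
        ((- 1) ^ card (blocks p // r) * mu_NCP (mon (restr_equiv_mon p r)) :: 'k)"
      if "r \<in> {r \<in> nc_equivs p. blocks (quot_ncp p r) = Base (quot_ncp p r)}" for r
      using that by (simp add: gamma)
  qed blast
  finally show "(mu (gen p) :: 'k) =
      (\<Sum>r \<in> {r \<in> nc_equivs p. blocks (quot_ncp p r) = Base (quot_ncp p r)}.
         (- 1) ^ card (blocks p // r) * mu_NCP (mon (restr_equiv_mon p r)))" .
qed

end
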